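(* Let $V$ be an irreducible uniformly bounded weight module for $(\tilde{\mathcal{H}}_N\ltimes A_N)\otimes B$ such that $t^{\mathbf{s}}$ acts non-trivially on $V$ for some $\mathbf{0}\neq\mathbf{s}\in\mathbb{Z}^N$ and $t^{\mathbf{0}}$ acts non-trivially on $V$ (hence by a nonzero scalar $c$, as $t^{\mathbf 0}$ is central). Then there is $\lambda\in P(V)$ such that, with $\Lambda=(\lambda(d_i))_{i=1}^N\in\mathbb{C}^N$: (1) $V=\bigoplus_{\mathbf{r}\in\mathbb{Z}^N}V_{\Lambda+\mathbf{r}}$, where $V_{\Lambda+\mathbf{r}}=\{v\in V\mid D(u,\mathbf{0})v=(u,\Lambda+\mathbf{r})v\ \ \forall u\in\mathbb{C}^N\}$; the elements $t^{\mathbf{r}}$ act injectively on $V$ for every $\mathbf{r}\in\mathbb{Z}^N$; and $P(V)=\lambda+\sum_{i=1}^N\mathbb{Z}\delta_i$. (2) There exist an algebra homomorphism $\psi:B\to\mathbb{C}$ with $\psi(1)=1$, a linear map $\phi:B\to\mathbb{C}$ with $\phi(1)=1$, and a bilinear function $f:\mathbb{C}^N\times B\to\mathbb{C}$ with $f(u,1)=(u,\Lambda)$ such that, for all $b\in B$, \begin{align*} t^{\mathbf{r}}b&=\psi(b)t^{\mathbf{r}}\ \text{ on } V,\ \text{ for } \mathbf{r}\neq\mathbf{0},\\ t^{\mathbf{0}}b&=\phi(b)t^{\mathbf{0}}\ \text{ on } V,\\ D(\overline{\mathbf{r}},\mathbf{r})b&=\psi(b)D(\overline{\mathbf{r}},\mathbf{r})\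 \text{ on } V,\ \text{ for } \mathbf{r}\neq\mathbf{0},\\ D(u,\mathbf{0})b\cdot v&=(f(u,b)+(u,\mathbf{r})\psi(b))v,\ \text{ for } u\in\mathbb{C}^N,\ v\in V_{\Lambda+\mathbf{r}},\ \mathbf{r}\in\mathbb{Z}^N. \end{align*} (3) With these $\psi,\phi$, the action of $A_N\otimes B$ on $V$ is quasi-associative: there are nonzero complex numbers $\kappa,\mu$ with $\kappa^2=c\mu$ such that, as operators on $V$, for all $b,b'\in B$, $$t^{\mathbf{m}}b\cdot t^{\mathbf{n}}b'=\begin{cases}\kappa\, t^{\mathbf{m}+\mathbf{n}}(bb')=\psi(bb')\kappa\, t^{\mathbf{m}+\mathbf{n}},&\mathbf{m},\mathbf{n},\mathbf{m}+\mathbf{n}\in\mathbb{Z}^N\setminus\{\mathbf{0}\},\\ \psi(bb')\mu\, t^{\mathbf{0}},&\mathbf{m},\mathbf{n}\in\mathbb{Z}^N\setminus\{\mathbf{0}\},\ \mathbf{m}+\mathbf{n}=\mathbf{0},\\ \psi(b)\phi(b')c\, t^{\mathbf{m}},&\mathbf{m}\neq\mathbf{0},\ \mathbf{n}=\mathbf{0},\\ \phi(b)\phi(b')c\, t^{\mathbf{0}},&\mathbf{m}=\mathbf{n}=\mathbf{0}.\end{cases}$$ (4) For every $0\neq v\in V$, $\mathcal{U}((\tilde{\mathcal{H}}_N\ltimes A_N)\otimes B)\cdot v=\mathcal{U}(\tilde{\mathcal{H}}_N\ltimes A_N)\cdot v$. Therefore $V$ is an irreducible uniformly bounded Harish-Chandra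 module for $\tilde{\mathcal{H}}_N\ltimes A_N$; in particular $V$ is an irreducible jet module for the Lie algebra $\tilde{\mathcal{H}}_N$.
   Context: All vector spaces, algebras and tensor products are over $\mathbb{C}$; $B$ is a finitely generated commutative associative unital algebra; $N=2m$ with $m$ a positive integer. $A_N=\mathbb{C}[t_1^{\pm1},\dots,t_N^{\pm1}]$, $t^{\mathbf{n}}=t_1^{n_1}\cdots t_N^{n_N}$ for $\mathbf{n}\in\mathbb{Z}^N$, $d_i=t_i\frac{d}{dt_i}$, $(x,y)=(x|y)=\sum_i x_iy_i$ on $\mathbb{C}^N$. For $u\in\mathbb{C}^N$, $\mathbf{r}\in\mathbb{Z}^N$ put $D(u,\mathbf{r})=\sum_iu_it^{\mathbf{r}}d_i$, with $[D(u,\mathbf{r}),D(v,\mathbf{s})]=D((u,\mathbf{s})v-(v,\mathbf{r})u,\mathbf{r}+\mathbf{s})$. For $\mathbf{r}=(r_1,\dots,r_{2m})$ put $\overline{\mathbf{r}}=(r_{m+1},\dots,r_{2m},-r_1,\dots,-r_m)$ and $h_{\mathbf{r}}=D(\overline{\mathbf{r}},\mathbf{r})$. $\mathcal{H}_N=\mathrm{span}\{h_{\mathbf{r}}\mid\mathbf{r}\in\mathbb{Z}^N\}$, $\mathfrak{h}=\mathrm{span}\{d_1,\dots,d_N\}=\{D(u,\mathbf{0})\mid u\in\mathbb{C}^N\}$, $\tilde{\mathcal{H}}_N=\mathcal{H}_N\rtimes\mathfrak{h}$. In $\tilde{\mathcal{H}}_N\ltimes A_N$, $A_N$ is an abelian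 ideal and $[D(u,\mathbf{r}),t^{\mathbf{s}}]=(u,\mathbf{s})t^{\mathbf{r}+\mathbf{s}}$. For a Lie algebra $\mathfrak{g}$, $\mathfrak{g}\otimes B$ has bracket $[x\otimes b_1,y\otimes b_2]=[x,y]\otimes b_1b_2$. Write $xb$ for $x\otimes b$ and identify $x$ with $x\otimes1$. $\mathfrak{h}$ is the Cartan subalgebra; $\delta_i\in\mathfrak{h}^*$ is given by $\delta_i(d_j)=\delta_{ij}$. A weight module is a module with $V=\bigoplus_{\lambda\in\mathfrak{h}^*}V_\lambda$, $V_\lambda=\{v\mid hv=\lambda(h)v\ \forall h\in\mathfrak{h}\}$; $P(V)=\{\lambda\mid V_\lambda\neq0\}$. A Harish-Chandra module is a weight module with finite-dimensional weight spaces; it is uniformly bounded if there is a positive integer $M$ with $\dim V_\lambda\le M$ for all $\lambda$. $\mathcal{U}(\cdot)$ denotes the universal enveloping algebra. Jet module (object of category $\mathcal{J}$) for $\tilde{\mathcal{H}}_N$: an $\mathfrak h$-weight module over $\tilde{\mathcal{H}}_N$ with finite-dimensional weight spaces that admits an action of the commutative associative unital algebra $A_N$ compatible with the $\tilde{\mathcal{H}}_N$-action, i.e. $x(gv)=x(g)v+g(xv)$ for $x\in\tilde{\mathcal{H}}_N$, $g\in A_N$; irreducible means having no proper nonzero subspace stable under both actions. *)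

theory Defs
  imports "HOL-Analysis.Analysis" "HOL-Library.Poly_Mapping"
begin

section \<open>Vector spaces, Lie algebras and modules over the complex numbers\<close>

definition fin_dim :: "(complex \<Rightarrow> 'v::ab_group_add \<Rightarrow> 'v) \<Rightarrow> 'v set \<Rightarrow> bool" where
  "fin_dim scl W \<longleftrightarrow> (\<exists>S. finite S \<and> W = module.span scl S)"

definition is_direct_sum ::
  "(complex \<Rightarrow> 'v::ab_group_add \<Rightarrow> 'v) \<Rightarrow> 'i set \<Rightarrow> ('i \<Rightarrow> 'v set) \<Rightarrow> bool" where
  "is_direct_sum scl I W \<longleftrightarrow>
     (\<forall>i\<in>I. module.subspace scl (W i)) \<and>
     (\<forall>v. \<exists>!f. (\<forall>i\<in>I. f i \<in> W i) \<and> (\<forall>i. i \<notin> I \<longrightarrow> f i = 0) \<and>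
               finite {i. f i \<noteq> 0} \<and> v = (\<Sum>i | f i \<noteq> 0. f i))"

locale comm_algebra = vector_space scl
  for scl :: "complex \<Rightarrow> 'b::comm_ring_1 \<Rightarrow> 'b" +
  assumes scale_mult_left: "scl c (x * y) = scl c x * y"

definition finitely_generated_algebra :: "(complex \<Rightarrow> 'b::comm_ring_1 \<Rightarrow> 'b) \<Rightarrow> bool" where
  "finitely_generated_algebra scl \<longleftrightarrow>
     (\<exists>S. finite S \<and>
        (\<forall>A. module.subspace scl A \<and> 1 \<in> A \<and> (\<forall>x\<in>A. \<forall>y\<in>A. x * y \<in> A) \<and> S \<subseteq> A
             \<longrightarrow> A = UNIV))"

definition algebra_hom_to_C :: "(complex \<Rightarrow> 'b::comm_ring_1 \<Rightarrow> 'b) \<Rightarrow> ('b \<Rightarrow> complex) \<Rightarrow> bool" where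
  "algebra_hom_to_C scl \<psi> \<longleftrightarrow>
     Vector_Spaces.linear scl (*) \<psi> \<and> (\<forall>x y. \<psi> (x * y) = \<psi> x * \<psi> y)"

text \<open>
  A Lie algebra is given by its carrier \<open>L\<close>, a subspace of an ambient type, and by a bracket
  on the ambient type; nothing is required of the action outside \<open>L\<close>.
\<close>

locale lie_algebra = vector_space sclL
  for sclL :: "complex \<Rightarrow> 'l::ab_group_add \<Rightarrow> 'l" +
  fixes L :: "'l set" and brk :: "'l \<Rightarrow> 'l \<Rightarrow> 'l"
  assumes L_subspace: "module.subspace sclL L"
    and brk_closed: "x \<in> L \<Longrightarrow> y \<in> L \<Longrightarrow> brk x y \<in> L"
    and brk_linear: "x \<in> L \<Longrightarrow> y \<in> L \<Longrightarrow> z \<in> L \<Longrightarrow> brk (x + y) z = brk x z + brk y z"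
      "x \<in> L \<Longrightarrow> y \<in> L \<Longrightarrow> brk (sclL c x) y = sclL c (brk x y)"
    and brk_alternating: "x \<in> L \<Longrightarrow> brk x x = 0"
    and brk_jacobi: "x \<in> L \<Longrightarrow> y \<in> L \<Longrightarrow> z \<in> L \<Longrightarrow>
      brk x (brk y z) + brk y (brk z x) + brk z (brk x y) = 0"

locale lie_module = lie_algebra sclL L brk + V: vector_space sclV
  for sclL :: "complex \<Rightarrow> 'l::ab_group_add \<Rightarrow> 'l" and L brk
    and sclV :: "complex \<Rightarrow> 'v::ab_group_add \<Rightarrow> 'v" +
  fixes act :: "'l \<Rightarrow> 'v \<Rightarrow> 'v"
  assumes act_linear: "x \<in> L \<Longrightarrow> Vector_Spaces.linear sclV sclV (act x)"
    and act_add: "x \<in> L \<Longrightarrow> y \<in> L \<Longrightarrow> act (x + y) v = act x v + act y v"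
    and act_scale: "x \<in> L \<Longrightarrow> act (sclL c x) v = sclV c (act x v)"
    and act_brk: "x \<in> L \<Longrightarrow> y \<in> L \<Longrightarrow> act (brk x y) v = act x (act y v) - act y (act x v)"

definition irreducible_lie_module ::
  "(complex \<Rightarrow> 'l::ab_group_add \<Rightarrow> 'l) \<Rightarrow> 'l set \<Rightarrow> ('l \<Rightarrow> 'l \<Rightarrow> 'l)
     \<Rightarrow> (complex \<Rightarrow> 'v::ab_group_add \<Rightarrow> 'v) \<Rightarrow> ('l \<Rightarrow> 'v \<Rightarrow> 'v) \<Rightarrow> bool" where
  "irreducible_lie_module sclL L brk sclV act \<longleftrightarrow>
     lie_module sclL L brk sclV act \<and> (\<exists>v::'v. v \<noteq> 0) \<and>
     (\<forall>W. module.subspace sclV W \<and> (\<forall>x\<in>L. \<forall>w\<in>W. act x w \<in> W) \<longrightarrow> W = {0} \<or> W = UNIV)"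

text \<open>
  The universal enveloping algebra of \<open>L\<close> is spanned by the monomials \<open>x\<^sub>1 \<dots> x\<^sub>k\<close> (\<open>k \<ge> 0\<close>) in
  elements of \<open>L\<close>, and such a monomial acts on a module as the composition of its factors.
\<close>

definition U_orbit ::
  "(complex \<Rightarrow> 'v::ab_group_add \<Rightarrow> 'v) \<Rightarrow> 'l set \<Rightarrow> ('l \<Rightarrow> 'v \<Rightarrow> 'v) \<Rightarrow> 'v \<Rightarrow> 'v set" where
  "U_orbit sclV L act v = module.span sclV {foldr act xs v | xs. set xs \<subseteq> L}"


section \<open>Weights\<close>

text \<open>
  The coordinates \<open>1, \<dots>, N = 2m\<close> are indexed by \<open>'m + 'm\<close> with \<open>CARD('m) = m\<close>: \<open>Inl\<close> gives
  the first \<open>m\<close> of them and \<open>Inr\<close> the last \<open>m\<close>.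
\<close>

type_synonym 'm cvec = "complex ^ ('m + 'm)"
type_synonym 'm ivec = "int ^ ('m + 'm)"

definition cvec :: "'m::finite ivec \<Rightarrow> 'm cvec" where
  "cvec r = (\<chi> i. of_int (r $ i))"

text \<open>The bilinear form on complex vectors; the library's \<open>\<bullet>\<close> is the real inner product.\<close>

definition dotc :: "'m::finite cvec \<Rightarrow> 'm cvec \<Rightarrow> complex" where
  "dotc u v = (\<Sum>i\<in>UNIV. u $ i * v $ i)"

definition bar :: "'m::finite ivec \<Rightarrow> 'm ivec" where
  "bar r = (\<chi> i. case i of Inl j \<Rightarrow> r $ Inr j | Inr j \<Rightarrow> - (r $ Inl j))"

text \<open>
  The Cartan subalgebra consists of the \<open>D(u,0)\<close> and is identified with the space of all \<open>u\<close>; a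
  weight \<open>l\<close> is the linear functional \<open>u \<mapsto> l(D(u,0))\<close>, so that \<open>l(d\<^sub>i)\<close> is \<open>l (axis i 1)\<close>.
  Below, \<open>hact u\<close> is the operator by which \<open>D(u,0)\<close> acts on \<open>V\<close>.
\<close>

definition h_dual :: "('m::finite cvec \<Rightarrow> complex) set" where
  "h_dual = {l. Vector_Spaces.linear (*s) (*) l}"

definition weight_space ::
  "(complex \<Rightarrow> 'v::ab_group_add \<Rightarrow> 'v) \<Rightarrow> ('m::finite cvec \<Rightarrow> 'v \<Rightarrow> 'v)
     \<Rightarrow> ('m cvec \<Rightarrow> complex) \<Rightarrow> 'v set" where
  "weight_space sclV hact l = {v. \<forall>u. hact u v = sclV (l u) v}"

definition weights ::
  "(complex \<Rightarrow> 'v::ab_group_add \<Rightarrow> 'v) \<Rightarrow> ('m::finite cvec \<Rightarrow> 'v \<Rightarrow> 'v)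
     \<Rightarrow> ('m cvec \<Rightarrow> complex) set" where
  "weights sclV hact = {l \<in> h_dual. weight_space sclV hact l \<noteq> {0}}"

definition weight_module ::
  "(complex \<Rightarrow> 'v::ab_group_add \<Rightarrow> 'v) \<Rightarrow> ('m::finite cvec \<Rightarrow> 'v \<Rightarrow> 'v) \<Rightarrow> bool" where
  "weight_module sclV hact \<longleftrightarrow> is_direct_sum sclV h_dual (weight_space sclV hact)"

definition harish_chandra ::
  "(complex \<Rightarrow> 'v::ab_group_add \<Rightarrow> 'v) \<Rightarrow> ('m::finite cvec \<Rightarrow> 'v \<Rightarrow> 'v) \<Rightarrow> bool" where
  "harish_chandra sclV hact \<longleftrightarrow>
     weight_module sclV hact \<and> (\<forall>l\<in>h_dual. fin_dim sclV (weight_space sclV hact l))"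

definition uniformly_bounded ::
  "(complex \<Rightarrow> 'v::ab_group_add \<Rightarrow> 'v) \<Rightarrow> ('m::finite cvec \<Rightarrow> 'v \<Rightarrow> 'v) \<Rightarrow> bool" where
  "uniformly_bounded sclV hact \<longleftrightarrow>
     harish_chandra sclV hact \<and>
     (\<exists>M::nat. M > 0 \<and> (\<forall>l\<in>h_dual. vector_space.dim sclV (weight_space sclV hact l) \<le> M))"


section \<open>Laurent polynomials and vector fields\<close>

text \<open>
  Everything is defined for coefficients in an arbitrary commutative ring \<open>'b\<close>. For \<open>'b = complex\<close>,
  \<open>('m, 'b) laurent\<close> is \<open>A\<^sub>N\<close> with its multiplication; in general it is \<open>A\<^sub>N \<otimes> B\<close>. An element
  \<open>X\<close> of \<open>('m, 'b) vfield\<close> stands for \<open>\<Sum>\<^sub>i X\<^sub>i d\<^sub>i\<close>, and a pair \<open>(X, f)\<close> for \<open>X + f\<close>.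
\<close>

type_synonym ('m, 'b) laurent = "'m ivec \<Rightarrow>\<^sub>0 'b"
type_synonym ('m, 'b) vfield = "('m, 'b) laurent ^ ('m + 'm)"
type_synonym ('m, 'b) ext = "('m, 'b) vfield \<times> ('m, 'b) laurent"

definition deg_der :: "'m + 'm \<Rightarrow> ('m::finite, 'b::comm_ring_1) laurent \<Rightarrow> ('m, 'b) laurent" where
  "deg_der i f = Poly_Mapping.mapp (\<lambda>s c. of_int (s $ i) * c) f"

definition vf_app ::
  "('m::finite, 'b::comm_ring_1) vfield \<Rightarrow> ('m, 'b) laurent \<Rightarrow> ('m, 'b) laurent" where
  "vf_app X f = (\<Sum>i\<in>UNIV. X $ i * deg_der i f)"

definition vf_brk ::
  "('m::finite, 'b::comm_ring_1) vfield \<Rightarrow> ('m, 'b) vfield \<Rightarrow> ('m, 'b) vfield" where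
  "vf_brk X Y = (\<chi> j. vf_app X (Y $ j) - vf_app Y (X $ j))"

definition ext_brk ::
  "('m::finite, 'b::comm_ring_1) ext \<Rightarrow> ('m, 'b) ext \<Rightarrow> ('m, 'b) ext" where
  "ext_brk x y = (vf_brk (fst x) (fst y), vf_app (fst x) (snd y) - vf_app (fst y) (snd x))"

definition laurent_scale ::
  "(complex \<Rightarrow> 'b \<Rightarrow> 'b) \<Rightarrow> complex \<Rightarrow> ('m::finite, 'b::comm_ring_1) laurent \<Rightarrow> ('m, 'b) laurent" where
  "laurent_scale scl c f = Poly_Mapping.map (scl c) f"

definition vf_scale ::
  "(complex \<Rightarrow> 'b \<Rightarrow> 'b) \<Rightarrow> complex \<Rightarrow> ('m::finite, 'b::comm_ring_1) vfield \<Rightarrow> ('m, 'b) vfield" where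
  "vf_scale scl c X = (\<chi> i. laurent_scale scl c (X $ i))"

definition ext_scale ::
  "(complex \<Rightarrow> 'b \<Rightarrow> 'b) \<Rightarrow> complex \<Rightarrow> ('m::finite, 'b::comm_ring_1) ext \<Rightarrow> ('m, 'b) ext" where
  "ext_scale scl c x = (vf_scale scl c (fst x), laurent_scale scl c (snd x))"

definition vD :: "'m::finite cvec \<Rightarrow> 'm ivec \<Rightarrow> ('m, complex) vfield" where
  "vD u r = (\<chi> i. Poly_Mapping.single r (u $ i))"

definition H_N :: "('m::finite, complex) vfield set" where
  "H_N = module.span (vf_scale (*)) (range (\<lambda>r. vD (cvec (bar r)) r))"

definition cartan :: "('m::finite, complex) vfield set" where
  "cartan = range (\<lambda>u. vD u 0)"

text \<open>The underlying space of \<open>H\<^sub>N \<rtimes> \<hh>\<close>; the sum is direct because \<open>D(\<bar>r,r) = 0\<close> for \<open>r = 0\<close>.\<close>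

definition H_tilde :: "('m::finite, complex) vfield set" where
  "H_tilde = {X + Y | X Y. X \<in> H_N \<and> Y \<in> cartan}"

definition H_ext :: "('m::finite, complex) ext set" where
  "H_ext = H_tilde \<times> UNIV"

text \<open>The elements \<open>D(u,r)\<close> and \<open>t\<^sup>s\<close> of the semidirect product with \<open>A\<^sub>N\<close>.\<close>

definition D_elt :: "'m::finite cvec \<Rightarrow> 'm ivec \<Rightarrow> ('m, complex) ext" where
  "D_elt u r = (vD u r, 0)"

definition t_elt :: "'m::finite ivec \<Rightarrow> ('m, complex) ext" where
  "t_elt s = (0, Poly_Mapping.single s 1)"


section \<open>Tensoring with \<open>B\<close>\<close>

text \<open>
  The ambient Lie algebra consists of families of complex coefficients, and its tensor product with
  \<open>B\<close> is modelled by families of coefficients in \<open>B\<close>: \<open>x \<otimes> b\<close> has the coefficients of \<open>x\<close>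
  multiplied by \<open>b\<close>. The lemmas \<open>tens_independent\<close> and \<open>ext_brk_tens\<close> below state that this is
  the tensor product, with the bracket \<open>[x \<otimes> b, y \<otimes> b'] = [x,y] \<otimes> bb'\<close>.
\<close>

definition laurent_tens ::
  "(complex \<Rightarrow> 'b \<Rightarrow> 'b) \<Rightarrow> ('m::finite, complex) laurent \<Rightarrow> 'b::comm_ring_1 \<Rightarrow> ('m, 'b) laurent" where
  "laurent_tens scl f b = Poly_Mapping.map (\<lambda>c. scl c b) f"

definition tens ::
  "(complex \<Rightarrow> 'b \<Rightarrow> 'b) \<Rightarrow> ('m::finite, complex) ext \<Rightarrow> 'b::comm_ring_1 \<Rightarrow> ('m, 'b) ext" where
  "tens scl x b = ((\<chi> i. laurent_tens scl (fst x $ i) b), laurent_tens scl (snd x) b)"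

definition tensor_B ::
  "(complex \<Rightarrow> 'b \<Rightarrow> 'b) \<Rightarrow> ('m::finite, complex) ext set \<Rightarrow> ('m, 'b::comm_ring_1) ext set" where
  "tensor_B scl L = module.span (ext_scale scl) {tens scl x b | x b. x \<in> L}"


section \<open>Jet modules\<close>

text \<open>
  \<open>actH\<close> is the action of \<open>H_tilde\<close>, and \<open>actA\<close> the action of the associative algebra \<open>A\<^sub>N\<close>.
\<close>

definition jet_action ::
  "(complex \<Rightarrow> 'v::ab_group_add \<Rightarrow> 'v) \<Rightarrow> (('m::finite, complex) vfield \<Rightarrow> 'v \<Rightarrow> 'v)
     \<Rightarrow> (('m, complex) laurent \<Rightarrow> 'v \<Rightarrow> 'v) \<Rightarrow> bool" where
  "jet_action sclV actH actA \<longleftrightarrow>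
     lie_module (vf_scale (*)) H_tilde vf_brk sclV actH \<and>
     harish_chandra sclV (\<lambda>u. actH (vD u 0)) \<and>
     (\<forall>g. Vector_Spaces.linear sclV sclV (actA g)) \<and>
     (\<forall>v. Vector_Spaces.linear (laurent_scale (*)) sclV (\<lambda>g. actA g v)) \<and>
     (\<forall>v. actA 1 v = v) \<and>
     (\<forall>g g' v. actA (g * g') v = actA g (actA g' v)) \<and>
     (\<forall>X\<in>H_tilde. \<forall>g v. actH X (actA g v) = actA (vf_app X g) v + actA g (actH X v))"

definition irreducible_jet_module ::
  "(complex \<Rightarrow> 'v::ab_group_add \<Rightarrow> 'v) \<Rightarrow> (('m::finite, complex) vfield \<Rightarrow> 'v \<Rightarrow> 'v) \<Rightarrow> bool" where
  "irreducible_jet_module sclV actH \<longleftrightarrow>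
     (\<exists>actA. jet_action sclV actH actA \<and> (\<exists>v::'v. v \<noteq> 0) \<and>
        (\<forall>W. module.subspace sclV W \<and> (\<forall>X\<in>H_tilde. \<forall>w\<in>W. actH X w \<in> W) \<and>
             (\<forall>g. \<forall>w\<in>W. actA g w \<in> W) \<longrightarrow> W = {0} \<or> W = UNIV))"

section \<open>The Lie algebra structures\<close>

lemma laurent_induct [case_names single add]:
  fixes f :: "'a \<Rightarrow>\<^sub>0 'b::comm_monoid_add"
  assumes single: "\<And>k c. P (Poly_Mapping.single k c)"
    and add: "\<And>f g. P f \<Longrightarrow> P g \<Longrightarrow> P (f + g)"
  shows "P f"
proof (induction f rule: update_induct)
  case const
  show ?case using single[of undefined 0] by simp
next
  case (update f a b)
  have "Poly_Mapping.update a b f = f + Poly_Mapping.single a b"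
    using update by (intro poly_mapping_eqI)
      (auto simp: lookup_update lookup_add lookup_single in_keys_iff when_def)
  then show ?case using update single add by simp
qed

lemma lookup_deg_der: "Poly_Mapping.lookup (deg_der i f) s = of_int (s $ i) * Poly_Mapping.lookup f s"
  by (auto simp: deg_der_def lookup_mapp when_def in_keys_iff)

lemma deg_der_add: "deg_der i (f + g) = deg_der i f + deg_der i g"
  and deg_der_diff: "deg_der i (f - g) = deg_der i f - deg_der i g"
  and deg_der_zero [simp]: "deg_der i 0 = 0"
  by (auto intro!: poly_mapping_eqI simp: lookup_deg_der lookup_add lookup_minus algebra_simps)

lemma deg_der_sum: "deg_der i (\<Sum>j\<in>A. f j) = (\<Sum>j\<in>A. deg_der i (f j))"
  by (induction A rule: infinite_finite_induct) (auto simp: deg_der_add)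

lemma deg_der_single:
  "deg_der i (Poly_Mapping.single s c) = Poly_Mapping.single s (of_int (s $ i) * c)"
  by (auto intro!: poly_mapping_eqI simp: lookup_deg_der lookup_single when_def)

lemma deg_der_mult: "deg_der i (f * g) = deg_der i f * g + f * deg_der i g"
proof (induction f rule: laurent_induct)
  case f: (single k c)
  show ?case
  proof (induction g rule: laurent_induct)
    case (single l d)
    show ?case
      by (simp add: deg_der_single mult_single flip: single_add) (simp add: algebra_simps)
  qed (simp add: deg_der_add algebra_simps)
qed (simp add: deg_der_add algebra_simps)

lemma deg_der_commute: "deg_der i (deg_der j f) = deg_der j (deg_der i f)"
  by (auto intro!: poly_mapping_eqI simp: lookup_deg_der)

lemma vf_app_add: "vf_app X (f + g) = vf_app X f + vf_app X g"
  and vf_app_diff: "vf_app X (f - g) = vf_app X f - vf_app X g"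
  and vf_app_add_left: "vf_app (X + Y) f = vf_app X f + vf_app Y f"
  and vf_app_diff_left: "vf_app (X - Y) f = vf_app X f - vf_app Y f"
  and vf_app_zero [simp]: "vf_app X 0 = 0" "vf_app 0 f = 0"
  by (simp_all add: vf_app_def deg_der_add deg_der_diff algebra_simps sum.distrib sum_subtractf)

lemma vf_app_vf_brk: "vf_app (vf_brk X Y) f = vf_app X (vf_app Y f) - vf_app Y (vf_app X f)"
proof -
  have 1: "vf_app X (vf_app Y f) = (\<Sum>j\<in>UNIV. vf_app X (Y $ j) * deg_der j f) +
      (\<Sum>i\<in>UNIV. \<Sum>j\<in>UNIV. X $ i * Y $ j * deg_der i (deg_der j f))" for X Y
    unfolding vf_app_def deg_der_sum deg_der_mult sum_distrib_left sum_distrib_right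
      distrib_left sum.distrib
    by (subst (3) sum.swap) (simp add: algebra_simps)
  have 2: "(\<Sum>i\<in>UNIV. \<Sum>j\<in>UNIV. X $ i * Y $ j * deg_der i (deg_der j f)) =
      (\<Sum>i\<in>UNIV. \<Sum>j\<in>UNIV. Y $ i * X $ j * deg_der i (deg_der j f))"
    by (subst sum.swap) (simp add: deg_der_commute mult.commute)
  have 3: "vf_app (vf_brk X Y) f =
      (\<Sum>j\<in>UNIV. (vf_app X (Y $ j) - vf_app Y (X $ j)) * deg_der j f)"
    unfolding vf_app_def[of "vf_brk X Y"] by (simp add: vf_brk_def)
  show ?thesis unfolding 1[of X Y] 1[of Y X] 2 3
    by (simp add: left_diff_distrib sum_subtractf)
qed

lemma ext_brk_add: "ext_brk (x + y) z = ext_brk x z + ext_brk y z"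
  and ext_brk_alternating: "ext_brk x x = 0"
  by (simp_all add: ext_brk_def vf_brk_def vec_eq_iff prod_eq_iff vf_app_add vf_app_add_left)

lemma ext_brk_jacobi: "ext_brk x (ext_brk y z) + ext_brk y (ext_brk z x) + ext_brk z (ext_brk x y) = 0"
proof -
  have b: "vf_brk X Y $ j = vf_app X (Y $ j) - vf_app Y (X $ j)"
    for X Y :: "('a,'b) vfield" and j by (simp add: vf_brk_def)
  show ?thesis
    by (simp add: ext_brk_def vec_eq_iff prod_eq_iff b vf_app_vf_brk vf_app_diff)
qed

lemma vf_app_vD:
  "vf_app (vD u r) (Poly_Mapping.single s c) = Poly_Mapping.single (r + s) (dotc u (cvec s) * c)"
proof -
  have "(\<Sum>i\<in>A. Poly_Mapping.single k (h i)) = Poly_Mapping.single k (\<Sum>i\<in>A. h i)"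
    for A and k :: "'a ivec" and h :: "'a + 'a \<Rightarrow> complex"
    by (induction A rule: infinite_finite_induct) (auto simp: single_add)
  then show ?thesis
    by (simp add: vf_app_def vD_def deg_der_single mult_single dotc_def cvec_def
        sum_distrib_right mult.assoc)
qed

lemma vf_brk_vD:
  "vf_brk (vD u r) (vD v s) = vD (dotc u (cvec s) *s v - dotc v (cvec r) *s u) (r + s)"
proof -
  have "vD w k $ i = Poly_Mapping.single k (w $ i)" for w :: "'a cvec" and k i
    by (simp add: vD_def)
  then show ?thesis
    by (simp add: vf_brk_def vec_eq_iff vf_app_vD single_diff add.commute[of s r])
qed

lemma ext_brk_D_D:
  "ext_brk (D_elt u r) (D_elt v s) =
     D_elt (dotc u (cvec s) *s v - dotc v (cvec r) *s u) (r + s)"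
  by (simp add: ext_brk_def D_elt_def vf_brk_vD)

lemma ext_brk_D_t:
  "ext_brk (D_elt u r) (t_elt s) = ext_scale (*) (dotc u (cvec s)) (t_elt (r + s))"
  by (simp add: ext_brk_def D_elt_def t_elt_def ext_scale_def vf_app_vD vf_brk_def vf_scale_def
      laurent_scale_def vec_eq_iff map_eq_zero_iff)

lemma comm_algebra_complex: "comm_algebra ((*) :: complex \<Rightarrow> complex \<Rightarrow> complex)"
  by unfold_locales (auto simp: algebra_simps)

context comm_algebra
begin

lemma scale_mult_right: "scl c (x * y) = x * scl c y"
  using scale_mult_left[of c y x] by (simp add: mult.commute)

lemma scale_of_int: "scl (of_int k * c) x = of_int k * scl c x"
proof -
  have nat: "scl (of_nat n * c) x = of_nat n * scl c x" for n
    by (induction n) (auto simp: algebra_simps)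
  show ?thesis
  proof (cases k)
    case (nonneg n)
    then show ?thesis using nat[of n] by simp
  next
    case (neg n)
    have "of_int k * c = - (of_nat (Suc n) * c)" and "(of_int k :: 'b) = - of_nat (Suc n)"
      unfolding neg by (simp_all add: algebra_simps)
    then show ?thesis by (simp only: scale_minus_left nat mult_minus_left)
  qed
qed

lemma lookup_laurent_scale:
  "Poly_Mapping.lookup (laurent_scale scl c f) s = scl c (Poly_Mapping.lookup f s)"
  by (simp add: laurent_scale_def Poly_Mapping.map.rep_eq when_def)

lemma lookup_laurent_tens:
  "Poly_Mapping.lookup (laurent_tens scl f b) s = scl (Poly_Mapping.lookup f s) b"
  by (simp add: laurent_tens_def Poly_Mapping.map.rep_eq when_def)

lemma vector_space_laurent: "vector_space (laurent_scale scl)"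
  by unfold_locales
    (auto intro!: poly_mapping_eqI simp: lookup_laurent_scale lookup_add algebra_simps)

lemma vector_space_vf: "vector_space (vf_scale scl)"
  by unfold_locales
    (auto intro!: poly_mapping_eqI simp: vf_scale_def vec_eq_iff lookup_laurent_scale lookup_add
      algebra_simps)

lemma vector_space_ext: "vector_space (ext_scale scl)"
proof -
  interpret l: vector_space "laurent_scale scl" by (rule vector_space_laurent)
  interpret v: vector_space "vf_scale scl" by (rule vector_space_vf)
  show ?thesis
    by unfold_locales
      (auto simp: ext_scale_def prod_eq_iff l.scale_right_distrib v.scale_right_distrib
        l.scale_left_distrib v.scale_left_distrib)
qed

lemma tens_bilinear:
  "tens scl (x + y) b = tens scl x b + tens scl y b"
  "tens scl x (b + b') = tens scl x b + tens scl x b'"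
  "tens scl (ext_scale (*) c x) b = ext_scale scl c (tens scl x b)"
  "tens scl x (scl c b) = ext_scale scl c (tens scl x b)"
proof -
  interpret C: comm_algebra "(*) :: complex \<Rightarrow> complex \<Rightarrow> complex" by (rule comm_algebra_complex)
  show "tens scl (x + y) b = tens scl x b + tens scl y b"
    "tens scl x (b + b') = tens scl x b + tens scl x b'"
    "tens scl (ext_scale (*) c x) b = ext_scale scl c (tens scl x b)"
    "tens scl x (scl c b) = ext_scale scl c (tens scl x b)"
    by (auto intro!: poly_mapping_eqI simp: tens_def ext_scale_def vf_scale_def prod_eq_iff
        vec_eq_iff lookup_laurent_tens lookup_laurent_scale C.lookup_laurent_scale lookup_add
        algebra_simps)
qed

lemma laurent_tens_add: "laurent_tens scl (f + g) b = laurent_tens scl f b + laurent_tens scl g b"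
  and laurent_tens_diff: "laurent_tens scl (f - g) b = laurent_tens scl f b - laurent_tens scl g b"
  and laurent_tens_zero: "laurent_tens scl 0 b = 0"
  and laurent_tens_single:
    "laurent_tens scl (Poly_Mapping.single s c) b = Poly_Mapping.single s (scl c b)"
  by (auto intro!: poly_mapping_eqI simp: lookup_laurent_tens lookup_add lookup_minus
      lookup_single when_def algebra_simps)

lemma deg_der_laurent_tens: "deg_der i (laurent_tens scl f b) = laurent_tens scl (deg_der i f) b"
  by (auto intro!: poly_mapping_eqI simp: lookup_laurent_tens lookup_deg_der scale_of_int)

lemma laurent_tens_sum:
  "laurent_tens scl (\<Sum>i\<in>A. h i) b = (\<Sum>i\<in>A. laurent_tens scl (h i) b)"
  by (induction A rule: infinite_finite_induct) (auto simp: laurent_tens_add laurent_tens_zero)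

lemma laurent_tens_mult:
  "laurent_tens scl f b * laurent_tens scl g b' = laurent_tens scl (f * g) (b * b')"
proof (induction f rule: laurent_induct)
  case f: (single k c)
  show ?case
  proof (induction g rule: laurent_induct)
    case (single l d)
    show ?case
      by (simp add: laurent_tens_single mult_single scale_mult_left[symmetric]
          scale_mult_right[symmetric] mult.commute[of d c])
  qed (simp add: laurent_tens_add algebra_simps)
qed (simp add: laurent_tens_add algebra_simps)

lemma ext_brk_tens: "ext_brk (tens scl x b) (tens scl y b') = tens scl (ext_brk x y) (b * b')"
proof -
  have 1: "vf_app (\<chi> i. laurent_tens scl (X $ i) b) (laurent_tens scl f b') =
      laurent_tens scl (vf_app X f) (b * b')" for X :: "('a, complex) vfield" and f b b'
    by (simp add: vf_app_def laurent_tens_sum deg_der_laurent_tens laurent_tens_mult)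
  show ?thesis
    by (simp add: ext_brk_def tens_def vf_brk_def vec_eq_iff 1 laurent_tens_diff
        mult.commute[of b' b])
qed

lemma tens_independent:
  assumes "finite S" and ind: "\<not> module.dependent (ext_scale (*)) S"
    and sum0: "(\<Sum>x\<in>S. tens scl x (\<beta> x)) = 0" and "x \<in> S"
  shows "\<beta> x = 0"
proof (rule ccontr)
  assume ne: "\<beta> x \<noteq> 0"
  interpret C: comm_algebra "(*) :: complex \<Rightarrow> complex \<Rightarrow> complex" by (rule comm_algebra_complex)
  interpret E: vector_space "ext_scale ((*) :: complex \<Rightarrow> complex \<Rightarrow> complex)"
    by (rule C.vector_space_ext)
  interpret p: vector_space_pair scl "(*) :: complex \<Rightarrow> complex \<Rightarrow> complex" ..
  have i1: "independent {\<beta> x}" using ne by simp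
  define g where "g = p.construct {\<beta> x} (\<lambda>_. 1)"
  have lin: "Vector_Spaces.linear scl (*) g" unfolding g_def by (rule p.linear_construct[OF i1])
  then interpret g: Vector_Spaces.linear scl "(*)" g .
  have one: "g (\<beta> x) = 1" unfolding g_def by (rule p.construct_basis[OF i1]) simp
  have "(\<Sum>y\<in>S. Poly_Mapping.lookup (fst y $ i) s * g (\<beta> y)) =
      g (Poly_Mapping.lookup (fst (\<Sum>y\<in>S. tens scl y (\<beta> y)) $ i) s)" for i s
    by (simp add: fst_sum lookup_sum g.sum tens_def lookup_laurent_tens g.scale)
  moreover have "(\<Sum>y\<in>S. Poly_Mapping.lookup (snd y) s * g (\<beta> y)) =
      g (Poly_Mapping.lookup (snd (\<Sum>y\<in>S. tens scl y (\<beta> y))) s)" for s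
    by (simp add: snd_sum lookup_sum g.sum tens_def lookup_laurent_tens g.scale)
  ultimately have "(\<Sum>y\<in>S. ext_scale (*) (g (\<beta> y)) y) = 0"
    unfolding sum0
    by (auto intro!: poly_mapping_eqI simp: prod_eq_iff vec_eq_iff fst_sum snd_sum lookup_sum
        ext_scale_def vf_scale_def C.lookup_laurent_scale mult.commute)
  then have "g (\<beta> x) = 0"
    using E.independentD[OF ind \<open>finite S\<close> subset_refl, of "\<lambda>y. g (\<beta> y)"] \<open>x \<in> S\<close> by simp
  with one show False by simp
qed

lemma ext_brk_scale: "ext_brk (ext_scale scl c x) y = ext_scale scl c (ext_brk x y)"
proof -
  have add: "laurent_scale scl c (f + g) = laurent_scale scl c f + laurent_scale scl c g"
    and diff: "laurent_scale scl c (f - g) = laurent_scale scl c f - laurent_scale scl c g"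
    and zero: "laurent_scale scl c 0 = 0"
    and scale_single: "laurent_scale scl c (Poly_Mapping.single k d) = Poly_Mapping.single k (scl c d)"
    for f g :: "('a, 'b) laurent" and k d
    by (auto intro!: poly_mapping_eqI simp: lookup_laurent_scale lookup_add
        lookup_minus lookup_single when_def algebra_simps)
  have der: "deg_der i (laurent_scale scl c f) = laurent_scale scl c (deg_der i f)"
    for f :: "('a, 'b) laurent" and i
    by (auto intro!: poly_mapping_eqI simp: lookup_laurent_scale lookup_deg_der scale_mult_right)
  have mult: "laurent_scale scl c f * g = laurent_scale scl c (f * g)"
    for f g :: "('a, 'b) laurent"
  proof (induction f rule: laurent_induct)
    case f: (single k d)
    show ?case
    proof (induction g rule: laurent_induct)
      case (single l e)
      show ?case by (simp add: scale_single mult_single scale_mult_left)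
    qed (simp add: add algebra_simps)
  qed (simp add: add algebra_simps)
  have sum: "laurent_scale scl c (\<Sum>i\<in>A. h i) = (\<Sum>i\<in>A. laurent_scale scl c (h i))"
    for A and h :: "'a + 'a \<Rightarrow> ('a, 'b) laurent"
    by (induction A rule: infinite_finite_induct) (auto simp: add zero)
  have "vf_app (vf_scale scl c X) f = laurent_scale scl c (vf_app X f)"
    and "vf_app X (laurent_scale scl c f) = laurent_scale scl c (vf_app X f)"
    for X :: "('a, 'b) vfield" and f
    by (simp_all add: vf_app_def vf_scale_def mult sum der mult.commute[of "X $ _"])
  then show ?thesis
    by (simp add: ext_brk_def ext_scale_def vf_brk_def vec_eq_iff diff) (simp add: vf_scale_def diff)
qed


lemma lie_algebra_ext:
  assumes "module.subspace (ext_scale scl) L" "\<And>x y. x \<in> L \<Longrightarrow> y \<in> L \<Longrightarrow> ext_brk x y \<in> L"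
  shows "lie_algebra (ext_scale scl) L ext_brk"
  unfolding lie_algebra_def lie_algebra_axioms_def
  using assms vector_space_ext
  by (auto simp: ext_brk_add ext_brk_scale ext_brk_alternating ext_brk_jacobi)

lemma ext_brk_span:
  assumes gen: "\<And>x y. x \<in> G \<Longrightarrow> y \<in> G \<Longrightarrow> ext_brk x y \<in> module.span (ext_scale scl) G"
    and "x \<in> module.span (ext_scale scl) G" "y \<in> module.span (ext_scale scl) G"
  shows "ext_brk x y \<in> module.span (ext_scale scl) G"
proof -
  interpret E: vector_space "ext_scale scl" by (rule vector_space_ext)
  have zero: "ext_brk 0 z = 0" for z :: "('a, 'b) ext"
    using ext_brk_add[of 0 0 z] by simp
  have skew: "ext_brk z w = - ext_brk w z" for z w :: "('a, 'b) ext"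
    by (simp add: ext_brk_def vf_brk_def vec_eq_iff prod_eq_iff)
  have left: "ext_brk z w \<in> E.span G"
    if "z \<in> E.span G" "\<And>z. z \<in> G \<Longrightarrow> ext_brk z w \<in> E.span G" for z w
    using that(1)
    by (induction rule: E.span_induct_alt)
      (auto simp: zero ext_brk_add ext_brk_scale E.span_zero intro!: E.span_add E.span_scale that(2))
  show ?thesis
  proof (rule left[OF assms(2)])
    fix z assume "z \<in> G"
    have "ext_brk y z \<in> E.span G" by (rule left[OF assms(3)]) (rule gen[OF _ \<open>z \<in> G\<close>])
    then show "ext_brk z y \<in> E.span G" by (subst skew) (rule E.span_neg)
  qed
qed

lemma lie_algebra_tensor_B:
  assumes "\<And>x y. x \<in> L \<Longrightarrow> y \<in> L \<Longrightarrow> ext_brk x y \<in> L"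
  shows "lie_algebra (ext_scale scl) (tensor_B scl L) ext_brk"
proof -
  interpret E: vector_space "ext_scale scl" by (rule vector_space_ext)
  show ?thesis unfolding tensor_B_def
  proof (rule lie_algebra_ext)
    fix x y assume "x \<in> E.span {tens scl x b | x b. x \<in> L}" "y \<in> E.span {tens scl x b | x b. x \<in> L}"
    then show "ext_brk x y \<in> E.span {tens scl x b | x b. x \<in> L}"
    proof (rule ext_brk_span[rotated])
      fix x y assume "x \<in> {tens scl x b | x b. x \<in> L}" "y \<in> {tens scl x b | x b. x \<in> L}"
      then obtain x' y' b b' where "x = tens scl x' b" "y = tens scl y' b'" "x' \<in> L" "y' \<in> L"
        by blast
      then show "ext_brk x y \<in> E.span {tens scl x b | x b. x \<in> L}"
        using assms[of x' y'] by (intro E.span_base) (simp only: ext_brk_tens, blast)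
    qed
  qed (rule E.subspace_span)
qed

end

lemma dotc_bar_skew: "dotc (cvec (bar s)) (cvec r) = - dotc (cvec (bar r)) (cvec s)"
proof -
  have "dotc (cvec (bar s)) (cvec r) =
    (\<Sum>j\<in>UNIV. of_int (s $ Inr j) * of_int (r $ Inl j)) -
    (\<Sum>j\<in>UNIV. of_int (s $ Inl j) * of_int (r $ Inr j))" for s r :: "'a ivec"
    by (simp add: dotc_def cvec_def bar_def UNIV_Plus_UNIV[symmetric] sum.Plus sum_negf
        del: UNIV_Plus_UNIV)
  from this[of s r] this[of r s] show ?thesis by (simp add: mult.commute)
qed

lemma vf_brk_h:
  "vf_brk (vD (cvec (bar r)) r) (vD (cvec (bar s)) s) =
     vf_scale (*) (dotc (cvec (bar r)) (cvec s)) (vD (cvec (bar (r + s))) (r + s))"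
proof -
  interpret C: comm_algebra "(*) :: complex \<Rightarrow> complex \<Rightarrow> complex" by (rule comm_algebra_complex)
  have "cvec (bar (r + s)) = cvec (bar r) + cvec (bar s)"
    by (auto simp: cvec_def bar_def vec_eq_iff split: sum.splits)
  moreover have "vf_scale (*) c (vD u k) = vD (c *s u) k" for c and u :: "'a cvec" and k
    by (auto intro!: poly_mapping_eqI simp: vf_scale_def vD_def vec_eq_iff C.lookup_laurent_scale
        lookup_single when_def)
  ultimately show ?thesis
    by (simp add: vf_brk_vD dotc_bar_skew[of s r]) (simp add: vec_eq_iff algebra_simps)
qed

lemma lie_algebra_H_ext: "lie_algebra (ext_scale (*)) (H_ext :: ('m::finite, complex) ext set) ext_brk"
  and lie_algebra_H_tilde: "lie_algebra (vf_scale (*)) (H_tilde :: ('m, complex) vfield set) vf_brk"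
proof -
  interpret C: comm_algebra "(*) :: complex \<Rightarrow> complex \<Rightarrow> complex" by (rule comm_algebra_complex)
  interpret V: vector_space "vf_scale (*) :: complex \<Rightarrow> ('m, complex) vfield \<Rightarrow> _"
    by (rule C.vector_space_vf)
  interpret E: vector_space "ext_scale (*) :: complex \<Rightarrow> ('m, complex) ext \<Rightarrow> _"
    by (rule C.vector_space_ext)
  define h :: "'m ivec \<Rightarrow> ('m, complex) vfield" where "h r = vD (cvec (bar r)) r" for r
  define G where "G = range h \<union> cartan"
  have sc: "vf_scale (*) c (vD u k) = vD (c *s u) k" for c and u :: "'m cvec" and k
    by (auto intro!: poly_mapping_eqI simp: vf_scale_def vD_def vec_eq_iff C.lookup_laurent_scale
        lookup_single when_def)
  have ad: "vD u k + vD v k = vD (u + v) k" for u v :: "'m cvec" and k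
    by (simp add: vD_def vec_eq_iff single_add)
  have "V.subspace cartan"
  proof (rule V.subspaceI)
    show "0 \<in> cartan" unfolding cartan_def by (rule range_eqI[of _ _ 0]) (simp add: vD_def vec_eq_iff)
  qed (auto simp: cartan_def sc ad)
  then have H: "H_tilde = V.span G"
    by (auto simp: H_tilde_def G_def H_N_def h_def V.span_Un V.span_eq_iff[THEN iffD2])
  have gen: "vf_brk X Y \<in> V.span G" if "X \<in> G" "Y \<in> G" for X Y
  proof -
    have skew: "vf_brk X Y = - vf_brk Y X" for X Y :: "('m, complex) vfield"
      by (simp add: vf_brk_def vec_eq_iff)
    have zero: "dotc u 0 = 0" "cvec (0 :: 'm ivec) = 0" for u :: "'m cvec"
      by (auto simp: dotc_def cvec_def vec_eq_iff)
    have hh: "vf_brk (h r) (h s) \<in> V.span G" for r s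
      unfolding h_def vf_brk_h by (rule V.span_scale, rule V.span_base) (simp add: G_def h_def)
    have ch: "vf_brk (vD u 0) (h s) \<in> V.span G" for u s
    proof -
      have "vf_brk (vD u 0) (h s) = vf_scale (*) (dotc u (cvec s)) (h s)"
        by (simp add: h_def vf_brk_vD zero sc)
      moreover have "h s \<in> V.span G" by (rule V.span_base) (simp add: G_def)
      ultimately show ?thesis by (simp add: V.span_scale)
    qed
    then have hc: "vf_brk (h s) (vD u 0) \<in> V.span G" for u s
      by (subst skew) (rule V.span_neg)
    have cc: "vf_brk (vD u 0) (vD v 0) \<in> V.span G" for u v
    proof -
      have "vf_brk (vD u 0) (vD v 0 :: ('m, complex) vfield) = 0"
        by (simp add: vf_brk_vD zero) (simp add: vD_def vec_eq_iff)
      then show ?thesis by (simp add: V.span_zero)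
    qed
    show ?thesis using that hh ch hc cc by (auto simp: G_def cartan_def)
  qed
  have lift: "(X, 0) \<in> E.span ((\<lambda>X. (X, 0)) ` G)" if "X \<in> V.span G" for X
    using that
  proof (induction rule: V.span_induct_alt)
    case base
    then show ?case using E.span_zero by (simp add: zero_prod_def)
  next
    case (step c x y)
    have "(vf_scale (*) c x + y, 0) = ext_scale (*) c (x, 0) + (y, 0)"
      by (simp add: ext_scale_def laurent_scale_def map_eq_zero_iff)
    moreover have "(x, 0) \<in> E.span ((\<lambda>X. (X, 0)) ` G)"
      using step by (intro E.span_base) auto
    ultimately show ?case using step by (simp add: E.span_add E.span_scale)
  qed
  have drop: "fst x \<in> V.span G" if "x \<in> E.span ((\<lambda>X. (X, 0)) ` G)" for x
    using that
    by (induction rule: E.span_induct_alt)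
      (auto simp: ext_scale_def V.span_zero V.span_base V.span_add V.span_scale)
  have brk: "vf_brk X Y \<in> H_tilde" if "X \<in> H_tilde" "Y \<in> H_tilde"
    for X Y :: "('m, complex) vfield"
  proof -
    have "ext_brk (X, 0) (Y, 0) \<in> E.span ((\<lambda>X. (X, 0)) ` G)"
      by (rule C.ext_brk_span) (use that in \<open>auto simp: H ext_brk_def intro!: lift gen\<close>)
    from drop[OF this] show ?thesis by (simp add: H ext_brk_def)
  qed
  show "lie_algebra (ext_scale (*)) (H_ext :: ('m, complex) ext set) ext_brk"
  proof (rule C.lie_algebra_ext)
    show "E.subspace H_ext"
      by (rule E.subspaceI)
        (auto simp: H_ext_def H ext_scale_def V.span_zero zero_prod_def V.span_add V.span_scale)
  qed (auto simp: H_ext_def ext_brk_def brk)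
  have pair: "ext_brk (X, 0) (Y, 0) = (vf_brk X Y, 0)"
    "ext_scale (*) c (X, 0) = (vf_scale (*) c X, 0)" for X Y :: "('m, complex) vfield" and c
    by (simp_all add: ext_brk_def ext_scale_def laurent_scale_def map_eq_zero_iff)
  show "lie_algebra (vf_scale (*)) (H_tilde :: ('m, complex) vfield set) vf_brk"
    unfolding lie_algebra_def lie_algebra_axioms_def
  proof (intro conjI allI impI)
    show "vector_space (vf_scale (*) :: complex \<Rightarrow> ('m, complex) vfield \<Rightarrow> _)"
      by (rule C.vector_space_vf)
    show "V.subspace H_tilde" by (simp add: H)
    fix X Y Z :: "('m, complex) vfield" and c
    show "vf_brk (X + Y) Z = vf_brk X Z + vf_brk Y Z"
      using ext_brk_add[of "(X, 0)" "(Y, 0)" "(Z, 0)"] by (simp add: pair)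
    show "vf_brk (vf_scale (*) c X) Y = vf_scale (*) c (vf_brk X Y)"
      using C.ext_brk_scale[of c "(X, 0)" "(Y, 0)"] by (simp add: pair)
    show "vf_brk X X = 0"
      using ext_brk_alternating[of "(X, 0)"] by (simp add: pair zero_prod_def)
    show "vf_brk X (vf_brk Y Z) + vf_brk Y (vf_brk Z X) + vf_brk Z (vf_brk X Y) = 0"
      using ext_brk_jacobi[of "(X, 0)" "(Y, 0)" "(Z, 0)"] by (simp add: pair zero_prod_def)
  qed (rule brk)
qed

lemma (in comm_algebra) lie_algebra_tensor_B_H_ext:
  "lie_algebra (ext_scale scl) (tensor_B scl H_ext) ext_brk"
  by (rule lie_algebra_tensor_B) (rule lie_algebra.brk_closed[OF lie_algebra_H_ext])

end

theory Submission
  imports Defs "HOL-Library.Function_Algebras" "HOL-Computational_Algebra.Fundamental_Theorem_Algebra"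
begin

text \<open>
  Write \<open>t\<^sup>r b\<close>, \<open>h\<^sub>r b\<close>, \<open>D(u,0) b\<close> for the operators of the generators on \<open>V\<close>, and let \<open>M\<close>
  bound the dimensions of the weight spaces. Everything rests on two principles about families of
  commuting operators that are stable under brackets with all generators.

  If \<open>Y\<close> commutes with every bracket \<open>[X,Y]\<close>, the vectors killed by a power of \<open>Y\<close> form a
  submodule, so \<open>Y\<close> is injective or locally nilpotent
  (\<open>injective_or_locally_nilpotent\<close>); in degree \<open>0\<close> local nilpotence means \<open>Y\<^sup>M = 0\<close>.
  If moreover a commutative stable algebra contains an injective operator of every degree, its
  nilpotent elements of degree \<open>0\<close> have a nonzero common kernel, which is a submodule; hence they
  vanish, and all its elements of degree \<open>0\<close> are scalars (\<open>degree_zero_scalar\<close>).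

  First, every \<open>t\<^sup>s\<close> is injective (\<open>tt_injective\<close>). Otherwise \<open>(t\<^sup>s t\<^sup>-\<^sup>s)\<^sup>M = 0\<close> for one
  and then for all \<open>s \<noteq> 0\<close>. Bracketing this identity repeatedly with elements \<open>h\<^sub>q\<close> trades the
  factors \<open>t\<^sup>-\<^sup>s\<close> and then \<open>t\<^sup>s\<close> for arbitrary \<open>t\<^sup>q b\<close> on one side of a hyperplane, so that any
  product of \<open>3M\<close> such operators vanishes. Among \<open>6M\<close> nonzero degrees some \<open>3M\<close> lie on one side
  of a generic hyperplane; hence all products of \<open>6M\<close> operators \<open>t\<^sup>q b\<close> with \<open>q \<noteq> 0\<close> vanish, the
  common kernel of these operators is a nonzero submodule, and they are all zero.

  Now the second principle applies to the algebra generated by all \<open>t\<^sup>r b\<close>. It shows that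
  \<open>t\<^sup>r b\<close> is a multiple of \<open>t\<^sup>r\<close> and \<open>t\<^sup>m t\<^sup>n\<close> a multiple of \<open>t\<^sup>m\<^sup>+\<^sup>n\<close>; brackets with the \<open>h\<^sub>k\<close>
  show that the factors are a character \<open>\<psi>\<close> of \<open>B\<close> (\<open>tt_psi\<close>) and a constant
  \<open>\<kappa>\<close> (\<open>exists_kappa\<close>). After normalisation the \<open>t\<^sup>r\<close> represent the group algebra of the lattice
  by invertible operators, which identifies all weight spaces.

  For \<open>b\<close> in the kernel \<open>K\<close> of \<open>\<psi>\<close> the operators \<open>h\<^sub>r b\<close> and \<open>D(u,0) b\<close> commute with all \<open>t\<^sup>s\<close>,
  so they are determined by operators on a single finite-dimensional weight space. Since
  \<open>D(u,0) b\<close> acts on \<open>h\<^sub>r b'\<close> by \<open>(u,r)\<close> times multiplication by \<open>b\<close>, a linear dependence between iterated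
  brackets that holds for all \<open>r\<close> at once is a polynomial identity in \<open>r\<close>, and gives
  \<open>h\<^sub>r b\<^sub>0 b\<^sub>1 \<dots> b\<^sub>j = 0\<close> for large \<open>j\<close> (\<open>kernel_products_annihilate\<close>). So if \<open>K\<close> does not act
  trivially, there is a last \<open>b\<^sub>0 \<in> K\<close>: some \<open>h\<^sub>r b\<^sub>0\<close> is nonzero, but all \<open>h\<^sub>r b\<^sub>0 b\<close> with \<open>b \<in> K\<close>
  vanish. Then the \<open>t\<^sup>r b\<close>, \<open>h\<^sub>r b\<^sub>0\<close> and \<open>D(u,0) b\<^sub>0\<close> generate a commutative stable algebra, the second
  principle makes \<open>D(u,0) b\<^sub>0\<close> a scalar, and its brackets with the \<open>h\<^sub>r\<close> show \<open>h\<^sub>r b\<^sub>0 = 0\<close>, a contradiction.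
  Therefore \<open>K\<close> kills the \<open>h\<^sub>r\<close> and \<open>D(u,0) b\<close> is a scalar for \<open>b \<in> K\<close>
  (\<open>kernel_acts_by_scalars\<close>). All claims follow; in particular, a subspace that is stable under the
  operators with \<open>b = 1\<close> is stable under all of them, so \<open>V\<close> stays irreducible.
\<close>

section \<open>Linear algebra\<close>

lemma sum_fun_apply: "(\<Sum>i\<in>A. f i) x = (\<Sum>i\<in>A. f i x)"
  for f :: "'i \<Rightarrow> 'a \<Rightarrow> 'b::comm_monoid_add"
  by (induction A rule: infinite_finite_induct) auto

context vector_space
begin

lemma finite_family_dependent:
  assumes "finite T" "card T < n" and f: "\<And>i. i < n \<Longrightarrow> f i \<in> span T"
  shows "\<exists>p. (\<exists>i<n. p i \<noteq> 0) \<and> (\<Sum>i<n. scale (p i) (f i)) = 0"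
proof (cases "inj_on f {..<n}")
  case True
  have "card (f ` {..<n}) = n" using True by (simp add: card_image)
  moreover have "f ` {..<n} \<subseteq> span T" using f by auto
  ultimately have "dependent (f ` {..<n})"
    using independent_span_bound[OF \<open>finite T\<close>, of "f ` {..<n}"] \<open>card T < n\<close> by fastforce
  then obtain q v where q: "(\<Sum>v\<in>f ` {..<n}. scale (q v) v) = 0" "v \<in> f ` {..<n}" "q v \<noteq> 0"
    by (subst (asm) dependent_finite) auto
  have "(\<Sum>i<n. scale (q (f i)) (f i)) = 0"
    using q(1) by (subst (asm) sum.reindex[OF True]) simp
  then show ?thesis using q by (intro exI[of _ "q \<circ> f"]) auto
next
  case False
  then obtain i j where ij: "i < n" "j < n" "i \<noteq> j" "f i = f j" by (auto simp: inj_on_def)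
  let ?p = "\<lambda>k. if k = i then 1 else if k = j then - 1 else 0"
  have "(\<Sum>k<n. scale (?p k) (f k)) = (\<Sum>k\<in>{i,j}. scale (?p k) (f k))"
    by (rule sum.mono_neutral_right) (use ij in auto)
  also have "\<dots> = 0" using ij by simp
  finally show ?thesis using ij(1) by (intro exI[of _ ?p]) (auto intro!: exI[of _ i])
qed

text \<open>
  The finitely many sequences together form a single sequence in a finite-dimensional space of functions
  on \<open>K\<close>, so that one dependence serves them all.
\<close>

lemma common_dependence:
  fixes y :: "nat \<Rightarrow> 'i \<Rightarrow> 'b"
  assumes "finite K" "finite T" and y: "\<And>j i. i \<in> K \<Longrightarrow> y j i \<in> span T"
  shows "\<exists>p n. (\<exists>j<n. p j \<noteq> 0) \<and> (\<forall>i\<in>K. (\<Sum>j<n. scale (p j) (y j i)) = 0)"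
proof -
  define scl where "scl c f = (\<lambda>i. scale c (f i))" for c and f :: "'i \<Rightarrow> 'b"
  interpret F: vector_space scl
    by unfold_locales (auto simp: scl_def fun_eq_iff algebra_simps)
  define \<delta> where "\<delta> i v = (\<lambda>k. if k = i then v else 0)" for i :: 'i and v :: 'b
  define D where "D = (\<lambda>(i, v). \<delta> i v) ` (K \<times> T)"
  define f where "f j = (\<Sum>i\<in>K. \<delta> i (y j i))" for j
  have fin: "finite D" using assms by (simp add: D_def)
  have \<delta>: "\<delta> i v \<in> F.span D" if "i \<in> K" "v \<in> span T" for i v
    using that(2)
  proof (induction rule: span_induct_alt)
    case base
    have "\<delta> i 0 = 0" by (simp add: \<delta>_def fun_eq_iff)
    then show ?case by (metis F.span_zero)
  next
    case (step c x w)
    have "\<delta> i (scale c x + w) = scl c (\<delta> i x) + \<delta> i w"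
      by (simp add: \<delta>_def scl_def fun_eq_iff)
    moreover have "\<delta> i x \<in> F.span D"
      using step that(1) by (intro F.span_base) (auto simp: D_def)
    ultimately show ?case using step.IH by (simp only: F.span_add F.span_scale)
  qed
  have "f j \<in> F.span D" for j
    unfolding f_def by (rule F.span_sum) (use \<delta> y in auto)
  with F.finite_family_dependent[OF fin, of "Suc (card D)" f] obtain p where
    p: "\<exists>i<Suc (card D). p i \<noteq> 0" "(\<Sum>i<Suc (card D). scl (p i) (f i)) = 0" by auto
  have fy: "f j i = y j i" if "i \<in> K" for j i
  proof -
    have "f j i = (\<Sum>k\<in>K. if i = k then y j k else 0)"
      by (simp add: f_def \<delta>_def sum_fun_apply)
    then show ?thesis using that assms(1) by simp
  qed
  have "(\<Sum>j<Suc (card D). scale (p j) (y j i)) = 0" if "i \<in> K" for i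
  proof -
    have "(\<Sum>j<Suc (card D). scale (p j) (y j i)) = (\<Sum>j<Suc (card D). scl (p j) (f j)) i"
      using that by (simp add: sum_fun_apply scl_def fy del: sum.lessThan_Suc)
    then show ?thesis by (simp add: p(2) del: sum.lessThan_Suc)
  qed
  with p(1) show ?thesis by blast
qed

lemma dim_less:
  assumes "subspace S" "S \<subseteq> W" "v \<in> W" "v \<notin> S" "finite T" "W \<subseteq> span T"
  shows "dim S < dim W"
proof -
  obtain B where B: "B \<subseteq> S" "independent B" "S \<subseteq> span B" "card B = dim S"
    by (rule basis_exists)
  have "span B \<subseteq> S" using B(1) assms(1) by (rule span_minimal)
  then have "v \<notin> span B" using assms(4) by auto
  then have ind: "independent (insert v B)" using B(2) by (simp add: independent_insertI)
  moreover have "insert v B \<subseteq> W" using B(1) assms by auto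
  ultimately obtain C where C: "insert v B \<subseteq> C" "C \<subseteq> W" "independent C" "W \<subseteq> span C"
    by (metis maximal_independent_subset_extend)
  have "finite C"
    using independent_span_bound[OF assms(5) C(3)] C(2) assms(6) by auto
  then have "card (insert v B) \<le> card C" using C(1) by (simp add: card_mono)
  moreover have "card C = dim W" using C by (intro basis_card_eq_dim)
  moreover have "v \<notin> B" using \<open>v \<notin> span B\<close> span_base by auto
  moreover have "finite B" using \<open>finite C\<close> C(1) by (meson finite_subset insert_subset)
  ultimately show ?thesis using B(4) by simp
qed

end

text \<open>
  Comparing the values of the polynomial at \<open>c\<close> and \<open>2c\<close> removes its leading term.
\<close>

lemma polynomial_coeffs_zero:
  fixes scale :: "complex \<Rightarrow> 'v::ab_group_add \<Rightarrow> 'v"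
  assumes "vector_space scale"
    and "\<And>c. c \<ge> 1 \<Longrightarrow> (\<Sum>j<n. scale (of_nat c ^ j) (w j)) = 0" and "j < n"
  shows "w j = 0"
proof -
  interpret vector_space scale by fact
  show ?thesis
    using assms(2,3)
  proof (induction n arbitrary: w j)
    case (Suc n)
    have low: "w j = 0" if "j < n" for j
    proof -
      have "scale (of_nat (2 ^ n - 2 ^ j)) (w j) = 0"
      proof (rule Suc.IH[OF _ that])
        fix c :: nat assume c: "c \<ge> 1"
        have "(\<Sum>j<n. scale (of_nat c ^ j) (scale (of_nat (2 ^ n - 2 ^ j)) (w j)))
            = (\<Sum>j<Suc n. scale (of_nat c ^ j) (scale (of_nat (2 ^ n - 2 ^ j)) (w j)))" by simp
        also have "\<dots> = scale (of_nat (2 ^ n)) (\<Sum>j<Suc n. scale (of_nat c ^ j) (w j))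
              - (\<Sum>j<Suc n. scale (of_nat (2 * c) ^ j) (w j))"
          unfolding scale_sum_right sum_subtractf[symmetric]
        proof (rule sum.cong[OF refl])
          fix j assume "j \<in> {..<Suc n}"
          then have "(2::nat) ^ j \<le> 2 ^ n" by (intro power_increasing) auto
          then show "scale (of_nat c ^ j) (scale (of_nat (2 ^ n - 2 ^ j)) (w j)) =
            scale (of_nat (2 ^ n)) (scale (of_nat c ^ j) (w j)) - scale (of_nat (2 * c) ^ j) (w j)"
            by (simp add: of_nat_diff power_mult_distrib mult.commute
                scale_left_diff_distrib[symmetric] right_diff_distrib)
        qed
        also have "\<dots> = 0"
          using c Suc.prems(1)[of c] Suc.prems(1)[of "2 * c"] by (simp del: sum.lessThan_Suc of_nat_mult)
        finally show "(\<Sum>j<n. scale (of_nat c ^ j) (scale (of_nat (2 ^ n - 2 ^ j)) (w j))) = 0" .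
      qed
      moreover have "(2::nat) ^ n - 2 ^ j > 0" using that by simp
      then have "of_nat (2 ^ n - 2 ^ j) \<noteq> (0::complex)" by (simp only: of_nat_eq_0_iff)
      ultimately show ?thesis by simp
    qed
    have "w n = 0" using Suc.prems(1)[of 1] low by simp
    with low Suc.prems(2) show ?case by (auto simp: less_Suc_eq)
  qed simp
qed

section \<open>The symplectic form on the lattice\<close>

text \<open>
  The symplectic form \<open>(bar r, s)\<close>; its values are the structure constants of the brackets of
  \<open>h\<^sub>r\<close> with \<open>h\<^sub>s\<close> and \<open>t\<^sup>s\<close>.
\<close>

definition om :: "'m::finite ivec \<Rightarrow> 'm ivec \<Rightarrow> int" where
  "om r s = (\<Sum>i\<in>UNIV. bar r $ i * s $ i)"

lemma dotc_bar: "dotc (cvec (bar r)) (cvec s) = of_int (om r s)"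
  by (simp add: dotc_def cvec_def om_def)

lemma cvec_simps [simp]: "cvec (r + s) = cvec r + cvec s" "cvec 0 = 0"
  "cvec (- r) = - cvec r" "cvec (r - s) = cvec r - cvec s"
  by (simp_all add: cvec_def vec_eq_iff)

lemma dotc_simps [simp]: "dotc u (v + w) = dotc u v + dotc u w" "dotc (u + u') v = dotc u v + dotc u' v"
  "dotc u (- v) = - dotc u v" "dotc u (v - w) = dotc u v - dotc u w" "dotc u 0 = 0"
  "dotc (c *s u) v = c * dotc u v" "dotc u (c *s v) = c * dotc u v" "dotc 0 v = 0"
  by (simp_all add: dotc_def algebra_simps sum.distrib sum_negf sum_subtractf sum_distrib_left)

lemma om_skew: "om r s = - om s r"
proof -
  have "(of_int (om r s) :: complex) = of_int (- om s r)"
    using dotc_bar_skew[of r s] by (simp add: dotc_bar)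
  then show ?thesis by (simp only: of_int_eq_iff)
qed

lemma om_simps [simp]: "om r (s + t) = om r s + om r t" "om r (s - t) = om r s - om r t"
  "om r (- s) = - om r s" "om r 0 = 0" "om 0 s = 0" "om r r = 0"
  "om (r + r') s = om r s + om r' s" "om (r - r') s = om r s - om r' s" "om (- r) s = - om r s"
proof -
  show a: "om r (s + t) = om r s + om r t" "om r (s - t) = om r s - om r t"
    "om r (- s) = - om r s" "om r 0 = 0" for r s t :: "'a ivec"
    by (simp_all add: om_def algebra_simps sum.distrib sum_subtractf sum_negf)
  show "om 0 s = 0" "om r r = 0" "om (r + r') s = om r s + om r' s"
    "om (r - r') s = om r s - om r' s" "om (- r) s = - om r s"
    using a om_skew[of 0 s] om_skew[of r r] om_skew[of "r + r'" s] om_skew[of "r - r'" s]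
      om_skew[of r s] om_skew[of r' s] om_skew[of "- r" s] by auto
qed

lemma om_nondegenerate:
  assumes "s \<noteq> 0"
  shows "\<exists>r. om r s \<noteq> 0"
proof -
  have "bar (- bar s) = s"
    by (auto simp: bar_def vec_eq_iff split: sum.split)
  then have eq: "om (- bar s) s = (\<Sum>i\<in>UNIV. s $ i * s $ i)" by (simp only: om_def)
  obtain i where "s $ i \<noteq> 0" using assms by (auto simp: vec_eq_iff)
  then have "(\<Sum>i\<in>UNIV. s $ i * s $ i) > 0"
    by (intro sum_pos2[of _ i]) (auto simp: zero_less_mult_iff linorder_neq_iff)
  with eq show ?thesis by (metis less_irrefl)
qed

text \<open>
  If \<open>k\<close> works for \<open>F\<close> but not for \<open>v\<close>, a large multiple of \<open>k\<close> is perturbed by a vector that is not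
  orthogonal to \<open>v\<close>.
\<close>

lemma om_generic:
  assumes "finite F" "0 \<notin> F"
  shows "\<exists>k. \<forall>v\<in>F. om k v \<noteq> 0"
  using assms
proof (induction F rule: finite_induct)
  case (insert v F)
  then obtain k where k: "\<forall>w\<in>F. om k w \<noteq> 0" by auto
  obtain l where l: "om l v \<noteq> 0" using om_nondegenerate insert.prems by auto
  show ?case
  proof (cases "om k v = 0")
    case False
    then show ?thesis using k by auto
  next
    case True
    \<comment> \<open>\<open>C\<close> exceeds all \<open>\<bar>om l w\<bar>\<close>, so \<open>C k + l\<close> is still not orthogonal to any \<open>w \<in> F\<close>\<close>
    define C where "C = 1 + (\<Sum>w\<in>F. \<bar>om l w\<bar>)"
    define q where "q = (\<chi> i. C * k $ i) + l"
    have C: "\<bar>om l w\<bar> < C" if "w \<in> F" for w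
      using that insert.hyps member_le_sum[of w F "\<lambda>w. \<bar>om l w\<bar>"] by (simp add: C_def)
    have q: "om q w = C * om k w + om l w" for w
    proof -
      have "bar (\<chi> i. C * k $ i) = (\<chi> i. C * bar k $ i)"
        by (auto simp: bar_def vec_eq_iff split: sum.split)
      then have "om (\<chi> i. C * k $ i) w = C * om k w"
        by (simp add: om_def sum_distrib_left mult.assoc)
      then show ?thesis by (simp add: q_def)
    qed
    have "om q w \<noteq> 0" if "w \<in> F" for w
    proof
      have "C > 0" using C[OF that] by linarith
      assume "om q w = 0"
      then have "om l w = - (C * om k w)" using q[of w] by simp
      then have "\<bar>om l w\<bar> = C * \<bar>om k w\<bar>" using \<open>C > 0\<close> by (simp add: abs_mult)
      moreover have "\<bar>om k w\<bar> \<ge> 1" using k that by fastforce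
      ultimately have "C * 1 \<le> \<bar>om l w\<bar>" using \<open>C > 0\<close> by (metis mult_left_mono less_imp_le)
      then show False using C[OF that] by simp
    qed
    moreover have "om q v \<noteq> 0" using True l by (simp add: q)
    ultimately show ?thesis by auto
  qed
qed auto

text \<open>
  Any two nonzero lattice points have a common neighbour in the graph of nonorthogonal pairs. This
  is how identities obtained from one bracket spread over the whole lattice.
\<close>

lemma om_connected:
  assumes "\<And>q r. om q r \<noteq> 0 \<Longrightarrow> g q = g r" and "q \<noteq> 0" "r \<noteq> 0"
  shows "g q = g r"
proof -
  obtain k where "om k q \<noteq> 0" "om k r \<noteq> 0" using om_generic[of "{q, r}"] assms by auto
  then show ?thesis using assms(1) by metis
qed

section \<open>Operators on a complex vector space\<close>

text \<open>
  Computations with brackets and powers are carried out in the endomorphism ring of the additive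
  group \<open>V\<close>; complex linearity is a separate predicate, since the scalar multiplication is not a part of the
  type. The ring may be trivial, hence it is not an instance of \<open>ring_1\<close>.
\<close>

typedef (overloaded) 'v endo = "{f :: 'v::ab_group_add \<Rightarrow> 'v. \<forall>v w. f (v + w) = f v + f w}"
  morphisms app Endo
  by (auto intro!: exI[of _ "\<lambda>_. 0"])

notation app (infixr "\<cdot>" 75)

setup_lifting type_definition_endo

instantiation endo :: (ab_group_add) "{ring, monoid_mult}"
begin
lift_definition zero_endo :: "'a endo" is "\<lambda>_. 0" by simp
lift_definition one_endo :: "'a endo" is "\<lambda>v. v" by simp
lift_definition plus_endo :: "'a endo \<Rightarrow> 'a endo \<Rightarrow> 'a endo" is "\<lambda>f g v. f v + g v"
  by simp
lift_definition minus_endo :: "'a endo \<Rightarrow> 'a endo \<Rightarrow> 'a endo" is "\<lambda>f g v. f v - g v"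
  by simp
lift_definition uminus_endo :: "'a endo \<Rightarrow> 'a endo" is "\<lambda>f v. - f v"
  by simp
lift_definition times_endo :: "'a endo \<Rightarrow> 'a endo \<Rightarrow> 'a endo" is "\<lambda>f g v. f (g v)"
  by simp
instance
  by standard (transfer; simp add: fun_eq_iff algebra_simps)+
end

lemma endo_eqI: "(\<And>v. f \<cdot> v = g \<cdot> v) \<Longrightarrow> f = g"
  by transfer auto

lemma app_simps [simp]:
  "(0::'v::ab_group_add endo) \<cdot> v = 0" "(1::'v endo) \<cdot> v = v" "(f + g) \<cdot> v = f \<cdot> v + g \<cdot> v"
  "(f - g) \<cdot> v = f \<cdot> v - g \<cdot> v" "(- f) \<cdot> v = - (f \<cdot> v)" "(f * g) \<cdot> v = f \<cdot> g \<cdot> v"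
  by (transfer; simp)+

lemma app_add [simp]: "f \<cdot> (v + w) = f \<cdot> v + f \<cdot> w"
  by transfer simp

lemma app_zero [simp]: "f \<cdot> (0::'v::ab_group_add) = 0"
  using app_add[of f 0 0] by simp

lemma app_minus [simp]: "f \<cdot> (- v) = - (f \<cdot> v)"
  using app_add[of f v "- v"] by (simp add: eq_neg_iff_add_eq_0 add.commute)

lemma app_diff [simp]: "f \<cdot> (v - w) = f \<cdot> v - f \<cdot> w"
  using app_add[of f v "- w"] by simp

lemma app_sum: "f \<cdot> (\<Sum>i\<in>A. g i) = (\<Sum>i\<in>A. f \<cdot> g i)"
  by (induction A rule: infinite_finite_induct) auto

lemma sum_app: "(\<Sum>i\<in>A. f i) \<cdot> v = (\<Sum>i\<in>A. f i \<cdot> v)"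
  by (induction A rule: infinite_finite_induct) auto

lemma inj_app_iff: "inj (app f) \<longleftrightarrow> (\<forall>v. f \<cdot> v = 0 \<longrightarrow> v = 0)"
proof
  assume *: "\<forall>v. f \<cdot> v = 0 \<longrightarrow> v = 0"
  show "inj (app f)"
  proof (rule injI)
    fix v w assume "f \<cdot> v = f \<cdot> w"
    then have "f \<cdot> (v - w) = 0" by simp
    then show "v = w" using * by (metis eq_iff_diff_eq_0)
  qed
qed (metis app_zero injD)

section \<open>Operators that are injective or nilpotent\<close>

abbreviation br :: "'v::ab_group_add endo \<Rightarrow> 'v endo \<Rightarrow> 'v endo" where
  "br X Y \<equiv> X * Y - Y * X"

lemma br_mult: "br X (Y * Z) = br X Y * Z + Y * br X Z"
  by (simp add: algebra_simps)

lemma br_add: "br X (Y + Z) = br X Y + br X Z" and br_diff: "br X (Y - Z) = br X Y - br X Z"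
  by (simp_all add: algebra_simps)

lemma commute_power:
  fixes X Y :: "'v::ab_group_add endo"
  assumes "X * Y = Y * X" shows "X * Y ^ n = Y ^ n * X"
  by (induction n) (simp_all add: assms mult.assoc[symmetric], simp add: assms mult.assoc)

lemma commute_power_mult:
  fixes X Y :: "'v::ab_group_add endo"
  assumes "X * Y = Y * X" shows "(X * Y) ^ n = X ^ n * Y ^ n"
proof (induction n)
  case (Suc n)
  have "(X * Y) ^ Suc n = X * (Y * X ^ n) * Y ^ n" by (simp add: Suc mult.assoc)
  also have "Y * X ^ n = X ^ n * Y" by (rule commute_power) (simp add: assms)
  finally show ?case by (simp add: mult.assoc)
qed simp

locale complex_space = vector_space scale
  for scale :: "complex \<Rightarrow> 'v::ab_group_add \<Rightarrow> 'v"
begin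

definition sc :: "complex \<Rightarrow> 'v endo" where
  "sc c = Endo (scale c)"

lemma sc_app [simp]: "sc c \<cdot> v = scale c v"
  unfolding sc_def by (subst Endo_inverse) (simp_all add: scale_right_distrib)

lemma sc_simps [simp]: "sc 0 = 0" "sc 1 = 1"
  by (auto intro!: endo_eqI)

lemma sc_add: "sc (c + d) = sc c + sc d"
  and sc_mult: "sc (c * d) = sc c * sc d"
  and sc_minus: "sc (- c) = - sc c"
  and sc_diff: "sc (c - d) = sc c - sc d"
  by (auto intro!: endo_eqI simp: algebra_simps)

lemma sc_mult_assoc: "sc c * (sc d * f) = sc (c * d) * f"
  by (simp add: sc_mult mult.assoc)

lemma sc_eq_0_iff: "sc c * f = 0 \<longleftrightarrow> c = 0 \<or> f = 0"
proof
  assume *: "sc c * f = 0"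
  have "c = 0 \<or> f \<cdot> v = 0" for v
    using arg_cong[OF *, of "\<lambda>g. g \<cdot> v"] by simp
  then show "c = 0 \<or> f = 0" by (auto intro!: endo_eqI)
qed auto

definition lin :: "'v endo \<Rightarrow> bool" where
  "lin f \<longleftrightarrow> (\<forall>c. f * sc c = sc c * f)"

lemma linD: "lin f \<Longrightarrow> f * sc c = sc c * f"
  by (simp add: lin_def)

lemma lin_scale: "lin f \<Longrightarrow> f \<cdot> scale c v = scale c (f \<cdot> v)"
  using arg_cong[OF linD[of f c], of "\<lambda>g. g \<cdot> v"] by simp

lemma linI: "(\<And>c v. f \<cdot> scale c v = scale c (f \<cdot> v)) \<Longrightarrow> lin f"
  by (auto simp: lin_def intro!: endo_eqI)

lemma lin_simps [intro]:
  "lin f \<Longrightarrow> lin g \<Longrightarrow> lin (f + g)" "lin f \<Longrightarrow> lin g \<Longrightarrow> lin (f - g)"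
  "lin f \<Longrightarrow> lin g \<Longrightarrow> lin (f * g)" "lin (sc c)" "lin 0" "lin 1" "lin f \<Longrightarrow> lin (f ^ n)"
proof -
  show p: "lin f \<Longrightarrow> lin g \<Longrightarrow> lin (f * g)" for f g
    by (intro linI) (simp add: lin_scale)
  show o: "lin 1" by (intro linI) simp
  show "lin f \<Longrightarrow> lin (f ^ n)" by (induction n) (auto simp: o p)
qed (auto intro!: linI simp: lin_scale algebra_simps)

lemma br_power:
  assumes "lin Y" "br X Y * Y = Y * br X Y"
  shows "br X (Y ^ n) = sc (of_nat n) * (Y ^ (n - 1) * br X Y)"
proof (induction n)
  case (Suc n)
  have "br X (Y ^ Suc n) = br X Y * Y ^ n + Y * br X (Y ^ n)"
    by (simp add: br_mult)
  also have "br X Y * Y ^ n = Y ^ n * br X Y"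
    by (rule commute_power) (rule assms)
  also have "Y * br X (Y ^ n) = sc (of_nat n) * (Y ^ n * br X Y)"
  proof (cases n)
    case (Suc k)
    have "Y * br X (Y ^ n) = (Y * sc (of_nat n)) * (Y ^ k * br X Y)"
      by (simp only: Suc.IH) (simp add: Suc mult.assoc)
    then show ?thesis using linD[OF assms(1)] by (simp add: Suc mult.assoc)
  qed simp
  finally show ?case by (simp add: sc_add algebra_simps)
qed simp

end

text \<open>
  The situation of the theorem in terms of operators: \<open>tt r b\<close>, \<open>hh r b\<close>, \<open>dd u b\<close> stand for
  \<open>t\<^sup>r b\<close>, \<open>h\<^sub>r b\<close>, \<open>D(u,0) b\<close>, and \<open>M\<close> for the uniform bound.
\<close>

locale loop_rep = V: complex_space scale + B: comm_algebra sclB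
  for scale :: "complex \<Rightarrow> 'v::ab_group_add \<Rightarrow> 'v"
    and sclB :: "complex \<Rightarrow> 'b::comm_ring_1 \<Rightarrow> 'b" +
  fixes tt hh :: "'m::finite ivec \<Rightarrow> 'b \<Rightarrow> 'v endo"
    and dd :: "'m cvec \<Rightarrow> 'b \<Rightarrow> 'v endo"
    and M :: nat
  assumes lin_tt: "V.lin (tt r b)" and lin_hh: "V.lin (hh r b)" and lin_dd: "V.lin (dd u b)"
    and tt_add: "tt r (b + b') = tt r b + tt r b'"
    and tt_scale: "tt r (sclB c b) = V.sc c * tt r b"
    and hh_add: "hh r (b + b') = hh r b + hh r b'"
    and hh_scale: "hh r (sclB c b) = V.sc c * hh r b"
    and dd_add: "dd u (b + b') = dd u b + dd u b'"
    and dd_scale: "dd u (sclB c b) = V.sc c * dd u b"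
    and dd_add_left: "dd (u + u') b = dd u b + dd u' b"
    and dd_scale_left: "dd (c *s u) b = V.sc c * dd u b"
    and hh_0: "hh 0 b = 0"
    and br_hh_hh: "br (hh r b) (hh s b') = V.sc (of_int (om r s)) * hh (r + s) (b * b')"
    and br_hh_tt: "br (hh r b) (tt s b') = V.sc (of_int (om r s)) * tt (r + s) (b * b')"
    and br_dd_hh: "br (dd u b) (hh s b') = V.sc (dotc u (cvec s)) * hh s (b * b')"
    and br_dd_tt: "br (dd u b) (tt s b') = V.sc (dotc u (cvec s)) * tt s (b * b')"
    and br_dd_dd: "br (dd u b) (dd u' b') = 0"
    and br_tt_tt: "br (tt r b) (tt s b') = 0"
    and irreducible: "\<lbrakk>V.subspace W; \<And>r b w. w \<in> W \<Longrightarrow> tt r b \<cdot> w \<in> W;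
        \<And>r b w. w \<in> W \<Longrightarrow> hh r b \<cdot> w \<in> W; \<And>u b w. w \<in> W \<Longrightarrow> dd u b \<cdot> w \<in> W\<rbrakk>
        \<Longrightarrow> W = {0} \<or> W = UNIV"
    and nonzero: "\<exists>v::'v. v \<noteq> 0"
    and weight_span: "V.span (\<Union>L. {v. \<forall>u. dd u 1 \<cdot> v = scale (dotc u L) v}) = UNIV"
    and weight_bound: "\<exists>T. finite T \<and> card T \<le> M \<and>
        {v. \<forall>u. dd u 1 \<cdot> v = scale (dotc u L) v} \<subseteq> V.span T"
begin

abbreviation sc where "sc \<equiv> V.sc"
abbreviation lin where "lin \<equiv> V.lin"

definition gens :: "'v endo set" where
  "gens = {tt r b | r b. True} \<union> {hh r b | r b. True} \<union> {dd u b | u b. True}"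

definition wsp :: "'m cvec \<Rightarrow> 'v set" where
  "wsp L = {v. \<forall>u. dd u 1 \<cdot> v = scale (dotc u L) v}"

text \<open>
  Homogeneity of degree \<open>r\<close> with respect to the Cartan subalgebra; such an operator maps the weight space
  of \<open>L\<close> to that of \<open>L + r\<close>.
\<close>

definition shift :: "'m ivec \<Rightarrow> 'v endo \<Rightarrow> bool" where
  "shift r f \<longleftrightarrow> lin f \<and> (\<forall>u. br (dd u 1) f = sc (dotc u (cvec r)) * f)"

lemma irreducible_gens:
  assumes "V.subspace W" "\<And>X w. X \<in> gens \<Longrightarrow> w \<in> W \<Longrightarrow> X \<cdot> w \<in> W" "v \<in> W" "v \<noteq> 0"
  shows "W = UNIV"
proof -
  have "W = {0} \<or> W = UNIV"
    by (rule irreducible) (use assms(1,2) in \<open>(unfold gens_def, blast)+\<close>)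
  then show ?thesis using assms by auto
qed

lemma wsp_span: "V.span (\<Union>L. wsp L) = UNIV"
  using weight_span by (simp add: wsp_def)

lemma wsp_bound: "\<exists>T. finite T \<and> card T \<le> M \<and> wsp L \<subseteq> V.span T"
  using weight_bound by (simp add: wsp_def)

lemma subspace_wsp: "V.subspace (wsp L)"
  by (rule V.subspaceI) (auto simp: wsp_def V.lin_scale[OF lin_dd] V.scale_right_distrib mult.commute)

lemma exists_weight: "\<exists>L v. v \<in> wsp L \<and> v \<noteq> 0"
proof (rule ccontr)
  assume "\<not> ?thesis"
  then have "(\<Union>L. wsp L) \<subseteq> {0}" by auto
  then have "V.span (\<Union>L. wsp L) \<subseteq> {0}" by (metis V.span_minimal V.subspace_single_0)
  then show False using wsp_span nonzero by auto
qed

lemma one_neq_zero: "(1 :: 'v endo) \<noteq> 0"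
proof
  assume "(1 :: 'v endo) = 0"
  then have "(1 :: 'v endo) \<cdot> v = (0 :: 'v endo) \<cdot> v" for v by simp
  then show False using nonzero by simp
qed

lemma lin_gens: "X \<in> gens \<Longrightarrow> lin X"
  by (auto simp: gens_def lin_tt lin_hh lin_dd)

lemma shift_lin: "shift r f \<Longrightarrow> lin f"
  by (simp add: shift_def)

lemma shift_tt: "shift r (tt r b)" and shift_hh: "shift r (hh r b)" and shift_dd: "shift 0 (dd u b)"
  by (simp_all add: shift_def lin_tt lin_hh lin_dd br_dd_tt br_dd_hh br_dd_dd)

lemma shift_gens: "X \<in> gens \<Longrightarrow> \<exists>k. shift k X"
  using shift_tt shift_hh shift_dd unfolding gens_def by blast

lemma shift_mult: "shift r f \<Longrightarrow> shift s g \<Longrightarrow> shift (r + s) (f * g)"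
proof -
  assume a: "shift r f" "shift s g"
  have "br (dd u 1) (f * g) = sc (dotc u (cvec (r + s))) * (f * g)" for u
  proof -
    have "f * (sc (dotc u (cvec s)) * g) = sc (dotc u (cvec s)) * (f * g)"
      using V.linD[OF shift_lin[OF a(1)], of "dotc u (cvec s)"] by (metis mult.assoc)
    then show ?thesis
      unfolding br_mult using a by (simp add: shift_def V.sc_add algebra_simps)
  qed
  then show ?thesis using a by (auto simp: shift_def)
qed

lemma shift_sc: "shift r f \<Longrightarrow> shift r (sc c * f)"
  using shift_mult[of 0 "sc c" r f] V.linD[OF lin_dd] by (simp add: shift_def V.lin_simps)

lemma shift_one: "shift 0 1" and shift_scalar: "shift 0 (sc c)"
  using V.linD[OF lin_dd] by (auto simp: shift_def V.lin_simps)

lemma shift_add: "shift r f \<Longrightarrow> shift r g \<Longrightarrow> shift r (f + g)"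
  and shift_diff: "shift r f \<Longrightarrow> shift r g \<Longrightarrow> shift r (f - g)"
  unfolding shift_def br_add br_diff by (simp_all add: V.lin_simps distrib_left right_diff_distrib)

lemma shift_wsp: "shift r f \<Longrightarrow> v \<in> wsp L \<Longrightarrow> f \<cdot> v \<in> wsp (L + cvec r)"
proof -
  assume a: "shift r f" "v \<in> wsp L"
  have "dd u 1 \<cdot> f \<cdot> v = scale (dotc u (L + cvec r)) (f \<cdot> v)" for u
  proof -
    have "br (dd u 1) f \<cdot> v = (sc (dotc u (cvec r)) * f) \<cdot> v" using a by (simp add: shift_def)
    then have "dd u 1 \<cdot> f \<cdot> v = f \<cdot> dd u 1 \<cdot> v + scale (dotc u (cvec r)) (f \<cdot> v)"
      by (simp add: algebra_simps)
    then show ?thesis using a V.lin_scale[OF shift_lin[OF a(1)]]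
      by (simp add: wsp_def V.scale_left_distrib)
  qed
  then show ?thesis by (simp add: wsp_def)
qed

lemma shift0_wsp: "shift 0 f \<Longrightarrow> v \<in> wsp L \<Longrightarrow> f \<cdot> v \<in> wsp L"
  using shift_wsp[of 0 f v L] by simp

lemma shift0_power: "shift 0 f \<Longrightarrow> shift 0 (f ^ n)"
  using shift_mult[of 0 _ 0] by (induction n) (auto simp: shift_one)

lemma endo_eq_0_on_wsp:
  assumes "lin f" "\<And>L v. v \<in> wsp L \<Longrightarrow> f \<cdot> v = 0"
  shows "f = 0"
proof (rule endo_eqI)
  fix v
  have "v \<in> V.span (\<Union>L. wsp L)" by (simp add: wsp_span)
  then have "f \<cdot> v = 0"
    by (induction rule: V.span_induct_alt) (auto simp: V.lin_scale[OF assms(1)] assms(2))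
  then show "f \<cdot> v = 0 \<cdot> v" by simp
qed

text \<open>
  If \<open>Y\<^sup>n v = 0\<close>, then \<open>Y\<^sup>n\<^sup>+\<^sup>1 X v = - (n + 1) [X,Y] Y\<^sup>n v = 0\<close>; so the vectors killed by some power
  of \<open>Y\<close> form a submodule.
\<close>

lemma injective_or_locally_nilpotent:
  assumes "lin Y" and comm: "\<And>X. X \<in> gens \<Longrightarrow> br X Y * Y = Y * br X Y"
  shows "inj (app Y) \<or> (\<forall>v. \<exists>n. Y ^ n \<cdot> v = 0)"
proof (cases "\<exists>v. Y \<cdot> v = 0 \<and> v \<noteq> 0")
  case False
  then show ?thesis by (auto simp: inj_app_iff)
next
  case True
  then obtain v where v: "Y \<cdot> v = 0" "v \<noteq> 0" by blast
  define W where "W = {v. \<exists>n. Y ^ n \<cdot> v = 0}"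
  have larger: "Y ^ (k + n) \<cdot> w = 0" if "Y ^ n \<cdot> w = 0" for k n w
    using that by (simp add: power_add)
  have "W = UNIV"
  proof (rule irreducible_gens)
    show "V.subspace W"
    proof (rule V.subspaceI)
      fix x y assume "x \<in> W" "y \<in> W"
      then obtain n k where "Y ^ n \<cdot> x = 0" "Y ^ k \<cdot> y = 0" by (auto simp: W_def)
      then have "Y ^ (n + k) \<cdot> (x + y) = 0"
        using larger[of n x k] larger[of k y n] by (simp add: add.commute)
      then show "x + y \<in> W" unfolding W_def by blast
    next
      fix c x assume "x \<in> W"
      then obtain n where n: "Y ^ n \<cdot> x = 0" by (auto simp: W_def)
      have "lin (Y ^ n)" using assms(1) by auto
      then have "Y ^ n \<cdot> scale c x = 0" using n by (simp add: V.lin_scale)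
      then show "scale c x \<in> W" unfolding W_def by blast
    qed (simp add: W_def)
    show "v \<in> W" using v by (auto simp: W_def intro!: exI[of _ 1])
    fix X w assume X: "X \<in> gens" "w \<in> W"
    then obtain n where n: "Y ^ n \<cdot> w = 0" by (auto simp: W_def)
    have "br X (Y ^ Suc n) = sc (of_nat (Suc n)) * (Y ^ n * br X Y)"
      using V.br_power[OF assms(1) comm[OF X(1)], of "Suc n"] by simp
    also have "Y ^ n * br X Y = br X Y * Y ^ n"
      by (rule commute_power[symmetric]) (rule comm[OF X(1)])
    finally have "(X * Y ^ Suc n - Y ^ Suc n * X) \<cdot> w = (sc (of_nat (Suc n)) * (br X Y * Y ^ n)) \<cdot> w"
      by (rule arg_cong)
    then have "Y ^ Suc n \<cdot> X \<cdot> w = 0" using n larger[OF n, of 1] by simp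
    then show "X \<cdot> w \<in> W" unfolding W_def by blast
  qed (rule v)
  then show ?thesis by (auto simp: W_def)
qed

text \<open>
  A nilpotent operator on a space of dimension at most \<open>M\<close> has index at most \<open>M\<close>. The exponent
  does not depend on the weight, and this is how uniform boundedness is used.
\<close>

lemma nilpotent_on_wsp:
  assumes "shift 0 Y" "\<And>v. \<exists>n. Y ^ n \<cdot> v = 0" "v \<in> wsp L"
  shows "Y ^ M \<cdot> v = 0"
proof (rule ccontr)
  assume ne: "Y ^ M \<cdot> v \<noteq> 0"
  obtain T where T: "finite T" "card T \<le> M" "wsp L \<subseteq> V.span T" using wsp_bound by blast
  have "Y ^ i \<cdot> v \<in> V.span T" for i
    using shift0_wsp[OF shift0_power[OF assms(1)] assms(3)] T(3) by auto
  with V.finite_family_dependent[OF T(1), of "Suc M" "\<lambda>i. Y ^ i \<cdot> v"] T(2)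
  obtain p where p: "\<exists>i<Suc M. p i \<noteq> 0" "(\<Sum>i<Suc M. scale (p i) (Y ^ i \<cdot> v)) = 0" by auto
  obtain i0 where i0: "p i0 \<noteq> 0" "\<And>i. i < i0 \<Longrightarrow> p i = 0"
    using exists_least_iff[of "\<lambda>i. p i \<noteq> 0"] p(1) by blast
  have "i0 \<le> M" using p(1) i0(2) by (meson less_Suc_eq_le not_le order.strict_trans2)
  obtain d where d: "Y ^ d \<cdot> v = 0" "\<And>i. i < d \<Longrightarrow> Y ^ i \<cdot> v \<noteq> 0"
    using exists_least_iff[of "\<lambda>n. Y ^ n \<cdot> v = 0"] assms(2) by auto
  have larger: "Y ^ n \<cdot> v = 0" if "n \<ge> d" for n
  proof -
    have "Y ^ n = Y ^ (n - d) * Y ^ d" using that by (simp flip: power_add)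
    then show ?thesis using d(1) by simp
  qed
  have "d > M" using ne larger by (metis not_le)
  \<comment> \<open>\<open>Y\<^sup>k\<close> moves the lowest term of the dependence to the last power that does not kill \<open>v\<close>\<close>
  define k where "k = d - 1 - i0"
  have lin: "lin (Y ^ k)" using assms(1) shift_lin by blast
  have "0 = Y ^ k \<cdot> (\<Sum>i<Suc M. scale (p i) (Y ^ i \<cdot> v))" using p by simp
  also have "\<dots> = (\<Sum>i<Suc M. scale (p i) (Y ^ (k + i) \<cdot> v))"
    by (simp only: app_sum V.lin_scale[OF lin] power_add app_simps)
  also have "\<dots> = (\<Sum>i\<in>{i0}. scale (p i) (Y ^ (k + i) \<cdot> v))"
  proof (rule sum.mono_neutral_right)
    show "\<forall>i\<in>{..<Suc M} - {i0}. scale (p i) (Y ^ (k + i) \<cdot> v) = 0"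
    proof
      fix i assume "i \<in> {..<Suc M} - {i0}"
      then consider "i < i0" | "k + i \<ge> d" using \<open>d > M\<close> \<open>i0 \<le> M\<close> by (fastforce simp: k_def)
      then show "scale (p i) (Y ^ (k + i) \<cdot> v) = 0" using i0(2) larger by cases auto
    qed
  qed (use \<open>i0 \<le> M\<close> in auto)
  finally have "Y ^ (k + i0) \<cdot> v = 0" using i0(1) by simp
  moreover have "k + i0 < d" using \<open>d > M\<close> \<open>i0 \<le> M\<close> by (simp add: k_def)
  ultimately show False using d(2) by blast
qed

lemma nilpotent_bound:
  assumes "shift 0 Y" "\<And>v. \<exists>n. Y ^ n \<cdot> v = 0"
  shows "Y ^ M = 0"
  by (rule endo_eq_0_on_wsp) (use assms nilpotent_on_wsp shift_lin in blast)+

text \<open>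
  Some nonzero polynomial in \<open>Y\<close> kills a weight vector; one of its linear factors is not
  injective.
\<close>

lemma exists_noninjective:
  assumes "shift 0 Y"
  shows "\<exists>a. \<not> inj (app (Y - sc a))"
proof (rule ccontr)
  assume "\<not> ?thesis"
  then have inj: "w = 0" if "(Y - sc a) \<cdot> w = 0" for a w using that by (auto simp: inj_app_iff)
  have lin: "lin Y" using assms by (rule shift_lin)
  define ev where "ev n q = (\<Sum>j\<le>n. sc (coeff q j) * Y ^ j)" for n and q :: "complex poly"
  have lead: "ev n q = ev (degree q) q" if "n \<ge> degree q" for n q
    unfolding ev_def by (rule sum.mono_neutral_right) (use that in \<open>auto simp: coeff_eq_0\<close>)
  have factor: "ev (Suc n) ([:-a, 1:] * q) = (Y - sc a) * ev n q" if "n \<ge> degree q" for n a q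
  proof -
    have "ev (Suc n) ([:-a, 1:] * q) =
        (\<Sum>j\<le>Suc n. sc (coeff (pCons 0 q) j) * Y ^ j) - (\<Sum>j\<le>Suc n. sc a * (sc (coeff q j) * Y ^ j))"
      by (simp add: ev_def V.sc_diff V.sc_mult algebra_simps sum.distrib sum_subtractf
          sum_negf del: sum.atMost_Suc)
    also have "(\<Sum>j\<le>Suc n. sc (coeff (pCons 0 q) j) * Y ^ j) = Y * ev n q"
      unfolding ev_def sum_distrib_left by (subst sum.atMost_Suc_shift)
        (auto intro!: sum.cong simp: mult.assoc[symmetric] V.linD[OF lin] del: sum.atMost_Suc)
    also have "(\<Sum>j\<le>Suc n. sc a * (sc (coeff q j) * Y ^ j)) = sc a * ev n q"
      using that by (simp add: ev_def coeff_eq_0 sum_distrib_left)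
    finally show ?thesis by (simp add: algebra_simps)
  qed
  have main: "w = 0" if "q \<noteq> 0" "ev (degree q) q \<cdot> w = 0" for q w
    using that
  proof (induction "degree q" arbitrary: q)
    case 0
    then obtain c where "q = [:c:]" "c \<noteq> 0" by (metis degree_eq_zeroE pCons_eq_0_iff)
    then show ?case using 0 by (simp add: ev_def)
  next
    case (Suc n)
    then have "\<not> constant (poly q)" by (simp add: constant_degree)
    then obtain a where "poly q a = 0" using fundamental_theorem_of_algebra by blast
    then obtain q' where q': "q = [:-a, 1:] * q'" by (metis poly_eq_0_iff_dvd dvdE)
    then have "q' \<noteq> 0" using Suc by auto
    then have deg: "degree q = Suc (degree q')" unfolding q' by (subst degree_mult_eq) auto
    have "(Y - sc a) \<cdot> ev (degree q') q' \<cdot> w = 0"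
      using Suc.prems(2) factor[of q' "degree q'" a] unfolding deg q'[symmetric] by simp
    then have "ev (degree q') q' \<cdot> w = 0" by (rule inj)
    then show ?case using Suc deg \<open>q' \<noteq> 0\<close> by auto
  qed
  obtain L v where v: "v \<in> wsp L" "v \<noteq> 0" using exists_weight by blast
  obtain T where T: "finite T" "wsp L \<subseteq> V.span T" using wsp_bound by blast
  have "Y ^ i \<cdot> v \<in> V.span T" for i
    using shift0_wsp[OF shift0_power[OF assms(1)] v(1)] T(2) by auto
  with V.finite_family_dependent[OF T(1), of "Suc (card T)" "\<lambda>i. Y ^ i \<cdot> v"]
  obtain p where p: "\<exists>i<Suc (card T). p i \<noteq> 0" "(\<Sum>i<Suc (card T). scale (p i) (Y ^ i \<cdot> v)) = 0"
    by auto
  define q where "q = (\<Sum>i\<le>card T. monom (p i) i)"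
  have q: "coeff q i = (if i \<le> card T then p i else 0)" for i
    by (simp add: q_def coeff_sum if_distrib cong: if_cong)
  have "q \<noteq> 0" using p(1) q by (metis coeff_0 less_Suc_eq_le)
  moreover have "degree q \<le> card T" by (rule degree_le) (simp add: q)
  then have "ev (degree q) q = ev (card T) q" by (rule lead[symmetric])
  then have "ev (degree q) q \<cdot> v = 0"
    using p(2) by (simp add: ev_def[of "card T"] sum_app q lessThan_Suc_atMost)
  ultimately show False using main v(2) by blast
qed

section \<open>Commutative algebras of operators stable under brackets\<close>

definition stable_algebra :: "'v endo set \<Rightarrow> bool" where
  "stable_algebra C \<longleftrightarrow> 1 \<in> C \<and> (\<forall>Y\<in>C. lin Y \<and> (\<forall>c. sc c * Y \<in> C) \<and>
     (\<forall>Z\<in>C. Y * Z = Z * Y \<and> Y * Z \<in> C \<and> Y + Z \<in> C) \<and> (\<forall>X\<in>gens. br X Y \<in> C))"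

lemma stable_algebraD:
  assumes "stable_algebra C"
  shows "1 \<in> C" "Y \<in> C \<Longrightarrow> lin Y" "Y \<in> C \<Longrightarrow> sc c * Y \<in> C" "Y \<in> C \<Longrightarrow> Z \<in> C \<Longrightarrow> Y * Z = Z * Y"
    "Y \<in> C \<Longrightarrow> Z \<in> C \<Longrightarrow> Y * Z \<in> C" "Y \<in> C \<Longrightarrow> Z \<in> C \<Longrightarrow> Y + Z \<in> C"
    "X \<in> gens \<Longrightarrow> Y \<in> C \<Longrightarrow> br X Y \<in> C" "Y \<in> C \<Longrightarrow> Z \<in> C \<Longrightarrow> Y - Z \<in> C" "sc c \<in> C"
proof -
  show *: "1 \<in> C" "Y \<in> C \<Longrightarrow> lin Y" "Y \<in> C \<Longrightarrow> sc c * Y \<in> C" "Y \<in> C \<Longrightarrow> Z \<in> C \<Longrightarrow> Y * Z = Z * Y"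
    "Y \<in> C \<Longrightarrow> Z \<in> C \<Longrightarrow> Y * Z \<in> C" "Y \<in> C \<Longrightarrow> Z \<in> C \<Longrightarrow> Y + Z \<in> C"
    "X \<in> gens \<Longrightarrow> Y \<in> C \<Longrightarrow> br X Y \<in> C" for X Y Z c
    using assms unfolding stable_algebra_def by blast+
  show "Y - Z \<in> C" if "Y \<in> C" "Z \<in> C"
    using *(6)[OF that(1) *(3)[OF that(2), of "- 1"]] by (simp add: V.sc_minus)
  show "sc c \<in> C" using *(3)[OF *(1), of c] by simp
qed

lemma stable_inj_or_nil:
  assumes "stable_algebra C" "Y \<in> C"
  shows "inj (app Y) \<or> (\<forall>v. \<exists>n. Y ^ n \<cdot> v = 0)"
  by (rule injective_or_locally_nilpotent) (use stable_algebraD[OF assms(1)] assms(2) in auto)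

text \<open>
  Let \<open>N\<close> be the set of noninjective, hence nilpotent, elements of degree \<open>0\<close>. Multiplying a bracket
  \<open>[X,n]\<close> by an injective \<open>T\<close> of the opposite degree brings it back to degree \<open>0\<close>, and the result
  is again in \<open>N\<close>; so the common kernel of \<open>N\<close> is a submodule. It is nonzero because commuting nilpotent
  operators on a weight space have a nonzero common kernel. Hence \<open>N = {0}\<close>, and an element of degree \<open>0\<close> equals
  its eigenvalue.
\<close>

lemma degree_zero_scalar:
  assumes C: "stable_algebra C" and T: "\<And>k. \<exists>T\<in>C. shift k T \<and> inj (app T)"
    and Y: "Y \<in> C" "shift 0 Y"
  shows "\<exists>c. Y = sc c"
proof -
  note CD = stable_algebraD[OF C]
  define N where "N = {n \<in> C. shift 0 n \<and> \<not> inj (app n)}"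
  obtain L v0 where v0: "v0 \<in> wsp L" "v0 \<noteq> 0" using exists_weight by blast
  have nil: "\<exists>k. n ^ k \<cdot> v = 0" if "n \<in> N" for n v
    using that stable_inj_or_nil[OF C, of n] by (auto simp: N_def)
  have der: "T * br X n \<in> N" if "n \<in> N" "X \<in> gens" "shift k X" "T \<in> C" "shift (- k) T" for n X T k
  proof -
    define z where "z = T * br X n"
    define X' where "X' = T * X"
    have zC: "z \<in> C" using that CD by (auto simp: z_def N_def)
    have nC: "n \<in> C" "shift 0 n" using that by (auto simp: N_def)
    have X': "shift 0 X'" using shift_mult[OF that(5) that(3)] by (simp add: X'_def)
    have z: "br X' n = z"
    proof -
      have "n * (T * X) = T * n * X" using CD(4)[OF nC(1) that(4)] by (simp add: mult.assoc[symmetric])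
      then show ?thesis by (simp add: z_def X'_def algebra_simps)
    qed
    have sz: "shift 0 z"
      unfolding z[symmetric] using shift_mult[OF X' nC(2)] shift_mult[OF nC(2) X']
      by (intro shift_diff) auto
    \<comment> \<open>with \<open>z\<close> injective, \<open>[X',n\<^sup>p] = p n\<^sup>p\<^sup>-\<^sup>1 z\<close> would lower the least \<open>p\<close> with \<open>n\<^sup>p = 0\<close> on \<open>wsp L\<close>\<close>
    have "\<not> inj (app z)"
    proof
      assume inj: "inj (app z)"
      have "\<forall>w\<in>wsp L. n ^ M \<cdot> w = 0" using nilpotent_on_wsp[OF nC(2) nil[OF that(1)]] by blast
      then obtain p where p: "\<forall>w\<in>wsp L. n ^ p \<cdot> w = 0"
        "\<And>i. i < p \<Longrightarrow> \<not> (\<forall>w\<in>wsp L. n ^ i \<cdot> w = 0)"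
        using exists_least_iff[of "\<lambda>p. \<forall>w\<in>wsp L. n ^ p \<cdot> w = 0"] by blast
      have "p \<noteq> 0" using p(1) v0 by (intro notI) auto
      have "n ^ (p - 1) \<cdot> w = 0" if w: "w \<in> wsp L" for w
      proof -
        have "br X' (n ^ p) = sc (of_nat p) * (n ^ (p - 1) * z)"
          using V.br_power[OF CD(2)[OF nC(1)], of X' p] CD(4)[OF zC nC(1)] unfolding z by blast
        also have "n ^ (p - 1) * z = z * n ^ (p - 1)"
          by (rule commute_power[symmetric]) (rule CD(4)[OF zC nC(1)])
        finally have "br X' (n ^ p) \<cdot> w = (sc (of_nat p) * (z * n ^ (p - 1))) \<cdot> w" by simp
        moreover have "X' \<cdot> w \<in> wsp L" using X' w by (rule shift0_wsp)
        ultimately have "scale (of_nat p) (z \<cdot> n ^ (p - 1) \<cdot> w) = 0" using p(1) w by simp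
        then have "z \<cdot> n ^ (p - 1) \<cdot> w = 0" using \<open>p \<noteq> 0\<close> by simp
        then show ?thesis using inj by (simp add: inj_app_iff)
      qed
      then show False using p(2)[of "p - 1"] \<open>p \<noteq> 0\<close> by simp
    qed
    then show ?thesis using zC sz by (simp add: N_def z_def)
  qed
  \<comment> \<open>a vector \<open>v\<close> with the smallest orbit under the elements of degree \<open>0\<close> is killed by \<open>N\<close>\<close>
  define C0 where "C0 v = {Z \<cdot> v | Z. Z \<in> C \<and> shift 0 Z}" for v
  obtain T where T': "finite T" "wsp L \<subseteq> V.span T" using wsp_bound by blast
  have sub: "V.subspace (C0 v)" for v
  proof (rule V.subspaceI)
    have "sc 0 * 1 \<in> C" "shift 0 (sc 0 * 1)" by (intro CD(3) CD(1) shift_sc shift_one)+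
    then show "0 \<in> C0 v" unfolding C0_def by force
  next
    fix x y assume "x \<in> C0 v" "y \<in> C0 v"
    then obtain Z Z' where "x = Z \<cdot> v" "y = Z' \<cdot> v" "Z \<in> C" "Z' \<in> C" "shift 0 Z" "shift 0 Z'"
      by (auto simp: C0_def)
    then show "x + y \<in> C0 v" unfolding C0_def
      by (auto intro!: exI[of _ "Z + Z'"] CD(6) shift_add)
  next
    fix c x assume "x \<in> C0 v"
    then obtain Z where "x = Z \<cdot> v" "Z \<in> C" "shift 0 Z" by (auto simp: C0_def)
    then show "scale c x \<in> C0 v" unfolding C0_def
      by (auto intro!: exI[of _ "sc c * Z"] CD(3) shift_sc)
  qed
  have "\<exists>v. v \<in> wsp L \<and> v \<noteq> 0" using v0 by blast
  from ex_has_least_nat[of "\<lambda>v. v \<in> wsp L \<and> v \<noteq> 0" v0 "\<lambda>v. V.dim (C0 v)"] v0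
  obtain v where v: "v \<in> wsp L" "v \<noteq> 0"
    "\<And>w. w \<in> wsp L \<Longrightarrow> w \<noteq> 0 \<Longrightarrow> V.dim (C0 v) \<le> V.dim (C0 w)" by blast
  have kernel: "n \<cdot> v = 0" if n: "n \<in> N" for n
  proof (rule ccontr)
    assume ne: "n \<cdot> v \<noteq> 0"
    have nC: "n \<in> C" "shift 0 n" using n by (auto simp: N_def)
    have "C0 (n \<cdot> v) \<subseteq> C0 v"
    proof
      fix x assume "x \<in> C0 (n \<cdot> v)"
      then obtain Z where "x = (Z * n) \<cdot> v" "Z \<in> C" "shift 0 Z" by (auto simp: C0_def)
      moreover from this have "shift 0 (Z * n)" using shift_mult[of 0 Z 0 n] nC by simp
      ultimately show "x \<in> C0 v" unfolding C0_def using CD(5) nC by blast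
    qed
    moreover have "v \<in> C0 v" unfolding C0_def using CD(1) shift_one by force
    moreover have "v \<notin> C0 (n \<cdot> v)"
    proof
      assume "v \<in> C0 (n \<cdot> v)"
      then obtain Z where Z: "v = (Z * n) \<cdot> v" "Z \<in> C" by (auto simp: C0_def)
      obtain k where k: "n ^ k \<cdot> v = 0" using nil n by blast
      have "(Z * n) ^ i \<cdot> v = v" for i by (induction i) (use Z(1) in auto)
      then have "v = (Z ^ k * n ^ k) \<cdot> v" using commute_power_mult[OF CD(4)[OF Z(2) nC(1)], of k] by metis
      then show False using k v(2) by simp
    qed
    moreover have "C0 v \<subseteq> V.span T"
      using T'(2) shift0_wsp v(1) by (fastforce simp: C0_def)
    ultimately have "V.dim (C0 (n \<cdot> v)) < V.dim (C0 v)" using V.dim_less sub T'(1) by meson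
    moreover have "n \<cdot> v \<in> wsp L" using shift0_wsp nC(2) v(1) by blast
    ultimately show False using v(3) ne by (metis not_le)
  qed
  define W where "W = {v. \<forall>n\<in>N. n \<cdot> v = 0}"
  have "W = UNIV"
  proof (rule irreducible_gens)
    show "V.subspace W"
      by (rule V.subspaceI) (auto simp: W_def N_def V.lin_scale[OF CD(2)])
    show "v \<in> W" using kernel by (simp add: W_def)
    fix X w assume X: "X \<in> gens" "w \<in> W"
    then obtain k where k: "shift k X" using shift_gens by blast
    obtain S where S: "S \<in> C" "shift (- k) S" "inj (app S)" using T by blast
    have "n \<cdot> X \<cdot> w = 0" if n: "n \<in> N" for n
    proof -
      have "S \<cdot> br X n \<cdot> w = 0" using der[OF n X(1) k S(1,2)] X(2) by (auto simp: W_def)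
      then have "br X n \<cdot> w = 0" using S(3) unfolding inj_app_iff by blast
      moreover have "n \<cdot> w = 0" using X(2) n by (simp add: W_def)
      ultimately show ?thesis by simp
    qed
    then show "X \<cdot> w \<in> W" by (simp add: W_def)
  qed (rule v)
  have zero: "n = 0" if "n \<in> N" for n
  proof (rule endo_eqI)
    fix w
    have "w \<in> W" using \<open>W = UNIV\<close> by simp
    then show "n \<cdot> w = 0 \<cdot> w" using that by (simp add: W_def)
  qed
  obtain a where a: "\<not> inj (app (Y - sc a))" using exists_noninjective[OF Y(2)] by blast
  have "Y - sc a \<in> N" using a Y CD(8,9) shift_diff shift_scalar by (auto simp: N_def)
  then show ?thesis using zero by (metis eq_iff_diff_eq_0)
qed

inductive_set alg :: "'v endo set \<Rightarrow> 'v endo set" for S where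
  alg_one: "1 \<in> alg S"
| alg_mult: "X \<in> S \<Longrightarrow> Y \<in> alg S \<Longrightarrow> X * Y \<in> alg S"
| alg_add: "Y \<in> alg S \<Longrightarrow> Z \<in> alg S \<Longrightarrow> Y + Z \<in> alg S"
| alg_scale: "Y \<in> alg S \<Longrightarrow> sc c * Y \<in> alg S"

lemma alg_base: "X \<in> S \<Longrightarrow> X \<in> alg S"
  using alg_mult[OF _ alg_one, of X S] by simp

lemma alg_zero: "0 \<in> alg S"
  using alg_scale[OF alg_one, of 0 S] by simp

lemma stable_algebra_alg:
  assumes lin: "\<And>X. X \<in> S \<Longrightarrow> lin X" and comm: "\<And>X Y. X \<in> S \<Longrightarrow> Y \<in> S \<Longrightarrow> X * Y = Y * X"
    and der: "\<And>X Y. X \<in> gens \<Longrightarrow> Y \<in> S \<Longrightarrow> br X Y \<in> alg S"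
  shows "stable_algebra (alg S)"
proof -
  have l: "lin Y" if "Y \<in> alg S" for Y
    using that by induction (auto simp: lin V.lin_simps)
  have c: "X * Y = Y * X" if "Y \<in> alg S" "lin X" "\<And>Z. Z \<in> S \<Longrightarrow> X * Z = Z * X" for X Y
    using that(1)
  proof induction
    case (alg_mult Z Y)
    then show ?case using that(3)[of Z] by (metis mult.assoc)
  next
    case (alg_scale Y d)
    then show ?case using V.linD[OF that(2)] by (metis mult.assoc)
  qed (auto simp: algebra_simps)
  have c': "X * Y = Y * X" if "X \<in> S" "Y \<in> alg S" for X Y
    using c[OF that(2) lin[OF that(1)]] comm that(1) by blast
  have cc: "Y * Z = Z * Y" if "Y \<in> alg S" "Z \<in> alg S" for Y Z
    by (rule c[OF that(2) l[OF that(1)]]) (use c' that(1) in metis)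
  have m: "Y * Z \<in> alg S" if "Y \<in> alg S" "Z \<in> alg S" for Y Z
    using that by induction (auto simp: mult.assoc distrib_right intro: alg.intros)
  have d: "br X Y \<in> alg S" if X: "X \<in> gens" and "Y \<in> alg S" for X Y
    using that(2)
  proof induction
    case alg_one
    then show ?case by (simp add: alg_zero)
  next
    case (alg_mult Z Y)
    have "br X (Z * Y) = br X Z * Y + Z * br X Y" by (rule br_mult)
    then show ?case using alg_mult der[OF X] m by (auto intro: alg.intros)
  next
    case (alg_add Y Z)
    have "br X (Y + Z) = br X Y + br X Z" by (simp add: algebra_simps)
    then show ?case using alg_add by (auto intro: alg.intros)
  next
    case (alg_scale Y d)
    have "br X (sc d * Y) = sc d * br X Y"
      unfolding br_mult using V.linD[OF lin_gens[OF X], of d] by simp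
    then show ?case using alg_scale by (auto intro: alg.intros)
  qed
  show ?thesis unfolding stable_algebra_def
    using l cc m d by (auto intro: alg.intros)
qed

end

context loop_rep
begin

section \<open>The Laurent monomials act injectively\<close>

definition At :: "'v endo set" where
  "At = alg {tt r b | r b. True}"

lemma tt_At: "tt r b \<in> At"
  unfolding At_def by (rule alg_base) blast

lemma stable_At: "stable_algebra At"
  unfolding At_def
proof (rule stable_algebra_alg)
  fix X Y assume XY: "X \<in> gens" "Y \<in> {tt r b | r b. True}"
  then obtain s b' where Y: "Y = tt s b'" by blast
  consider r b where "X = tt r b" | r b where "X = hh r b" | u b where "X = dd u b"
    using XY(1) unfolding gens_def by blast
  moreover have "sc c * tt r b \<in> alg {tt r b | r b. True}" for c r b
    by (intro alg_scale alg_base) blast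
  ultimately show "br X Y \<in> alg {tt r b | r b. True}"
    by cases (simp_all only: Y br_tt_tt br_hh_tt br_dd_tt alg_zero)
qed (use br_tt_tt in \<open>auto simp: lin_tt\<close>)

lemmas AtD = stable_algebraD[OF stable_At]

lemma At_power: "Y \<in> At \<Longrightarrow> Y ^ n \<in> At"
  by (induction n) (auto intro: AtD)

lemmas At_closed = tt_At AtD(1,5,6,9) At_power

lemma At_comm: "Y \<in> At \<Longrightarrow> Z \<in> At \<Longrightarrow> Y * Z = Z * Y"
  by (rule AtD)

lemma At_left_comm: "Y \<in> At \<Longrightarrow> Z \<in> At \<Longrightarrow> Y * (Z * U) = Z * (Y * U)"
  by (metis At_comm mult.assoc)

lemmas At_ac = At_comm At_left_comm mult.assoc At_closed

text \<open>
  Linear combinations of products of \<open>p\<close> operators \<open>t\<^sup>q b\<close> with \<open>q\<close> on the positive side of the hyperplane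
  orthogonal to \<open>s\<close>. Brackets with \<open>h\<^sub>a b\<close> for \<open>a\<close> on that side preserve them.
\<close>

inductive posprod :: "'m ivec \<Rightarrow> nat \<Rightarrow> 'v endo \<Rightarrow> bool" for s where
  pos_one: "posprod s 0 1"
| pos_mult: "om q s > 0 \<Longrightarrow> posprod s p Y \<Longrightarrow> posprod s (Suc p) (tt q b * Y)"
| pos_add: "posprod s p Y \<Longrightarrow> posprod s p Z \<Longrightarrow> posprod s p (Y + Z)"
| pos_scale: "posprod s p Y \<Longrightarrow> posprod s p (sc c * Y)"

lemma posprod_At: "posprod s p Y \<Longrightarrow> Y \<in> At"
  by (induction rule: posprod.induct) (auto intro: At_closed)

lemma posprod_br:
  assumes "posprod s p Y" "om a s > 0"
  shows "posprod s p (br (hh a b) Y)"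
  using assms(1)
proof induction
  case pos_one
  then show ?case using posprod.pos_scale[OF posprod.pos_one, where c = 0 and s = s] by simp
next
  case (pos_mult q p Y b')
  have "br (hh a b) (tt q b' * Y) =
      sc (of_int (om a q)) * (tt (a + q) (b * b') * Y) + tt q b' * br (hh a b) Y"
    unfolding br_mult br_hh_tt by (simp add: mult.assoc)
  moreover have "om (a + q) s > 0" using pos_mult assms(2) by simp
  ultimately show ?case
    using pos_mult by (metis posprod.pos_add posprod.pos_scale posprod.pos_mult)
next
  case (pos_add p Y Z)
  then show ?case unfolding br_add by (metis posprod.pos_add)
next
  case (pos_scale p Y c)
  have "br (hh a b) (sc c * Y) = sc c * br (hh a b) Y"
    unfolding br_mult using V.linD[OF lin_hh, of a b c] by simp
  then show ?case using pos_scale by (simp add: posprod.pos_scale)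
qed

lemma posprod_annihilate:
  assumes "lin P" "\<And>q b Y. om q s > 0 \<Longrightarrow> posprod s p Y \<Longrightarrow> P * (tt q b * Y) = 0"
    and "posprod s (Suc p) Y"
  shows "P * Y = 0"
  using assms(3)
proof (induction "Suc p" Y rule: posprod.induct)
  case (pos_scale Y c)
  then show ?case using V.linD[OF assms(1), of c] by (metis mult.assoc mult_zero_right)
qed (auto simp: assms(2) distrib_left)

text \<open>
  Let \<open>x = t\<^sup>s\<close>, \<open>y = t\<^sup>-\<^sup>s\<close>, so that \<open>x\<^sup>M y\<^sup>M = 0\<close>. Bracketing \<open>x\<^sup>a y\<^sup>c Y = 0\<close> with \<open>h\<^sub>q\<^sub>+\<^sub>s b\<close> and
  multiplying by \<open>x\<close> replaces one factor \<open>y\<close> by \<open>t\<^sup>q b\<close>: the term from \<open>x\<^sup>a\<close> vanishes after the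
  multiplication, and the term from \<open>Y\<close> vanishes since its bracket is again a positive product. When
  no \<open>y\<close> is left, brackets with \<open>h\<^sub>q\<^sub>-\<^sub>s b\<close> replace the \<open>2M\<close> factors \<open>x\<close> one by one.
\<close>

lemma posprod_zero:
  assumes nil: "(tt s 1 * tt (- s) 1) ^ M = 0" and Y: "posprod s (3 * M) Y"
  shows "Y = 0"
proof -
  define x y where "x = tt s 1" and "y = tt (- s) 1"
  have xy: "x \<in> At" "y \<in> At" "lin x" "lin y" by (auto simp: x_def y_def tt_At lin_tt)
  have x: "br (hh a b) x = sc (of_int (om a s)) * tt (a + s) b"
    and y: "br (hh a b) y = sc (- of_int (om a s)) * tt (a - s) b" for a b
    by (simp_all add: x_def y_def br_hh_tt)
  have Dx: "br (hh a b) (x ^ n) = sc (of_nat n) * (x ^ (n - 1) * (sc (of_int (om a s)) * tt (a + s) b))"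
    and Dy: "br (hh a b) (y ^ n) = sc (of_nat n) * (y ^ (n - 1) * (sc (- of_int (om a s)) * tt (a - s) b))"
    for a b n
    unfolding x[symmetric] y[symmetric]
    by (rule V.br_power; (rule xy)?; simp add: x y; simp add: At_ac xy)+
  have 1: "x ^ (M + i) * y ^ (M - i) * Y = 0" if "i \<le> M" "posprod s i Y" for i Y
    using that
  proof (induction i arbitrary: Y)
    case 0
    have "(x * y) ^ M = x ^ M * y ^ M" by (rule commute_power_mult) (simp add: At_ac xy)
    then show ?case using nil by (simp add: x_def y_def)
  next
    case (Suc i)
    show ?case
    proof (rule posprod_annihilate[OF _ _ Suc.prems(2)])
      show "lin (x ^ (M + Suc i) * y ^ (M - Suc i))" using xy by (intro V.lin_simps)
      fix q b Y assume q: "om q s > 0" and Y: "posprod s i Y"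
      define X where "X = hh (q + s) b"
      have YA: "Y \<in> At" using Y by (rule posprod_At)
      obtain a where a: "M + i = Suc a" using Suc.prems(1) by (cases "M + i") auto
      obtain c where c: "M - i = Suc c" "c = M - Suc i" using Suc.prems(1) by (cases "M - i") auto
      have IH: "x ^ Suc a * (y ^ Suc c * Z) = 0" if "posprod s i Z" for Z
        using Suc.IH[OF _ that] Suc.prems(1) by (simp only: a c(1)) (simp add: mult.assoc)
      have "0 = x * br X (x ^ Suc a * (y ^ Suc c * Y))" using IH[OF Y] by simp
      also have "\<dots> = x * (br X (x ^ Suc a) * (y ^ Suc c * Y)) + x * (x ^ Suc a * (br X (y ^ Suc c) * Y))
          + x * (x ^ Suc a * (y ^ Suc c * br X Y))"
        unfolding br_mult by (simp only: distrib_left add.assoc)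
      also have "x ^ Suc a * (y ^ Suc c * br X Y) = 0"
        unfolding X_def by (rule IH, rule posprod_br[OF Y]) (use q in simp)
      also have "x * (br X (x ^ Suc a) * (y ^ Suc c * Y)) =
         sc (of_nat (Suc a)) * (sc (of_int (om (q + s) s)) * (tt (q + s + s) b * (x ^ Suc a * (y ^ Suc c * Y))))"
        unfolding X_def Dx by (simp add: At_ac xy YA)
      also have "\<dots> = 0" using IH[OF Y] by simp
      also have "x * (x ^ Suc a * (br X (y ^ Suc c) * Y)) =
        sc (of_nat (Suc c)) * (sc (- of_int (om q s)) * (x ^ Suc (Suc a) * (y ^ c * (tt q b * Y))))"
        unfolding X_def Dy by (simp add: At_ac xy YA)
      finally have "x ^ Suc (Suc a) * (y ^ c * (tt q b * Y)) = 0"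
        using q by (simp add: V.sc_eq_0_iff del: of_nat_Suc power_Suc) 
      then show "x ^ (M + Suc i) * y ^ (M - Suc i) * (tt q b * Y) = 0"
        using a c(2) by (simp add: mult.assoc)
    qed
  qed
  have 2: "x ^ (2 * M - j) * Y = 0" if "j \<le> 2 * M" "posprod s (M + j) Y" for j Y
    using that
  proof (induction j arbitrary: Y)
    case 0
    then show ?case using 1[of M Y] by (simp add: mult_2)
  next
    case (Suc j)
    show ?case
    proof (rule posprod_annihilate[OF _ _ Suc.prems(2)[unfolded add_Suc_right]])
      show "lin (x ^ (2 * M - Suc j))" using xy by (intro V.lin_simps)
      fix q b Y assume q: "om q s > 0" and Y: "posprod s (M + j) Y"
      define X where "X = hh (q - s) b"
      have YA: "Y \<in> At" using Y by (rule posprod_At)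
      obtain c where c: "2 * M - j = Suc c" "c = 2 * M - Suc j"
        using Suc.prems(1) by (cases "2 * M - j") auto
      have IH: "x ^ Suc c * Z = 0" if "posprod s (M + j) Z" for Z
        using Suc.IH[OF _ that] Suc.prems(1) by (simp only: c(1))
      have "0 = br X (x ^ Suc c * Y)" using IH[OF Y] by simp
      also have "\<dots> = br X (x ^ Suc c) * Y + x ^ Suc c * br X Y" by (rule br_mult)
      also have "x ^ Suc c * br X Y = 0"
        unfolding X_def by (rule IH, rule posprod_br[OF Y]) (use q in simp)
      also have "br X (x ^ Suc c) * Y = sc (of_nat (Suc c)) * (sc (of_int (om q s)) * (x ^ c * (tt q b * Y)))"
        unfolding X_def Dx by (simp add: At_ac xy YA)
      finally show "x ^ (2 * M - Suc j) * (tt q b * Y) = 0"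
        using q c(2) by (simp add: V.sc_eq_0_iff del: of_nat_Suc)
    qed
  qed
  have "x ^ (2 * M - 2 * M) * Y = 0" by (rule 2) (use Y in \<open>simp_all add: mult.commute\<close>)
  then show ?thesis by simp
qed

text \<open>
  If \<open>t\<^sup>s\<close> is not injective, \<open>t\<^sup>s t\<^sup>-\<^sup>s\<close> is nilpotent. By the previous lemma the powers of \<open>t\<^sup>q\<close>
  with \<open>q\<close> not orthogonal to \<open>s\<close> vanish, so these \<open>q\<close> inherit the property, and every nonzero \<open>q\<close>
  is reached in two steps.
\<close>

lemma monomial_pairs_nilpotent:
  assumes "s \<noteq> 0" "\<not> inj (app (tt s 1))" and "q \<noteq> 0"
  shows "(tt q 1 * tt (- q) 1) ^ M = 0"
proof -
  let ?nil = "\<lambda>s. (tt s 1 * tt (- s) 1) ^ M = 0"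
  have sh: "shift 0 (tt s 1 * tt (- s) 1)" for s
    using shift_mult[OF shift_tt[of s 1] shift_tt[of "- s" 1]] by simp
  have neg: "?nil (- s)" if "?nil s" for s
    using that At_comm[OF tt_At tt_At, of s 1 "- s" 1] by simp
  have pos: "?nil q" if "?nil s" "om q s > 0" for s q
  proof -
    have "posprod s n (tt q 1 ^ n)" for n
      by (induction n) (auto intro: posprod.intros that)
    then have 0: "tt q 1 ^ (3 * M) = 0" using posprod_zero that(1) by blast
    have "(tt q 1 * tt (- q) 1) ^ (3 * M) = 0"
      by (subst commute_power_mult) (simp_all add: At_ac 0)
    then have "\<exists>n. (tt q 1 * tt (- q) 1) ^ n \<cdot> v = 0" for v
      by (intro exI[of _ "3 * M"]) simp
    then show ?thesis by (rule nilpotent_bound[OF sh])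
  qed
  have step: "?nil q" if "?nil s" "om q s \<noteq> 0" for s q
    using pos[OF that(1), of q] pos[OF neg[OF that(1)], of q] that(2) by (auto simp: linorder_neq_iff)
  obtain v where v: "tt s 1 \<cdot> v = 0" "v \<noteq> 0" using assms(2) by (auto simp: inj_app_iff)
  have "(tt s 1 * tt (- s) 1) \<cdot> v = (tt (- s) 1 * tt s 1) \<cdot> v"
    by (rule arg_cong[OF At_comm]) (rule tt_At)+
  then have "\<not> inj (app (tt s 1 * tt (- s) 1))" using v by (auto simp: inj_app_iff)
  then have "?nil s"
    using stable_inj_or_nil[OF stable_At, of "tt s 1 * tt (- s) 1"] nilpotent_bound[OF sh]
    by (auto intro: At_closed)
  moreover obtain k where "om k s \<noteq> 0" "om k q \<noteq> 0"
    using om_generic[of "{s, q}"] assms by auto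
  ultimately show ?thesis using step om_skew[of k q] by (metis minus_zero)
qed

definition tprod :: "('m ivec \<times> 'b) list \<Rightarrow> 'v endo" where
  "tprod L = prod_list (map (\<lambda>(q, b). tt q b) L)"

lemma tprod_simps [simp]: "tprod [] = 1" "tprod ((q, b) # L) = tt q b * tprod L"
  "tprod (L @ L') = tprod L * tprod L'"
  by (simp_all add: tprod_def)

lemma tprod_At: "tprod L \<in> At"
  by (induction L) (auto simp: At_closed)

lemma tprod_filter: "tprod L = tprod (filter P L) * tprod (filter (\<lambda>x. \<not> P x) L)"
  by (induction L) (auto simp: At_ac tprod_At)

lemma posprod_tprod: "(\<And>q b. (q, b) \<in> set L \<Longrightarrow> om q s > 0) \<Longrightarrow> posprod s (length L) (tprod L)"
proof (induction L)
  case Nil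
  then show ?case by (simp add: posprod.pos_one)
next
  case (Cons x L)
  obtain q b where x: "x = (q, b)" by (metis surj_pair)
  have "om q s > 0" "posprod s (length L) (tprod L)" using Cons by (auto simp: x)
  then show ?case by (simp add: x posprod.pos_mult)
qed

text \<open>
  A generic \<open>k\<close> separates the degrees of the factors into two sides; one of the sides contains \<open>3M\<close> of
  them.
\<close>

lemma tprod_zero:
  assumes "s \<noteq> 0" "\<not> inj (app (tt s 1))"
    and L: "\<And>q b. (q, b) \<in> set L \<Longrightarrow> q \<noteq> 0" "length L \<ge> 6 * M"
  shows "tprod L = 0"
proof -
  obtain k where k: "\<forall>q\<in>insert s (fst ` set L). om k q \<noteq> 0"
    using om_generic[of "insert s (fst ` set L)"] L(1) assms(1) by force
  then have "k \<noteq> 0" by auto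
  have pos: "tprod L' = 0" if "s \<noteq> 0" and L': "\<And>q b. (q, b) \<in> set L' \<Longrightarrow> om q s > 0" "length L' \<ge> 3 * M" for s L'
  proof -
    have "posprod s (length (take (3 * M) L')) (tprod (take (3 * M) L'))"
      by (rule posprod_tprod) (use L'(1) in \<open>meson in_set_takeD\<close>)
    then have "tprod (take (3 * M) L') = 0"
      using posprod_zero monomial_pairs_nilpotent[OF assms(1,2) \<open>s \<noteq> 0\<close>] L'(2) by (simp add: min_absorb2)
    moreover have "tprod L' = tprod (take (3 * M) L') * tprod (drop (3 * M) L')"
      by (simp flip: tprod_simps(3))
    ultimately show ?thesis by simp
  qed
  define P where "P = (\<lambda>x::'m ivec \<times> 'b. om (fst x) k > 0)"
  have "length (filter P L) + length (filter (\<lambda>x. \<not> P x) L) = length L"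
    by (rule sum_length_filter_compl)
  then consider "length (filter P L) \<ge> 3 * M" | "length (filter (\<lambda>x. \<not> P x) L) \<ge> 3 * M"
    using L(2) by linarith
  then show ?thesis
  proof cases
    case 1
    have "tprod (filter P L) = 0" by (rule pos[of k]) (use 1 \<open>k \<noteq> 0\<close> in \<open>auto simp: P_def\<close>)
    then show ?thesis using tprod_filter[of L P] by simp
  next
    case 2
    have "tprod (filter (\<lambda>x. \<not> P x) L) = 0"
    proof (rule pos[of "- k"])
      fix q b assume "(q, b) \<in> set (filter (\<lambda>x. \<not> P x) L)"
      then have "\<not> om q k > 0" "om k q \<noteq> 0" using k by (auto simp: P_def)
      then show "om q (- k) > 0" using om_skew[of q k] by simp
    qed (use 2 \<open>k \<noteq> 0\<close> in auto)
    then show ?thesis using tprod_filter[of L P] by simp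
  qed
qed

text \<open>
  If all long products of operators \<open>t\<^sup>q b\<close> with \<open>q \<noteq> 0\<close> vanish, a product that is nonzero and as long as
  possible has its image in their common kernel. That kernel is a submodule, because the brackets with
  \<open>h\<^sub>k b\<close> never produce \<open>t\<^sup>0\<close>: the coefficient \<open>om k q\<close> is zero when \<open>k + q = 0\<close>.
\<close>

lemma tt_injective:
  assumes "r \<noteq> 0" "tt r 1 \<noteq> 0" "s \<noteq> 0"
  shows "inj (app (tt s 1))"
proof (rule ccontr)
  assume s: "\<not> ?thesis"
  define Q where "Q n \<longleftrightarrow> (\<forall>L. length L = n \<and> (\<forall>(q, b)\<in>set L. q \<noteq> 0) \<longrightarrow> tprod L = 0)" for n
  have "Q (6 * M)"
    unfolding Q_def by (intro allI impI tprod_zero[OF assms(3) s]) auto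
  then obtain n where n: "Q n" "\<And>i. i < n \<Longrightarrow> \<not> Q i" using exists_least_iff[of Q] by blast
  have "\<not> Q 0" using one_neq_zero by (simp add: Q_def)
  then have "n \<noteq> 0" using n(1) by metis
  then obtain L where L: "length L = n - 1" "\<forall>(q, b)\<in>set L. q \<noteq> 0" "tprod L \<noteq> 0"
    using n(2)[of "n - 1"] by (auto simp: Q_def)
  then obtain w where w: "tprod L \<cdot> w \<noteq> 0" by (metis app_simps(1) endo_eqI)
  define W where "W = {v. \<forall>q b. q \<noteq> 0 \<longrightarrow> tt q b \<cdot> v = 0}"
  have "W = UNIV"
  proof (rule irreducible_gens)
    show "V.subspace W" by (rule V.subspaceI) (auto simp: W_def V.lin_scale[OF lin_tt])
    have "tprod ((q, b) # L) = 0" if "q \<noteq> 0" for q b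
      using n(1) L \<open>n \<noteq> 0\<close> that unfolding Q_def by (elim allE[of _ "(q, b) # L"]) auto
    then have "tt q b \<cdot> tprod L \<cdot> w = 0" if "q \<noteq> 0" for q b
      using that by (metis app_simps(1,6) tprod_simps(2))
    then show "tprod L \<cdot> w \<in> W" by (simp add: W_def)
    fix X v assume X: "X \<in> gens" and v: "v \<in> W"
    have "tt q b \<cdot> X \<cdot> v = 0" if q: "q \<noteq> 0" for q b
    proof -
      have "br X (tt q b) \<cdot> v = 0"
      proof -
        have z: "tt q' b' \<cdot> v = 0" if "q' \<noteq> 0" for q' b' using v that by (simp add: W_def)
        consider r b' where "X = tt r b'" | r b' where "X = hh r b'" | u b' where "X = dd u b'"
          using X unfolding gens_def by blast
        then show ?thesis
        proof cases
          case 1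
          show ?thesis unfolding 1 br_tt_tt by simp
        next
          case 3
          show ?thesis unfolding 3 br_dd_tt by (simp add: z q)
        next
          case 2
          have "om r q = 0" if "r + q = 0" 
          proof -
            have "r = - q" using that by (simp add: eq_neg_iff_add_eq_0)
            then show ?thesis by simp
          qed
          then show ?thesis unfolding 2 br_hh_tt by (cases "r + q = 0") (auto simp: z)
        qed
      qed
      then show ?thesis using v q by (simp add: W_def)
    qed
    then show "X \<cdot> v \<in> W" by (simp add: W_def)
  qed (rule w)
  then have "tt r 1 \<cdot> v = 0" for v using assms(1) by (auto simp: W_def)
  then show False using assms(2) by (auto intro: endo_eqI)
qed

end

lemma (in complex_space) lin_sc_left: "lin f \<Longrightarrow> f * (sc c * g) = sc c * (f * g)"
  by (simp add: linD flip: mult.assoc)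

lemma double_neq_0: "n + n \<noteq> 0" if "n \<noteq> 0" for n :: "'m::finite ivec"
  using that by (auto simp: vec_eq_iff)

locale loop_rep_nontrivial = loop_rep scale sclB tt hh dd M
  for scale :: "complex \<Rightarrow> 'v::ab_group_add \<Rightarrow> 'v"
    and sclB :: "complex \<Rightarrow> 'b::comm_ring_1 \<Rightarrow> 'b"
    and tt hh :: "'m::finite ivec \<Rightarrow> 'b \<Rightarrow> 'v endo"
    and dd :: "'m cvec \<Rightarrow> 'b \<Rightarrow> 'v endo"
    and M :: nat +
  assumes nontriv: "\<exists>s. s \<noteq> 0 \<and> tt s 1 \<noteq> 0" and nontriv0: "tt 0 1 \<noteq> 0"
begin

lemma inj_tt: "r \<noteq> 0 \<Longrightarrow> inj (app (tt r 1))"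
  using tt_injective nontriv by blast

lemma tt_cancel: "r \<noteq> 0 \<Longrightarrow> tt r 1 * f = tt r 1 * g \<Longrightarrow> f = g"
proof (rule endo_eqI)
  fix v assume r: "r \<noteq> 0" and eq: "tt r 1 * f = tt r 1 * g"
  have "tt r 1 \<cdot> f \<cdot> v = tt r 1 \<cdot> g \<cdot> v" using arg_cong[OF eq, of "\<lambda>h. h \<cdot> v"] by simp
  then show "f \<cdot> v = g \<cdot> v" using inj_tt[OF r] by (simp add: inj_eq)
qed

lemma tt_nonzero: "r \<noteq> 0 \<Longrightarrow> tt r 1 \<noteq> 0"
  using tt_cancel[of r 1 0] one_neq_zero by auto

lemma sc_tt_eq_iff: "r \<noteq> 0 \<Longrightarrow> sc a * tt r 1 = sc b * tt r 1 \<longleftrightarrow> a = b"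
  using V.sc_eq_0_iff[of "a - b" "tt r 1"] tt_nonzero by (auto simp: V.sc_diff left_diff_distrib)

lemma sc_eq_iff: "sc a = sc b \<longleftrightarrow> a = b"
  using V.sc_eq_0_iff[of "a - b" 1] one_neq_zero by (auto simp: V.sc_diff)

lemma At_injective: "\<exists>T\<in>At. shift k T \<and> inj (app T)"
proof (cases "k = 0")
  case True
  then show ?thesis using AtD(1) shift_one by (auto simp: inj_app_iff)
next
  case False
  then show ?thesis using tt_At shift_tt inj_tt by blast
qed

lemma At_scalar: "Y \<in> At \<Longrightarrow> shift 0 Y \<Longrightarrow> \<exists>c. Y = sc c"
  by (rule degree_zero_scalar[OF stable_At At_injective])

text \<open>
  Multiplication by \<open>t\<^sup>-\<^sup>r\<close> reduces this to degree \<open>0\<close>.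
\<close>

lemma At_shift:
  assumes r: "r \<noteq> 0" and Y: "Y \<in> At" "shift r Y"
  shows "\<exists>p. Y = sc p * tt r 1"
proof -
  have shift: "shift 0 (tt (- r) 1 * Z)" if "shift r Z" for Z
    using shift_mult[OF shift_tt that, of "- r" 1] by simp
  have "\<exists>a. tt (- r) 1 * Y = sc a"
    by (intro At_scalar shift Y AtD(5) tt_At)
  then obtain a where a: "tt (- r) 1 * Y = sc a" ..
  have "\<exists>b. tt (- r) 1 * tt r 1 = sc b"
    by (intro At_scalar shift shift_tt AtD(5) tt_At)
  then obtain b where b: "tt (- r) 1 * tt r 1 = sc b" ..
  have r': "- r \<noteq> 0" using r by simp
  have "b \<noteq> 0"
  proof
    assume "b = 0"
    then have "tt (- r) 1 * tt r 1 = tt (- r) 1 * 0" using b by simp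
    then show False using tt_cancel[OF r'] tt_nonzero[OF r] by blast
  qed
  have "tt (- r) 1 * (sc (a / b) * tt r 1) = sc (a / b) * (tt (- r) 1 * tt r 1)"
    by (rule V.lin_sc_left[OF lin_tt])
  also have "\<dots> = tt (- r) 1 * Y" using \<open>b \<noteq> 0\<close> by (simp add: a b flip: V.sc_mult)
  finally show ?thesis using tt_cancel[OF r'] by metis
qed

section \<open>The character through which the coefficient algebra acts\<close>

definition psi :: "'b \<Rightarrow> complex" where
  "psi b = (SOME p. \<forall>r. r \<noteq> 0 \<longrightarrow> tt r b = sc p * tt r 1)"

text \<open>
  The factor is the same for \<open>r\<close> and \<open>q\<close> if \<open>om q r \<noteq> 0\<close>, since the bracket with \<open>h\<^sub>q\<^sub>-\<^sub>r\<close> turns \<open>t\<^sup>r b\<close>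
  into a multiple of \<open>t\<^sup>q b\<close>.
\<close>

lemma tt_psi: "r \<noteq> 0 \<Longrightarrow> tt r b = sc (psi b) * tt r 1"
proof -
  have "\<forall>r. \<exists>p. r \<noteq> 0 \<longrightarrow> tt r b = sc p * tt r 1" using At_shift[OF _ tt_At shift_tt] by blast
  then obtain p where p: "\<And>r. r \<noteq> 0 \<Longrightarrow> tt r b = sc (p r) * tt r 1" by metis
  have step: "p q = p r" if "om q r \<noteq> 0" for q r
  proof -
    have qr: "q \<noteq> 0" "r \<noteq> 0" "om (q - r) r = om q r" using that by auto
    have "br (hh (q - r) 1) (tt r b) = sc (p r) * br (hh (q - r) 1) (tt r 1)"
      unfolding p[OF qr(2)] br_mult using V.linD[OF lin_hh] by simp
    then have "sc (of_int (om q r)) * tt q b = sc (of_int (om q r)) * (sc (p r) * tt q 1)"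
      by (simp add: br_hh_tt qr V.sc_mult_assoc mult.commute)
    then have "sc (of_int (om q r)) * (tt q b - sc (p r) * tt q 1) = 0" by (simp add: right_diff_distrib)
    then have "sc (p q) * tt q 1 = sc (p r) * tt q 1"
      using that by (simp add: V.sc_eq_0_iff p[OF qr(1)])
    then show ?thesis by (simp add: sc_tt_eq_iff qr(1))
  qed
  obtain s :: "'m ivec" where s: "s \<noteq> 0" using nontriv by blast
  have "\<forall>r. r \<noteq> 0 \<longrightarrow> tt r b = sc (p s) * tt r 1"
    using p om_connected[of p, OF step _ s] by metis
  then have "\<forall>r. r \<noteq> 0 \<longrightarrow> tt r b = sc (psi b) * tt r 1" unfolding psi_def by (rule someI)
  then show "r \<noteq> 0 \<Longrightarrow> tt r b = sc (psi b) * tt r 1" by blast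
qed

lemma psi_unique: "r \<noteq> 0 \<Longrightarrow> tt r b = sc p * tt r 1 \<Longrightarrow> psi b = p"
  using tt_psi[of r b] sc_tt_eq_iff by metis

lemma psi_add: "psi (b + b') = psi b + psi b'"
  and psi_scale: "psi (sclB c b) = c * psi b"
  and psi_one: "psi 1 = 1"
  and psi_mult: "psi (b * b') = psi b * psi b'"
proof -
  obtain s :: "'m ivec" where s: "s \<noteq> 0" using nontriv by blast
  show "psi (b + b') = psi b + psi b'" "psi (sclB c b) = c * psi b" "psi 1 = 1"
    by (rule psi_unique[OF s];
        simp add: tt_add tt_scale tt_psi[OF s, of b] tt_psi[OF s, of b'] V.sc_add V.sc_mult
          distrib_right mult.assoc)+
  obtain k where k: "om k s \<noteq> 0" using om_nondegenerate[OF s] by blast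
  then have ks: "k + s \<noteq> 0" by (metis add_eq_0_iff om_simps(3,6) om_skew minus_zero)
  have "br (hh k b) (tt s b') = sc (psi b') * br (hh k b) (tt s 1)"
    unfolding tt_psi[OF s, of b'] br_mult using V.linD[OF lin_hh] by simp
  then have "sc (of_int (om k s)) * tt (k + s) (b * b') =
      sc (of_int (om k s)) * (sc (psi b') * tt (k + s) b)"
    by (simp add: br_hh_tt V.sc_mult_assoc mult.commute)
  then have "sc (of_int (om k s)) * (tt (k + s) (b * b') - sc (psi b') * tt (k + s) b) = 0"
    by (simp add: right_diff_distrib)
  then have "tt (k + s) (b * b') = sc (psi b') * tt (k + s) b" using k by (simp add: V.sc_eq_0_iff)
  then show "psi (b * b') = psi b * psi b'"
    by (intro psi_unique[OF ks]) (simp add: tt_psi[OF ks, of b] V.sc_mult_assoc mult.commute)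
qed

section \<open>Quasi-associativity of the Laurent monomials\<close>

text \<open>
  Let \<open>t\<^sup>m t\<^sup>n = K(m,n) t\<^sup>m\<^sup>+\<^sup>n\<close>. The bracket of \<open>h\<^sub>m\<^sub>-\<^sub>n\<close> with \<open>t\<^sup>n t\<^sup>n\<close> gives \<open>K(m,n) = K(n,n)\<close> for
  nonorthogonal \<open>m, n\<close>; by symmetry \<open>K(n,n)\<close> is a constant \<open>\<kappa>\<close>. The orthogonal pairs follow from the
  bracket of \<open>h\<^sub>k\<close> with \<open>t\<^sup>m t\<^sup>n\<^sup>-\<^sup>k\<close> for a generic \<open>k\<close>, which involves otherwise only nonorthogonal pairs.
\<close>

lemma exists_kappa:
  "\<exists>\<kappa>. \<kappa> \<noteq> 0 \<and> (\<forall>m n. m \<noteq> 0 \<and> n \<noteq> 0 \<and> m + n \<noteq> 0 \<longrightarrow> tt m 1 * tt n 1 = sc \<kappa> * tt (m + n) 1)"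
proof -
  have "\<forall>m n. \<exists>k. m \<noteq> 0 \<and> n \<noteq> 0 \<and> m + n \<noteq> 0 \<longrightarrow> tt m 1 * tt n 1 = sc k * tt (m + n) 1"
    using At_shift[OF _ AtD(5)[OF tt_At tt_At] shift_mult[OF shift_tt shift_tt]] by blast
  then obtain K where K: "\<And>m n. m \<noteq> 0 \<Longrightarrow> n \<noteq> 0 \<Longrightarrow> m + n \<noteq> 0 \<Longrightarrow> tt m 1 * tt n 1 = sc (K m n) * tt (m + n) 1"
    by metis
  have ne: "m \<noteq> 0" "n \<noteq> 0" "m + n \<noteq> 0" if "om m n \<noteq> 0" for m n :: "'m ivec"
    using that by (auto simp: add_eq_0_iff)
  have ttsc: "tt m b * (sc c * f) = sc c * (tt m b * f)" for m b c f
    by (rule V.lin_sc_left[OF lin_tt])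
  have diag: "K m n = K n n" if "om m n \<noteq> 0" for m n
  proof -
    note mn = ne[OF that] double_neq_0[OF ne(2)[OF that]]
    let ?c = "of_int (om m n) :: complex"
    have "br (hh (m - n) 1) (tt n 1 * tt n 1) = sc (K n n) * br (hh (m - n) 1) (tt (n + n) 1)"
      unfolding K[OF mn(2,2,4)] br_mult using V.linD[OF lin_hh] by simp
    moreover have "br (hh (m - n) 1) (tt n 1 * tt n 1) = sc (2 * ?c) * (tt m 1 * tt n 1)"
    proof -
      have "br (hh (m - n) 1) (tt n 1 * tt n 1) = sc ?c * (tt m 1 * tt n 1) + sc ?c * (tt m 1 * tt n 1)"
        unfolding br_mult br_hh_tt
        by (simp add: ttsc mult.assoc At_comm[OF tt_At tt_At, of n 1 m 1])
      then show ?thesis by (simp only: mult_2 V.sc_add distrib_right)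
    qed
    moreover have "br (hh (m - n) 1) (tt (n + n) 1) = sc (2 * ?c) * tt (m + n) 1"
    proof -
      have "m - n + (n + n) = m + n" by (simp add: vec_eq_iff)
      moreover have "om (m - n) (n + n) = 2 * om m n" by (simp only: om_simps)
      ultimately show ?thesis
        unfolding br_hh_tt by (simp only: of_int_mult of_int_numeral mult_1_left)
    qed
    ultimately have "sc (2 * ?c * K m n) * tt (m + n) 1 = sc (2 * ?c * K n n) * tt (m + n) 1"
      by (simp add: K[OF mn(1-3)] V.sc_mult_assoc mult.commute)
    then show ?thesis using that by (simp add: sc_tt_eq_iff mn(3))
  qed
  have sym: "K m n = K n m" if "om m n \<noteq> 0" for m n
  proof -
    note mn = ne[OF that]
    have "sc (K m n) * tt (m + n) 1 = sc (K n m) * tt (m + n) 1"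
      using K[OF mn] K[OF mn(2,1)] mn(3) At_comm[OF tt_At tt_At, of n 1 m 1] by (simp add: add.commute)
    then show ?thesis by (simp add: sc_tt_eq_iff mn(3))
  qed
  obtain s :: "'m ivec" where s: "s \<noteq> 0" using nontriv by blast
  define \<kappa> where "\<kappa> = K s s"
  have const: "K n n = \<kappa>" if "n \<noteq> 0" for n
  proof -
    have "K q q = K r r" if "om q r \<noteq> 0" for q r
      using diag[of q r] diag[of r q] sym[of q r] that om_skew[of r q] by simp
    then show ?thesis unfolding \<kappa>_def using om_connected[of "\<lambda>n. K n n"] that s by blast
  qed
  have generic: "tt m 1 * tt n 1 = sc \<kappa> * tt (m + n) 1" if "om m n \<noteq> 0" for m n
    using K[OF ne[OF that]] diag[OF that] const[OF ne(2)[OF that]] by simp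
  have "\<kappa> \<noteq> 0"
  proof
    assume "\<kappa> = 0"
    obtain k where "om k s \<noteq> 0" using om_nondegenerate[OF s] by blast
    then have "tt k 1 * tt s 1 = tt k 1 * 0" using generic[of k s] \<open>\<kappa> = 0\<close> by simp
    then show False using tt_cancel tt_nonzero s ne \<open>om k s \<noteq> 0\<close> by blast
  qed
  moreover have "tt m 1 * tt n 1 = sc \<kappa> * tt (m + n) 1"
    if mn: "m \<noteq> 0" "n \<noteq> 0" "m + n \<noteq> 0" for m n
  proof (cases "om m n = 0")
    case False
    then show ?thesis by (rule generic)
  next
    case True
    obtain k where k: "om k m \<noteq> 0" "om k n \<noteq> 0" "om k (m + n) \<noteq> 0"
      using om_generic[of "{m, n, m + n}"] mn by (metis finite.emptyI finite_insert insertCI insertE singletonD)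
    have om: "om m (n - k) \<noteq> 0" "om (m + k) (n - k) \<noteq> 0"
      using k True om_skew[of m k] om_skew[of m n] by auto
    have 1: "tt m 1 * tt (n - k) 1 = sc \<kappa> * tt (m + n - k) 1"
      using generic[OF om(1)] by (simp add: algebra_simps)
    have 2: "tt (m + k) 1 * tt (n - k) 1 = sc \<kappa> * tt (m + n) 1"
      using generic[OF om(2)] by simp
    have "br (hh k 1) (tt m 1 * tt (n - k) 1) = sc \<kappa> * br (hh k 1) (tt (m + n - k) 1)"
      unfolding 1 br_mult using V.linD[OF lin_hh] by simp
    then have "sc (of_int (om k m)) * (tt (m + k) 1 * tt (n - k) 1) + sc (of_int (om k n)) * (tt m 1 * tt n 1)
       = sc \<kappa> * (sc (of_int (om k (m + n))) * tt (m + n) 1)"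
      unfolding br_mult br_hh_tt by (simp add: ttsc mult.assoc add.commute)
    then have "sc (of_int (om k n)) * (tt m 1 * tt n 1 - sc \<kappa> * tt (m + n) 1) = 0"
      unfolding 2 by (simp add: V.sc_mult_assoc V.sc_add algebra_simps)
    then show ?thesis using k(2) by (simp add: V.sc_eq_0_iff)
  qed
  ultimately show ?thesis by blast
qed

definition kap :: complex where
  "kap = (SOME \<kappa>. \<kappa> \<noteq> 0 \<and> (\<forall>m n. m \<noteq> 0 \<and> n \<noteq> 0 \<and> m + n \<noteq> 0 \<longrightarrow> tt m 1 * tt n 1 = sc \<kappa> * tt (m + n) 1))"

lemma kap_nonzero: "kap \<noteq> 0"
  and tt_mult: "m \<noteq> 0 \<Longrightarrow> n \<noteq> 0 \<Longrightarrow> m + n \<noteq> 0 \<Longrightarrow> tt m 1 * tt n 1 = sc kap * tt (m + n) 1"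
  using someI_ex[OF exists_kappa, folded kap_def] by auto

text \<open>
  Associativity of \<open>t\<^sup>m t\<^sup>n t\<^sup>-\<^sup>n\<close> for any \<open>m\<close> that is not orthogonal to \<open>n\<close>.
\<close>

lemma tt_mult_inverse:
  assumes "n \<noteq> 0"
  shows "tt n 1 * tt (- n) 1 = sc (kap\<^sup>2)"
proof -
  obtain m where "om m n \<noteq> 0" using om_nondegenerate[OF assms] by blast
  then have m: "m \<noteq> 0" "m + n \<noteq> 0" by (auto simp: add_eq_0_iff)
  have "tt m 1 * (tt n 1 * tt (- n) 1) = sc kap * (tt (m + n) 1 * tt (- n) 1)"
    using tt_mult[OF m(1) assms m(2)] by (simp flip: mult.assoc)
  also have "tt (m + n) 1 * tt (- n) 1 = sc kap * tt m 1"
    using tt_mult[of "m + n" "- n"] m assms by simp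
  also have "sc kap * (sc kap * tt m 1) = tt m 1 * sc (kap\<^sup>2)"
    using V.linD[OF lin_tt] by (simp add: V.sc_mult_assoc power2_eq_square)
  finally show ?thesis by (rule tt_cancel[OF m(1)])
qed

text \<open>
  The normalisation that makes the monomials multiplicative. On \<open>r = 0\<close> the operator \<open>t\<^sup>0\<close>, which is
  an unrelated scalar, is replaced by \<open>1\<close>.
\<close>

definition T :: "'m ivec \<Rightarrow> 'v endo" where
  "T r = (if r = 0 then 1 else sc (1 / kap) * tt r 1)"

lemma T_0 [simp]: "T 0 = 1"
  by (simp add: T_def)

lemma tt_T: "r \<noteq> 0 \<Longrightarrow> tt r b = sc (psi b * kap) * T r"
  using kap_nonzero tt_psi[of r b] by (simp add: T_def V.sc_mult_assoc)

lemma T_At: "T r \<in> At"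
  by (simp add: T_def At_closed)

lemma lin_T: "lin (T r)"
  using T_At AtD(2) by blast

lemma shift_T: "shift r (T r)"
  by (auto simp: T_def intro: shift_one shift_sc shift_tt)

lemma T_mult: "T m * T n = T (m + n)"
proof -
  consider "m = 0" | "n = 0" | "m \<noteq> 0" "n \<noteq> 0" "m + n = 0" | "m \<noteq> 0" "n \<noteq> 0" "m + n \<noteq> 0" by blast
  then show ?thesis
  proof cases
    case 3
    then have n: "n = - m" by (simp add: add_eq_0_iff)
    have "T m * T n = sc (1 / kap) * (sc (1 / kap) * (tt m 1 * tt (- m) 1))"
      using 3 by (simp add: T_def n V.lin_sc_left[OF lin_tt] mult.assoc)
    then show ?thesis using 3 tt_mult_inverse[OF 3(1)] kap_nonzero
      by (simp add: power2_eq_square flip: V.sc_mult)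
  next
    case 4
    have "T m * T n = sc (1 / kap) * (sc (1 / kap) * (tt m 1 * tt n 1))"
      using 4 by (simp add: T_def V.lin_sc_left[OF lin_tt] mult.assoc)
    then show ?thesis using 4 tt_mult[OF 4] kap_nonzero
      by (simp add: T_def V.sc_mult_assoc)
  qed auto
qed

lemma T_inverse [simp]: "T r * T (- r) = 1" "T (- r) * T r = 1"
  by (simp_all add: T_mult)

lemma T_inverse_app [simp]: "T r \<cdot> T (- r) \<cdot> v = v" "T (- r) \<cdot> T r \<cdot> v = v"
  using T_inverse[of r] by (metis app_simps(2,6))+

lemma br_hh_T: "br (hh k b) (T s) = sc (of_int (om k s) * psi b) * T (k + s)"
proof (cases "s = 0")
  case False
  have "br (hh k b) (T s) = sc (1 / kap) * (sc (of_int (om k s)) * tt (k + s) b)"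
    using False V.linD[OF lin_hh, of k b "1 / kap"] unfolding T_def
    by (simp only: if_False br_mult br_hh_tt) simp
  also have "\<dots> = sc (of_int (om k s) * psi b) * T (k + s)"
  proof (cases "k + s = 0")
    case True
    then have "om k s = 0" by (simp add: add_eq_0_iff)
    then show ?thesis by simp
  next
    case False
    then show ?thesis using kap_nonzero by (simp add: tt_T V.sc_mult_assoc field_simps)
  qed
  finally show ?thesis .
qed simp

lemma br_dd_T: "br (dd u b) (T s) = sc (dotc u (cvec s) * psi b) * T s"
proof (cases "s = 0")
  case False
  have "br (dd u b) (T s) = sc (1 / kap) * (sc (dotc u (cvec s)) * tt s b)"
    using False V.linD[OF lin_dd, of u b "1 / kap"] unfolding T_def
    by (simp only: if_False br_mult br_dd_tt) simp
  then show ?thesis using kap_nonzero False by (simp add: tt_T V.sc_mult_assoc field_simps)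
qed simp

section \<open>Translation between weight spaces\<close>

lemma wsp_coset_span:
  assumes "v \<in> wsp L" "v \<noteq> 0"
  shows "V.span (\<Union>r. wsp (L + cvec r)) = UNIV"
proof (rule irreducible_gens[OF V.subspace_span])
  have "v \<in> wsp (L + cvec 0)" using assms by simp
  then show "v \<in> V.span (\<Union>r. wsp (L + cvec r))" by (intro V.span_base) blast
  fix X w assume X: "X \<in> gens" and w: "w \<in> V.span (\<Union>r. wsp (L + cvec r))"
  obtain k where k: "shift k X" using shift_gens[OF X] by blast
  show "X \<cdot> w \<in> V.span (\<Union>r. wsp (L + cvec r))"
    using w
  proof (induction rule: V.span_induct_alt)
    case (step c x y)
    then obtain r where "x \<in> wsp (L + cvec r)" by blast
    then have "X \<cdot> x \<in> wsp (L + cvec (r + k))"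
      using shift_wsp[OF k] by (metis add.assoc cvec_simps(1))
    then have "X \<cdot> x \<in> V.span (\<Union>r. wsp (L + cvec r))" by (intro V.span_base) blast
    then show ?case using step.IH
      by (simp add: V.lin_scale[OF lin_gens[OF X]] V.span_add V.span_scale)
  qed (simp add: V.span_zero)
qed (rule assms)

lemma T_wsp: "v \<in> wsp L \<Longrightarrow> T r \<cdot> v \<in> wsp (L + cvec r)"
  using shift_wsp[OF shift_T] .

text \<open>
  The \<open>T r\<close> identify the weight space of \<open>L\<close> with that of \<open>L + r\<close>, and these span \<open>V\<close>.
\<close>

lemma determined_by_one_weight_space:
  assumes L: "v \<in> wsp L" "v \<noteq> 0" and f: "lin f" "\<And>r. f * T r = T r * f" "\<And>w. w \<in> wsp L \<Longrightarrow> f \<cdot> w = 0"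
  shows "f = 0"
proof (rule endo_eqI)
  fix w
  have "w \<in> V.span (\<Union>r. wsp (L + cvec r))" by (simp add: wsp_coset_span[OF L])
  then have "f \<cdot> w = 0"
  proof (induction rule: V.span_induct_alt)
    case (step c x y)
    then obtain r where "x \<in> wsp (L + cvec r)" by blast
    then have "T (- r) \<cdot> x \<in> wsp L" using T_wsp[of x "L + cvec r" "- r"] by simp
    then have "f \<cdot> T (- r) \<cdot> x = 0" by (rule f(3))
    moreover have "f \<cdot> T r \<cdot> T (- r) \<cdot> x = T r \<cdot> f \<cdot> T (- r) \<cdot> x"
      using f(2)[of r] by (metis app_simps(6))
    ultimately have "f \<cdot> x = 0" by simp
    then show ?case using step.IH by (simp add: V.lin_scale[OF f(1)])
  qed simp
  then show "f \<cdot> w = 0 \<cdot> w" by simp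
qed

end

section \<open>The kernel of the character acts by scalars\<close>

lemma om_smult: "om (\<chi> i. c * k $ i) s = c * om k s" and om_smult_right: "om r (\<chi> i. c * k $ i) = c * om r k"
proof -
  have "bar (\<chi> i. c * k $ i) = (\<chi> i. c * bar k $ i)"
    by (auto simp: bar_def vec_eq_iff split: sum.split)
  then show "om (\<chi> i. c * k $ i) s = c * om k s"
    by (simp add: om_def sum_distrib_left mult.assoc)
  show "om r (\<chi> i. c * k $ i) = c * om r k"
    by (simp add: om_def sum_distrib_left algebra_simps)
qed

primrec iter_br :: "(nat \<Rightarrow> 'v::ab_group_add endo) \<Rightarrow> nat \<Rightarrow> 'v endo \<Rightarrow> 'v endo" where
  "iter_br e 0 f = f"
| "iter_br e (Suc j) f = br (e j) (iter_br e j f)"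

lemma iter_br_add: "iter_br e j (f + g) = iter_br e j f + iter_br e j g"
  by (induction j) (simp_all add: algebra_simps)

lemma iter_br_zero: "iter_br e j 0 = 0"
  by (induction j) simp_all

lemma (in complex_space) iter_br_scale:
  assumes "\<And>j. lin (e j)"
  shows "iter_br e j (sc c * f) = sc c * iter_br e j f"
  by (induction j) (simp_all add: lin_sc_left[OF assms] right_diff_distrib mult.assoc)

lemma (in complex_space) vector_space_endo: "vector_space (\<lambda>c f. sc c * f)"
  by unfold_locales (simp_all add: sc_add sc_mult_assoc distrib_left distrib_right)

context loop_rep
begin

lemma br_left_sum: "br (\<Sum>j\<in>A. f j) g = (\<Sum>j\<in>A. br (f j) g)"
  by (simp add: sum_distrib_left sum_distrib_right sum_subtractf)

lemma exists_finite_basis_wsp: "\<exists>F. finite F \<and> F \<subseteq> wsp L \<and> wsp L \<subseteq> V.span F"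
proof -
  obtain F where F: "F \<subseteq> wsp L" "V.independent F" "wsp L \<subseteq> V.span F"
    by (rule V.basis_exists)
  obtain D where D: "finite D" "wsp L \<subseteq> V.span D" using wsp_bound by blast
  have "finite F" using V.independent_span_bound[OF D(1) F(2)] F(1) D(2) by blast
  then show ?thesis using F by blast
qed

lemma vanish_on_span: "lin f \<Longrightarrow> \<forall>v\<in>F. f \<cdot> v = 0 \<Longrightarrow> w \<in> V.span F \<Longrightarrow> f \<cdot> w = 0"
proof -
  assume f: "lin f" "\<forall>v\<in>F. f \<cdot> v = 0" and "w \<in> V.span F"
  from this(3) show "f \<cdot> w = 0"
    by (induction rule: V.span_induct_alt) (use f in \<open>auto simp: V.lin_scale[OF f(1)]\<close>)
qed

end

context loop_rep_nontrivial
begin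

lemma hh_T_commute: "psi b = 0 \<Longrightarrow> hh r b * T s = T s * hh r b"
  using br_hh_T[of r b s] by simp

lemma dd_T_commute: "psi b = 0 \<Longrightarrow> dd u b * T s = T s * dd u b"
  using br_dd_T[of u b s] by simp

lemma T_left_commute: "T s * (T r * f) = T r * (T s * f)"
  by (rule At_left_comm[OF T_At T_At])

text \<open>
  Operators of degree \<open>0\<close> that commute with all \<open>T r\<close> are determined by their restriction to one weight
  space, so they form a finite-dimensional space.
\<close>

lemma finite_span_of_degree_zero_family:
  assumes Y: "\<And>k. shift 0 (Y k)" "\<And>k r. Y k * T r = T r * Y k"
  shows "\<exists>D. finite D \<and> D \<subseteq> range Y \<and> range Y \<subseteq> module.span (\<lambda>c f. sc c * f) D"
proof -
  interpret E: vector_space "\<lambda>c f. sc c * f" by (rule V.vector_space_endo)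
  obtain D where D: "D \<subseteq> range Y" "E.independent D" "range Y \<subseteq> E.span D"
    by (rule E.basis_exists)
  obtain L v where v: "v \<in> wsp L" "v \<noteq> 0" using exists_weight by blast
  obtain F where F: "finite F" "F \<subseteq> wsp L" "wsp L \<subseteq> V.span F"
    using exists_finite_basis_wsp by blast
  have "finite D"
  proof (rule ccontr)
    assume "infinite D"
    then obtain y :: "nat \<Rightarrow> 'v endo" where y: "inj y" "range y \<subseteq> D"
      unfolding infinite_iff_countable_subset by blast
    have yY: "shift 0 (y j)" "y j * T r = T r * y j" for j r
    proof -
      have "y j \<in> range Y" using y(2) D(1) by blast
      then show "shift 0 (y j)" "y j * T r = T r * y j" using Y by auto
    qed
    have "y j \<cdot> w \<in> V.span F" if "w \<in> F" for j w
      using shift0_wsp[OF yY(1)] F(2,3) that by blast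
    from V.common_dependence[OF F(1) F(1), of "\<lambda>j w. y j \<cdot> w", OF this]
    obtain p n where p: "\<exists>j<n. p j \<noteq> 0" "\<forall>w\<in>F. (\<Sum>j<n. scale (p j) (y j \<cdot> w)) = 0" by auto
    define f where "f = (\<Sum>j<n. sc (p j) * y j)"
    have lin: "lin f"
      unfolding f_def by (rule V.linI) (simp add: sum_app V.lin_scale[OF shift_lin[OF yY(1)]]
          V.scale_sum_right mult.commute)
    have "f = 0"
    proof (rule determined_by_one_weight_space[OF v lin])
      show "f * T r = T r * f" for r
        by (simp add: f_def sum_distrib_left sum_distrib_right mult.assoc yY(2) V.lin_sc_left[OF lin_T])
      show "f \<cdot> w = 0" if "w \<in> wsp L" for w
        by (rule vanish_on_span[OF lin, of F]) (use p(2) that F(3) in \<open>auto simp: f_def sum_app\<close>)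
    qed
    moreover have "(\<Sum>g\<in>y ` {..<n}. sc (p (inv y g)) * g) = f"
      unfolding f_def using y(1) by (subst sum.reindex) (auto simp: inj_on_def)
    ultimately have zero: "(\<Sum>g\<in>y ` {..<n}. sc (p (inv y g)) * g) = 0" by simp
    have "p (inv y (y j)) = 0" if "j < n" for j
      by (rule E.independentD[OF D(2) _ _ zero]) (use that y(2) in auto)
    then show False using p(1) y(1) by auto
  qed
  then show ?thesis using D by blast
qed

text \<open>
  Put \<open>u = bar w\<close> and \<open>\<beta>\<^sub>j = b\<^sub>0 m\<^sub>0 \<dots> m\<^sub>j\<^sub>-\<^sub>1\<close>. The iterated bracket with \<open>D(u,0) m\<^sub>0, \<dots>, D(u,0) m\<^sub>j\<^sub>-\<^sub>1\<close>
  maps \<open>T\<^sup>-\<^sup>k h\<^sub>k b\<^sub>0\<close> to \<open>om w k ^ j\<close> times \<open>T\<^sup>-\<^sup>k h\<^sub>k \<beta>\<^sub>j\<close>. As linear maps of a finite-dimensional space of operators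
  the iterated brackets are dependent, with coefficients \<open>p\<^sub>j\<close> that do not depend on \<open>k\<close>. So
  \<open>\<Sum>\<^sub>j p\<^sub>j (om w k)\<^sup>j h\<^sub>k \<beta>\<^sub>j = 0\<close>, and a bracket with \<open>h\<^sub>S\<^sub>-\<^sub>k\<close> turns \<open>h\<^sub>k\<close> into \<open>h\<^sub>S\<close> for a fixed \<open>S\<close>, while \<open>k\<close>
  still runs over all multiples of a generic vector. Thus each coefficient \<open>p\<^sub>j h\<^sub>S \<beta>\<^sub>j\<close> vanishes.
\<close>

lemma kernel_products_annihilate:
  fixes m :: "nat \<Rightarrow> 'b"
  assumes b0: "psi b0 = 0" and m: "\<And>i. psi (m i) = 0"
  shows "\<exists>j. \<forall>S. hh S (b0 * (\<Prod>i<j. m i)) = 0"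
proof -
  obtain L v where v: "v \<in> wsp L" "v \<noteq> 0" using exists_weight by blast
  obtain F where F: "finite F" "F \<subseteq> wsp L" "wsp L \<subseteq> V.span F"
    using exists_finite_basis_wsp by blast
  obtain w :: "'m ivec" where w: "w \<noteq> 0" using nontriv by blast
  define \<beta> where "\<beta> j = b0 * (\<Prod>i<j. m i)" for j
  have psi_\<beta>: "psi (\<beta> j) = 0" for j by (simp add: \<beta>_def psi_mult b0)
  define e where "e i = dd (cvec (bar w)) (m i)" for i
  have lin_e: "lin (e i)" and shift_e: "shift 0 (e i)" and eT: "e i * T r = T r * e i" for i r
    by (simp_all add: e_def lin_dd shift_dd dd_T_commute m)
  define Y where "Y k = T (- k) * hh k b0" for k
  have shift_TY: "shift 0 (T (- k) * hh k b)" for k b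
    using shift_mult[OF shift_T shift_hh, of "- k" k b] by simp
  have TY: "(T (- k) * hh k b) * T r = T r * (T (- k) * hh k b)" if "psi b = 0" for k b r
    using hh_T_commute[OF that] by (simp add: mult.assoc T_left_commute)
  have iter: "iter_br e j (Y k) = sc (of_int (om w k) ^ j) * (T (- k) * hh k (\<beta> j))" for j k
  proof (induction j)
    case 0
    then show ?case by (simp add: Y_def \<beta>_def)
  next
    case (Suc j)
    have "br (e j) (hh k (\<beta> j)) = sc (of_int (om w k)) * hh k (\<beta> (Suc j))"
      by (simp add: e_def br_dd_hh dotc_bar \<beta>_def mult.commute mult.left_commute)
    moreover have "br (e j) (T (- k)) = 0" by (simp add: eT)
    ultimately have "br (e j) (T (- k) * hh k (\<beta> j)) = sc (of_int (om w k)) * (T (- k) * hh k (\<beta> (Suc j)))"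
      unfolding br_mult by (simp add: V.lin_sc_left[OF lin_T])
    moreover have "iter_br e (Suc j) (Y k) = sc (of_int (om w k) ^ j) * br (e j) (T (- k) * hh k (\<beta> j))"
      by (simp add: Suc V.lin_sc_left[OF lin_e] right_diff_distrib mult.assoc)
    ultimately show ?case by (simp add: V.sc_mult_assoc mult.commute)
  qed
  interpret E: vector_space "\<lambda>c f. sc c * f" by (rule V.vector_space_endo)
  obtain D where D: "finite D" "D \<subseteq> range Y" "range Y \<subseteq> E.span D"
    using finite_span_of_degree_zero_family[of Y] shift_TY TY[OF b0] unfolding Y_def by blast
  have "iter_br e j f \<cdot> x \<in> V.span F" if fx: "f \<in> D" "x \<in> F" for j f x
  proof -
    obtain k where "f = Y k" using fx(1) D(2) by blast
    then have "shift 0 (iter_br e j f)" by (simp add: iter shift_sc shift_TY)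
    then show ?thesis using shift0_wsp fx(2) F(2,3) by blast
  qed
  then have "\<exists>p n. (\<exists>j<n. p j \<noteq> 0) \<and> (\<forall>z\<in>D \<times> F. (\<Sum>j<n. scale (p j) (iter_br e j (fst z) \<cdot> snd z)) = 0)"
    using D(1) F(1) by (intro V.common_dependence[of _ F]) auto
  then obtain p n where p: "\<exists>j<n. p j \<noteq> 0"
    "\<And>f x. f \<in> D \<Longrightarrow> x \<in> F \<Longrightarrow> (\<Sum>j<n. scale (p j) (iter_br e j f \<cdot> x)) = 0" by fastforce
  \<comment> \<open>the dependence found on the finite set \<open>D\<close> holds on its span, hence for all \<open>Y k\<close>\<close>
  have dep: "(\<Sum>j<n. scale (p j) (iter_br e j f \<cdot> x)) = 0" if "f \<in> E.span D" "x \<in> F" for f x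
    using that(1)
  proof (induction rule: E.span_induct_alt)
    case (step c f g)
    have "(\<Sum>j<n. scale (p j) (iter_br e j (sc c * f + g) \<cdot> x)) =
        scale c (\<Sum>j<n. scale (p j) (iter_br e j f \<cdot> x)) + (\<Sum>j<n. scale (p j) (iter_br e j g \<cdot> x))"
      by (simp add: iter_br_add V.iter_br_scale[OF lin_e] V.scale_right_distrib sum.distrib
          V.scale_sum_right mult.commute)
    then show ?case using step p(2) that(2) by auto
  qed (simp add: iter_br_zero)
  have rel: "(\<Sum>j<n. sc (p j * of_int (om w k) ^ j) * hh k (\<beta> j)) = 0" for k
  proof -
    define f where "f = (\<Sum>j<n. sc (p j * of_int (om w k) ^ j) * (T (- k) * hh k (\<beta> j)))"
    have l: "lin (T (- k) * hh k (\<beta> j))" for j using shift_TY shift_lin by blast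
    have lin: "lin f"
      unfolding f_def by (rule V.linI) (simp add: sum_app V.lin_scale[OF l, simplified]
          V.scale_sum_right mult.commute)
    have "f = 0"
    proof (rule determined_by_one_weight_space[OF v lin])
      show "f * T r = T r * f" for r
        by (simp add: f_def sum_distrib_left sum_distrib_right mult.assoc V.lin_sc_left[OF lin_T]
            TY[OF psi_\<beta>, unfolded mult.assoc])
      have "f \<cdot> x = 0" if "x \<in> F" for x
        using dep[of "Y k" x] D(3) that by (simp add: f_def sum_app iter image_subset_iff)
      then show "f \<cdot> x = 0" if "x \<in> wsp L" for x
        using vanish_on_span[OF lin, of F x] that F(3) by blast
    qed
    then have "T k * f = 0" by simp
    moreover have "T k * f = (\<Sum>j<n. sc (p j * of_int (om w k) ^ j) * hh k (\<beta> j))"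
      unfolding f_def sum_distrib_left
      by (intro sum.cong refl) (simp add: V.lin_sc_left[OF lin_T] mult.assoc[symmetric, of "T k"])
    ultimately show ?thesis by simp
  qed
  have rel': "(\<Sum>j<n. sc (p j * of_int (om w k) ^ j) * hh S (\<beta> j)) = 0" if "om k S \<noteq> 0" for k S
  proof -
    have "0 = br (\<Sum>j<n. sc (p j * of_int (om w k) ^ j) * hh k (\<beta> j)) (hh (S - k) 1)"
      using rel by simp
    also have "\<dots> = (\<Sum>j<n. sc (p j * of_int (om w k) ^ j) * br (hh k (\<beta> j)) (hh (S - k) 1))"
      unfolding br_left_sum
      by (intro sum.cong refl) (simp add: V.lin_sc_left[OF lin_hh] right_diff_distrib mult.assoc)
    also have "\<dots> = sc (of_int (om k S)) * (\<Sum>j<n. sc (p j * of_int (om w k) ^ j) * hh S (\<beta> j))"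
      unfolding sum_distrib_left by (intro sum.cong refl) (simp add: br_hh_hh V.sc_mult_assoc mult.commute)
    finally show ?thesis using that by (simp add: V.sc_eq_0_iff)
  qed
  obtain j where j: "j < n" "p j \<noteq> 0" using p(1) by blast
  have "hh S (\<beta> j) = 0" for S
  proof (cases "S = 0")
    case True
    then show ?thesis by (simp add: hh_0)
  next
    case False
    obtain k where k: "om k S \<noteq> 0" "om k w \<noteq> 0" using om_generic[of "{S, w}"] w False by auto
    define \<tau> where "\<tau> = (of_int (om w k) :: complex)"
    have "\<tau> \<noteq> 0" using k(2) om_skew[of w k] by (simp add: \<tau>_def)
    \<comment> \<open>on the multiples \<open>c k\<close> the relation is a polynomial identity in \<open>c\<close>\<close>
    have "scale (p j * \<tau> ^ j) (hh S (\<beta> j) \<cdot> x) = 0" for x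
    proof (rule polynomial_coeffs_zero[OF V.vector_space_axioms _ j(1)])
      fix c :: nat assume c: "c \<ge> 1"
      have "(\<Sum>j<n. sc (p j * of_int (om w (\<chi> i. int c * k $ i)) ^ j) * hh S (\<beta> j)) = 0"
        by (rule rel') (use c k(1) in \<open>simp add: om_smult\<close>)
      then have "(\<Sum>j<n. sc (p j * of_int (om w (\<chi> i. int c * k $ i)) ^ j) * hh S (\<beta> j)) \<cdot> x = 0 \<cdot> x"
        by simp
      then show "(\<Sum>j<n. scale (of_nat c ^ j) (scale (p j * \<tau> ^ j) (hh S (\<beta> j) \<cdot> x))) = 0"
        by (simp add: sum_app om_smult_right \<tau>_def power_mult_distrib mult_ac)
    qed
    then show ?thesis using j(2) \<open>\<tau> \<noteq> 0\<close> by (intro endo_eqI) auto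
  qed
  then show ?thesis by (auto simp: \<beta>_def)
qed

lemma tt_psi_zero: "psi b = 0 \<Longrightarrow> r \<noteq> 0 \<Longrightarrow> tt r b = 0"
  using tt_psi[of r b] by simp

lemma br_hh_tt_zero: "psi (b * b') = 0 \<Longrightarrow> br (hh r b) (tt s b') = 0"
proof (cases "r + s = 0")
  case True
  then have "om r s = 0" by (simp add: add_eq_0_iff)
  then show ?thesis unfolding br_hh_tt by simp
qed (simp add: br_hh_tt tt_psi_zero)

lemma br_dd_tt_zero: "psi (b * b') = 0 \<Longrightarrow> br (dd u b) (tt s b') = 0"
  by (cases "s = 0") (simp_all add: br_dd_tt tt_psi_zero)

lemma psi_minus_scalar: "psi (b - sclB (psi b) 1) = 0"
  using psi_add[of "b - sclB (psi b) 1" "sclB (psi b) 1"] by (simp add: psi_scale psi_one)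

text \<open>
  The hypotheses make the operators \<open>t\<^sup>r b\<close>, \<open>h\<^sub>r b\<^sub>0\<close>, \<open>D(u,0) b\<^sub>0\<close> commute with one another, and since
  \<open>b b\<^sub>0\<close> acts in \<open>h\<^sub>r\<close> like \<open>\<psi>(b) b\<^sub>0\<close>, the algebra that they generate is stable under brackets. So \<open>D(u,0) b\<^sub>0\<close> is a scalar,
  and its brackets with the \<open>h\<^sub>r\<close>, which are multiples of \<open>h\<^sub>r b\<^sub>0\<close>, are zero.
\<close>

lemma scalar_if_kernel_annihilates:
  assumes b0: "psi b0 = 0" and ann: "\<And>m r. psi m = 0 \<Longrightarrow> hh r (b0 * m) = 0"
  shows "\<exists>c. dd u b0 = sc c" and "hh r b0 = 0"
proof -
  define S where "S = {tt r b | r b. True} \<union> {hh r b0 | r. True} \<union> {dd u b0 | u. True}"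
  have tS: "tt r b \<in> S" and hS: "hh r b0 \<in> S" and dS: "dd u b0 \<in> S" for r b u
    unfolding S_def by blast+
  have zero: "hh r (b0 * b0) = 0" for r using ann[OF b0] .
  have hb: "hh r (b * b0) = sc (psi b) * hh r b0" for r b
  proof -
    have "b * b0 = sclB (psi b) b0 + b0 * (b - sclB (psi b) 1)"
      using B.scale_mult_right[of "psi b" b0 1] by (simp add: algebra_simps)
    then show ?thesis by (simp add: hh_add hh_scale ann psi_minus_scalar)
  qed
  have comm: "X * Y = Y * X" if XY: "X \<in> S" "Y \<in> S" for X Y
  proof -
    have p0: "psi (b0 * b) = 0" for b by (simp add: psi_mult b0)
    have th: "hh r b0 * tt s b = tt s b * hh r b0" and td: "dd u b0 * tt s b = tt s b * dd u b0"
      and hd: "dd u b0 * hh r b0 = hh r b0 * dd u b0" and dd: "dd u b0 * dd u' b0 = dd u' b0 * dd u b0"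
      and h: "hh r b0 * hh s b0 = hh s b0 * hh r b0" and t: "tt r b * tt s b' = tt s b' * tt r b"
      for r s u u' b b'
      using br_hh_tt_zero[OF p0, of r s b] br_dd_tt_zero[OF p0, of u s b] br_dd_hh[of u b0 r b0]
        br_dd_dd[of u b0 u' b0] br_hh_hh[of r b0 s b0] br_tt_tt[of r b s b']
      by (simp_all add: zero)
    have "(\<exists>r b. X = tt r b) \<or> (\<exists>r. X = hh r b0) \<or> (\<exists>u. X = dd u b0)"
      "(\<exists>r b. Y = tt r b) \<or> (\<exists>r. Y = hh r b0) \<or> (\<exists>u. Y = dd u b0)"
      using XY unfolding S_def by blast+
    then show ?thesis by (elim disjE exE; hypsubst) (simp_all only: th td hd dd h t)
  qed
  have stable: "stable_algebra (alg S)"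
  proof (rule stable_algebra_alg)
    show "lin X" if "X \<in> S" for X using that by (auto simp: S_def lin_tt lin_hh lin_dd)
    fix X Y assume X: "X \<in> gens" and Y: "Y \<in> S"
    have sct: "sc c * Z \<in> alg S" if "Z \<in> S" for c Z using that by (intro alg_scale alg_base)
    consider r b where "X = tt r b" | r b where "X = hh r b" | u b where "X = dd u b"
      using X unfolding gens_def by blast
    then show "br X Y \<in> alg S"
    proof cases
      case 1
      then have "br X Y = 0" using comm[OF tS Y] by simp
      then show ?thesis by (simp only: alg_zero)
    next
      case 2
      consider s b' where "Y = tt s b'" | s where "Y = hh s b0" | u where "Y = dd u b0"
        using Y unfolding S_def by blast
      then show ?thesis
      proof cases
        case 3
        have "br X Y = - br (dd u b0) (hh r b)" by (simp add: 2 3)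
        also have "\<dots> = sc (- (dotc u (cvec r) * psi b)) * hh r b0"
          unfolding br_dd_hh by (simp add: hb mult.commute[of b0] V.sc_mult V.sc_minus mult.assoc)
        finally show ?thesis using sct[OF hS] by simp
      qed (unfold 2, (simp only: br_hh_tt sct tS), (simp only: br_hh_hh hb V.sc_mult_assoc sct hS))
    next
      case 3
      consider s b' where "Y = tt s b'" | s where "Y = hh s b0" | u where "Y = dd u b0"
        using Y unfolding S_def by blast
      then show ?thesis
        by cases (unfold 3, (simp only: br_dd_tt sct tS), (simp only: br_dd_hh hb V.sc_mult_assoc sct hS),
            (simp only: br_dd_dd alg_zero))
    qed
  qed (rule comm)
  have "\<exists>T\<in>alg S. shift k T \<and> inj (app T)" for k
  proof (cases "k = 0")
    case True
    then show ?thesis using alg_one shift_one by (auto simp: inj_app_iff)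
  next
    case False
    then show ?thesis using alg_base[OF tS] shift_tt inj_tt by blast
  qed
  then have scalar: "\<exists>c. dd u b0 = sc c" for u
    by (rule degree_zero_scalar[OF stable _ alg_base[OF dS] shift_dd])
  then show "\<exists>c. dd u b0 = sc c" .
  show "hh r b0 = 0"
  proof (cases "r = 0")
    case True
    then show ?thesis by (simp add: hh_0)
  next
    case False
    then obtain k where k: "om k r \<noteq> 0" using om_nondegenerate by blast
    obtain c where "dd (cvec (bar k)) b0 = sc c" using scalar by blast
    then have "br (dd (cvec (bar k)) b0) (hh r 1) = 0" using V.linD[OF lin_hh] by simp
    then show ?thesis using k by (simp add: br_dd_hh dotc_bar V.sc_eq_0_iff)
  qed
qed

text \<open>
  By \<open>kernel_products_annihilate\<close>, an element of the kernel with some \<open>h\<^sub>r b \<noteq> 0\<close> cannot be multiplied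
  by elements of the kernel forever without losing this property. The last element that has it would
  contradict \<open>scalar_if_kernel_annihilates\<close>.
\<close>

lemma kernel_acts_by_scalars:
  assumes "psi b = 0"
  shows "hh r b = 0" and "\<exists>c. dd u b = sc c"
proof -
  define bad where "bad b \<longleftrightarrow> psi b = 0 \<and> (\<exists>r. hh r b \<noteq> 0)" for b
  have none: "\<not> bad b" for b
  proof
    assume b: "bad b"
    have "\<exists>b. bad b \<and> (\<forall>m. psi m = 0 \<longrightarrow> \<not> bad (b * m))"
    proof (rule ccontr)
      assume "\<not> ?thesis"
      then obtain \<mu> where \<mu>: "\<And>b. bad b \<Longrightarrow> psi (\<mu> b) = 0 \<and> bad (b * \<mu> b)" by metis
      define \<beta> where "\<beta> = rec_nat b (\<lambda>_ c. c * \<mu> c)"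
      have \<beta>: "\<beta> 0 = b" "\<beta> (Suc j) = \<beta> j * \<mu> (\<beta> j)" for j by (simp_all add: \<beta>_def)
      have bad: "bad (\<beta> j)" for j by (induction j) (use b \<mu> in \<open>auto simp: \<beta>\<close>)
      have prod: "\<beta> j = b * (\<Prod>i<j. \<mu> (\<beta> i))" for j
        by (induction j) (simp_all add: \<beta> mult.assoc)
      have "\<exists>j. \<forall>S. hh S (b * (\<Prod>i<j. \<mu> (\<beta> i))) = 0"
        by (rule kernel_products_annihilate) (use b bad \<mu> in \<open>auto simp: bad_def\<close>)
      then show False using bad unfolding bad_def prod[symmetric] by blast
    qed
    then obtain b where b: "bad b" "\<And>m. psi m = 0 \<Longrightarrow> \<not> bad (b * m)" by blast
    have "hh r (b * m) = 0" if "psi m = 0" for m r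
      using b(2)[OF that] that by (simp add: bad_def psi_mult)
    then have "hh r b = 0" for r using b(1) scalar_if_kernel_annihilates(2) by (simp add: bad_def)
    then show False using b(1) by (simp add: bad_def)
  qed
  show "hh r b = 0" using none[of b] assms by (auto simp: bad_def)
  have "hh r (b * m) = 0" if "psi m = 0" for m r
    using none[of "b * m"] that by (simp add: bad_def psi_mult)
  then show "\<exists>c. dd u b = sc c" by (rule scalar_if_kernel_annihilates(1)[OF assms])
qed

lemma hh_psi: "hh r b = sc (psi b) * hh r 1"
proof -
  have "hh r b = hh r (b - sclB (psi b) 1) + hh r (sclB (psi b) 1)" by (simp flip: hh_add)
  then show ?thesis using kernel_acts_by_scalars(1)[OF psi_minus_scalar] by (simp add: hh_scale)
qed

lemma dd_psi: "\<exists>c. \<forall>u b. dd u b = sc (c u b) + sc (psi b) * dd u 1"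
proof -
  have "\<exists>c. dd u b = sc c + sc (psi b) * dd u 1" for u b
  proof -
    have "dd u b = dd u (b - sclB (psi b) 1) + dd u (sclB (psi b) 1)" by (simp flip: dd_add)
    then show ?thesis
      using kernel_acts_by_scalars(2)[OF psi_minus_scalar] by (metis dd_scale)
  qed
  then show ?thesis by metis
qed

end

section \<open>The weight decomposition\<close>

lemma (in vector_space) direct_sumI:
  fixes W :: "'i \<Rightarrow> 'b set"
  assumes sub: "\<And>i. subspace (W i)" and spn: "span (\<Union>i. W i) = UNIV"
    and ind: "\<And>A f. finite A \<Longrightarrow> (\<And>i. i \<in> A \<Longrightarrow> f i \<in> W i) \<Longrightarrow> (\<Sum>i\<in>A. f i) = 0 \<Longrightarrow> \<forall>i\<in>A. f i = 0"
  shows "\<exists>!f. (\<forall>i. f i \<in> W i) \<and> finite {i. f i \<noteq> 0} \<and> v = (\<Sum>i | f i \<noteq> 0. f i)"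
proof -
  define ok where "ok v f A \<longleftrightarrow> finite A \<and> (\<forall>i. f i \<in> W i) \<and> (\<forall>i. i \<notin> A \<longrightarrow> f i = 0) \<and> v = (\<Sum>i\<in>A. f i)"
    for v f and A :: "'i set"
  have extend: "ok v f B" if "ok v f A" "A \<subseteq> B" "finite B" for v f A B
  proof -
    have "(\<Sum>i\<in>A. f i) = (\<Sum>i\<in>B. f i)"
      by (rule sum.mono_neutral_left) (use that in \<open>auto simp: ok_def\<close>)
    then show ?thesis using that by (auto simp: ok_def)
  qed
  have "v \<in> span (\<Union>i. W i)" by (simp add: spn)
  then have "\<exists>f A. ok v f A"
  proof (induction rule: span_induct_alt)
    case base
    then show ?case by (intro exI[of _ "\<lambda>_. 0"] exI[of _ "{}"]) (simp add: ok_def subspace_0[OF sub])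
  next
    case (step c x y)
    then obtain i f A where i: "x \<in> W i" and f: "ok y f A" by blast
    have "ok y f (insert i A)" by (rule extend[OF f]) (use f in \<open>auto simp: ok_def\<close>)
    define g where "g = (\<lambda>j. if j = i then scale c x + f i else f j)"
    have "(\<Sum>j\<in>insert i A. g j) = (\<Sum>j\<in>insert i A. (if j = i then scale c x else 0) + f j)"
      by (rule sum.cong) (auto simp: g_def)
    also have "\<dots> = scale c x + y"
      using \<open>ok y f (insert i A)\<close> by (simp add: sum.distrib ok_def)
    finally have "ok (scale c x + y) g (insert i A)"
      using \<open>ok y f (insert i A)\<close> i by (auto simp: ok_def g_def intro: subspace_add[OF sub] subspace_scale[OF sub])
    then show ?case by blast
  qed
  then obtain f A where f: "ok v f A" by blast
  have supp: "ok v f {i. f i \<noteq> 0}" if "ok v f A" for f A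
  proof -
    have "(\<Sum>i | f i \<noteq> 0. f i) = (\<Sum>i\<in>A. f i)"
      by (rule sum.mono_neutral_left) (use that in \<open>auto simp: ok_def\<close>)
    moreover have "{i. f i \<noteq> 0} \<subseteq> A" using that by (auto simp: ok_def)
    ultimately show ?thesis using that finite_subset by (auto simp: ok_def)
  qed
  show ?thesis
  proof (rule ex1I[of _ f])
    show "(\<forall>i. f i \<in> W i) \<and> finite {i. f i \<noteq> 0} \<and> v = (\<Sum>i | f i \<noteq> 0. f i)"
      using supp[OF f] by (simp add: ok_def)
    fix g assume "(\<forall>i. g i \<in> W i) \<and> finite {i. g i \<noteq> 0} \<and> v = (\<Sum>i | g i \<noteq> 0. g i)"
    then have g: "ok v g {i. g i \<noteq> 0}" by (auto simp: ok_def)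
    define C where "C = A \<union> {i. g i \<noteq> 0}"
    have "finite C" using f g by (auto simp: C_def ok_def)
    then have C: "ok v f C" "ok v g C" by (auto intro: extend[OF f] extend[OF g] simp: C_def)
    then have "(\<Sum>i\<in>C. f i - g i) = 0" by (simp add: ok_def sum_subtractf)
    then have "\<forall>i\<in>C. f i - g i = 0"
      by (intro ind) (use C \<open>finite C\<close> in \<open>auto simp: ok_def intro: subspace_diff[OF sub]\<close>)
    then have "g i = f i" for i using C by (cases "i \<in> C") (auto simp: ok_def)
    then show "g = f" by blast
  qed
qed

lemma cvec_inj: "cvec r = cvec s \<longleftrightarrow> r = s"
  by (auto simp: cvec_def vec_eq_iff)

lemma dotc_axis: "dotc (axis i 1) L = L $ i"
proof -
  have "dotc (axis i 1) L = (\<Sum>j\<in>UNIV. if j = i then L $ j else 0)"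
    unfolding dotc_def by (rule sum.cong) (auto simp: axis_def)
  then show ?thesis by simp
qed

context loop_rep
begin

text \<open>
  The operator \<open>D(u,0) - (u,K)\<close> removes the vector of weight \<open>K\<close> and multiplies the one of weight \<open>L\<close> by
  \<open>(u,L-K)\<close>, which is nonzero for a suitable unit vector \<open>u\<close>.
\<close>

lemma weight_vectors_independent:
  assumes "finite A" "\<And>L. L \<in> A \<Longrightarrow> f L \<in> wsp L" "(\<Sum>L\<in>A. f L) = 0"
  shows "\<forall>L\<in>A. f L = 0"
  using assms
proof (induction A arbitrary: f rule: finite_induct)
  case (insert K A)
  have A: "f L = 0" if L: "L \<in> A" for L
  proof -
    have "L \<noteq> K" using L insert.hyps by auto
    then obtain i where i: "L $ i \<noteq> K $ i" by (auto simp: vec_eq_iff)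
    let ?u = "axis i 1"
    have w: "dd ?u 1 \<cdot> f J = scale (J $ i) (f J)" if "J \<in> insert K A" for J
      using insert.prems(1)[OF that] by (simp add: wsp_def dotc_axis)
    have "0 = (dd ?u 1 - sc (K $ i)) \<cdot> (\<Sum>L\<in>insert K A. f L)" unfolding insert.prems(2) by simp
    also have "\<dots> = (\<Sum>L\<in>insert K A. scale (L $ i - K $ i) (f L))"
      unfolding app_sum by (rule sum.cong) (simp_all add: w V.scale_left_diff_distrib)
    also have "\<dots> = (\<Sum>L\<in>A. scale (L $ i - K $ i) (f L))"
      using insert.hyps by simp
    finally have zero: "(\<Sum>L\<in>A. scale (L $ i - K $ i) (f L)) = 0" by simp
    have "\<forall>L\<in>A. scale (L $ i - K $ i) (f L) = 0"
      by (rule insert.IH[OF _ zero]) (use insert.prems(1) in \<open>auto intro: V.subspace_scale[OF subspace_wsp]\<close>)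
    then show ?thesis using L i by auto
  qed
  then show ?case using insert.prems(2) insert.hyps by auto
qed simp

end

context loop_rep_nontrivial
begin

lemma coset_direct_sum:
  assumes "v \<in> wsp L" "v \<noteq> 0"
  shows "is_direct_sum scale UNIV (\<lambda>r. wsp (L + cvec r))"
proof -
  have ind: "\<forall>i\<in>A. f i = 0" if A: "finite A" "\<And>i. i \<in> A \<Longrightarrow> f i \<in> wsp (L + cvec i)" "(\<Sum>i\<in>A. f i) = 0"
    for f :: "'m ivec \<Rightarrow> 'v" and A
  proof -
    define J where "J = (\<lambda>i. L + cvec i)"
    have inj: "inj J" by (auto simp: J_def inj_def cvec_inj)
    have "\<forall>K\<in>J ` A. f (inv J K) = 0"
    proof (rule weight_vectors_independent)
      show "(\<Sum>K\<in>J ` A. f (inv J K)) = 0"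
        using A(3) inj by (subst sum.reindex) (auto simp: inj_on_def)
      fix K assume "K \<in> J ` A"
      then obtain i where i: "i \<in> A" "K = J i" by blast
      then show "f (inv J K) \<in> wsp K" using A(2)[OF i(1)] inj by simp (simp add: J_def)
    qed (use A(1) in simp)
    then show ?thesis using inj by simp
  qed
  have "\<exists>!f. (\<forall>i. f i \<in> wsp (L + cvec i)) \<and> finite {i. f i \<noteq> 0} \<and> v = (\<Sum>i | f i \<noteq> 0. f i)" for v
    by (rule V.direct_sumI[OF subspace_wsp wsp_coset_span[OF assms] ind])
  then show ?thesis by (auto simp: is_direct_sum_def subspace_wsp)
qed

lemma weights_form_coset:
  assumes "v \<in> wsp L" "v \<noteq> 0"
  shows "wsp K \<noteq> {0} \<longleftrightarrow> (\<exists>r. K = L + cvec r)"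
proof
  assume "\<exists>r. K = L + cvec r"
  then obtain r where "K = L + cvec r" by blast
  then have "T r \<cdot> v \<in> wsp K" using T_wsp assms(1) by blast
  moreover have "T r \<cdot> v \<noteq> 0" using assms(2) T_inverse_app(2)[of r v] by (metis app_zero)
  ultimately show "wsp K \<noteq> {0}" by blast
next
  assume "wsp K \<noteq> {0}"
  then obtain x where x: "x \<in> wsp K" "x \<noteq> 0" using V.subspace_0[OF subspace_wsp] by blast
  show "\<exists>r. K = L + cvec r"
  proof (rule ccontr)
    assume no: "\<nexists>r. K = L + cvec r"
    obtain f where f: "\<forall>i. f i \<in> wsp (L + cvec i)" "finite {i. f i \<noteq> 0}" "x = (\<Sum>i | f i \<noteq> 0. f i)"
      using coset_direct_sum[OF assms] unfolding is_direct_sum_def by (auto dest!: spec[of _ x])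
    define J where "J = (\<lambda>i. L + cvec i)"
    have inj: "inj J" by (auto simp: J_def inj_def cvec_inj)
    define g where "g = (\<lambda>Q. if Q = K then - x else f (inv J Q))"
    have KJ: "K \<notin> J ` {i. f i \<noteq> 0}" using no by (auto simp: J_def)
    have "(\<Sum>Q\<in>J ` {i. f i \<noteq> 0}. g Q) = (\<Sum>i | f i \<noteq> 0. f i)"
    proof (subst sum.reindex)
      show "inj_on J {i. f i \<noteq> 0}" using inj by (rule inj_on_subset) simp
      have "J i \<noteq> K" for i using no by (auto simp: J_def)
      then show "sum (g \<circ> J) {i. f i \<noteq> 0} = (\<Sum>i | f i \<noteq> 0. f i)" using inj by (simp add: g_def)
    qed
    then have sum: "(\<Sum>Q\<in>insert K (J ` {i. f i \<noteq> 0}). g Q) = 0"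
      using KJ f(2,3) by (simp add: g_def)
    have "\<forall>Q\<in>insert K (J ` {i. f i \<noteq> 0}). g Q = 0"
    proof (rule weight_vectors_independent[OF _ _ sum])
      fix Q assume "Q \<in> insert K (J ` {i. f i \<noteq> 0})"
      then consider "Q = K" | i where "Q = J i" "Q \<noteq> K" using KJ by blast
      then show "g Q \<in> wsp Q"
      proof cases
        case 1
        then show ?thesis using x(1) V.subspace_neg[OF subspace_wsp] by (simp add: g_def)
      next
        case (2 i)
        then have "g Q = f i" using inj by (simp add: g_def)
        then show ?thesis using f(1) 2 by (simp add: J_def)
      qed
    qed (use f(2) in simp)
    then show False using x(2) by (simp add: g_def)
  qed
qed

text \<open>
  By now every \<open>t\<^sup>r b\<close>, \<open>h\<^sub>r b\<close>, \<open>D(u,0) b\<close> is a combination of the operator for \<open>b = 1\<close> and a scalar.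
\<close>

lemma irreducible_at_one:
  assumes W: "V.subspace W" and st: "\<And>r w. w \<in> W \<Longrightarrow> tt r 1 \<cdot> w \<in> W"
    "\<And>r w. w \<in> W \<Longrightarrow> hh r 1 \<cdot> w \<in> W" "\<And>u w. w \<in> W \<Longrightarrow> dd u 1 \<cdot> w \<in> W"
  shows "W = {0} \<or> W = UNIV"
proof (rule irreducible[OF W])
  note sub = V.subspace_scale[OF W] V.subspace_add[OF W]
  show "tt r b \<cdot> w \<in> W" if "w \<in> W" for r b w
  proof (cases "r = 0")
    case True
    obtain c where "tt 0 b = sc c" using At_scalar[OF tt_At shift_tt] by blast
    then show ?thesis using True that sub by simp
  next
    case False
    show ?thesis unfolding tt_psi[OF False, of b] using that st(1) sub by simp
  qed
  show "hh r b \<cdot> w \<in> W" if "w \<in> W" for r b w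
    unfolding hh_psi[of r b] using that st(2) sub by simp
  obtain c where c: "\<And>u b. dd u b = sc (c u b) + sc (psi b) * dd u 1" using dd_psi by blast
  show "dd u b \<cdot> w \<in> W" if "w \<in> W" for u b w
    unfolding c[of u b] using that st(3) sub by simp
qed

lemma dd_on_weight_spaces:
  assumes v: "v \<in> wsp L" "v \<noteq> 0"
  shows "\<exists>f. (\<forall>b. Vector_Spaces.linear (*s) (*) (\<lambda>u. f u b)) \<and>
    (\<forall>u. Vector_Spaces.linear sclB (*) (f u)) \<and> (\<forall>u. f u 1 = dotc u L) \<and>
    (\<forall>b u r. \<forall>w \<in> wsp (L + cvec r). dd u b \<cdot> w = scale (f u b + dotc u (cvec r) * psi b) w)"
proof -
  obtain c where c: "\<And>u b. dd u b = sc (c u b) + sc (psi b) * dd u 1" using dd_psi by blast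
  define f where "f u b = c u b + dotc u L * psi b" for u b
  have f: "dd u b \<cdot> w = scale (f u b + dotc u (cvec r) * psi b) w" if "w \<in> wsp (L + cvec r)" for u b r w
  proof -
    have "dd u 1 \<cdot> w = scale (dotc u (L + cvec r)) w" using that by (simp add: wsp_def)
    then show ?thesis unfolding c[of u b] f_def by (simp add: algebra_simps)
  qed
  have fv: "dd u b \<cdot> v = scale (f u b) v" for u b using f[of v 0 u b] v(1) by simp
  have cancel: "a = b" if "scale a v = scale b v" for a b using that v(2) by simp
  have "vector_space ((*s) :: complex \<Rightarrow> 'm cvec \<Rightarrow> 'm cvec)"
    by unfold_locales (simp_all add: vector_add_ldistrib vector_sadd_rdistrib)
  moreover have "vector_space ((*) :: complex \<Rightarrow> complex \<Rightarrow> complex)"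
    by unfold_locales (simp_all add: algebra_simps)
  moreover have "f (u + u') b = f u b + f u' b" "f (d *s u) b = d * f u b"
    "f u (b + b') = f u b + f u b'" "f u (sclB d b) = d * f u b" for u u' b b' d
    by (rule cancel, simp only: fv[symmetric] V.scale_left_distrib V.scale_scale[symmetric]
        dd_add_left dd_scale_left dd_add dd_scale app_simps V.sc_app)+
  ultimately have "Vector_Spaces.linear (*s) (*) (\<lambda>u. f u b)" "Vector_Spaces.linear sclB (*) (f u)" for u b
    by (simp_all add: Vector_Spaces.linear_iff B.vector_space_axioms)
  moreover have "f u 1 = dotc u L" for u
    by (rule cancel) (use fv v(1) in \<open>simp add: wsp_def del: V.scale_cancel_right\<close>)
  ultimately show ?thesis using f by blast
qed

section \<open>The action of the associative algebra of Laurent polynomials\<close>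

text \<open>
  The action of \<open>A\<^sub>N\<close> that makes \<open>V\<close> a jet module: \<open>t\<^sup>r\<close> acts by \<open>T r\<close>, not by the operator \<open>tt r 1\<close>, which
  is multiplicative only up to the factors \<open>\<kappa>\<close> and \<open>\<mu>\<close>.
\<close>

definition actA :: "('m, complex) laurent \<Rightarrow> 'v endo" where
  "actA g = (\<Sum>s\<in>Poly_Mapping.keys g. sc (Poly_Mapping.lookup g s) * T s)"

lemma actA_superset:
  assumes "finite A" "Poly_Mapping.keys g \<subseteq> A"
  shows "actA g = (\<Sum>s\<in>A. sc (Poly_Mapping.lookup g s) * T s)"
  unfolding actA_def by (rule sum.mono_neutral_left) (use assms in \<open>auto simp: in_keys_iff\<close>)

lemma actA_single: "actA (Poly_Mapping.single s c) = sc c * T s"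
  using actA_superset[of "{s}" "Poly_Mapping.single s c"] by (simp add: lookup_single)

lemma actA_add: "actA (f + g) = actA f + actA g"
proof -
  let ?A = "Poly_Mapping.keys f \<union> Poly_Mapping.keys g"
  have "actA (f + g) = (\<Sum>s\<in>?A. sc (Poly_Mapping.lookup (f + g) s) * T s)"
    by (rule actA_superset) (simp_all add: keys_add)
  moreover have "actA f = (\<Sum>s\<in>?A. sc (Poly_Mapping.lookup f s) * T s)"
    "actA g = (\<Sum>s\<in>?A. sc (Poly_Mapping.lookup g s) * T s)" by (rule actA_superset; simp)+
  ultimately show ?thesis by (simp add: lookup_add V.sc_add distrib_right sum.distrib)
qed

lemma actA_scale: "actA (laurent_scale (*) c f) = sc c * actA f"
proof -
  interpret C: comm_algebra "(*) :: complex \<Rightarrow> complex \<Rightarrow> complex" by (rule comm_algebra_complex)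
  have "actA (laurent_scale (*) c f) = (\<Sum>s\<in>Poly_Mapping.keys f. sc (Poly_Mapping.lookup (laurent_scale (*) c f) s) * T s)"
    by (rule actA_superset) (auto simp: in_keys_iff C.lookup_laurent_scale)
  then show ?thesis
    by (simp add: C.lookup_laurent_scale actA_def sum_distrib_left V.sc_mult_assoc)
qed

lemma lin_actA: "lin (actA g)"
  by (induction g rule: laurent_induct) (auto simp: actA_single actA_add lin_T V.lin_simps)

lemma actA_one: "actA 1 = 1"
  by (simp add: actA_single flip: single_one)

lemma actA_mult: "actA (f * g) = actA f * actA g"
proof (induction f rule: laurent_induct)
  case f: (single k c)
  show ?case
  proof (induction g rule: laurent_induct)
    case (single l d)
    show ?case
      by (simp add: mult_single actA_single V.lin_sc_left[OF lin_T] mult.assoc V.sc_mult T_mult)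
  qed (simp add: actA_add algebra_simps)
qed (simp add: actA_add algebra_simps)

lemma br_hh_actA: "br (hh k 1) (actA g) = actA (vf_app (vD (cvec (bar k)) k) g)"
  and br_dd_actA: "br (dd u 1) (actA g) = actA (vf_app (vD u 0) g)"
proof -
  have lin: "br X (sc c * f) = sc c * br X f" if "lin X" for X f :: "'v endo" and c
    by (simp add: V.lin_sc_left[OF that] right_diff_distrib mult.assoc)
  show "br (hh k 1) (actA g) = actA (vf_app (vD (cvec (bar k)) k) g)"
  proof (induction g rule: laurent_induct)
    case (single s c)
    show ?case
      unfolding actA_single vf_app_vD lin[OF lin_hh] br_hh_T
      by (simp add: psi_one dotc_bar V.sc_mult_assoc mult.commute)
  qed (simp only: actA_add br_add vf_app_add)
  show "br (dd u 1) (actA g) = actA (vf_app (vD u 0) g)"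
  proof (induction g rule: laurent_induct)
    case (single s c)
    show ?case
      unfolding actA_single vf_app_vD lin[OF lin_dd] br_dd_T
      by (simp add: psi_one V.sc_mult_assoc mult.commute)
  qed (simp only: actA_add br_add vf_app_add)
qed

end

section \<open>Generators of the Lie algebras\<close>

definition ext_gens :: "('m::finite, complex) ext set" where
  "ext_gens = range (\<lambda>r. D_elt (cvec (bar r)) r) \<union> range (\<lambda>u. D_elt u 0) \<union> range t_elt"

lemma vD_zero: "vD 0 r = 0" and vD_add: "vD (u + v) r = vD u r + vD v r"
  by (simp_all add: vD_def vec_eq_iff single_add)

lemma D_elt_add: "D_elt (u + v) r = D_elt u r + D_elt v r"
  by (simp add: D_elt_def vD_add)

lemma D_elt_scale: "D_elt (c *s u) r = ext_scale (*) c (D_elt u r)"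
proof -
  interpret C: comm_algebra "(*) :: complex \<Rightarrow> complex \<Rightarrow> complex" by (rule comm_algebra_complex)
  show ?thesis
    by (auto intro!: poly_mapping_eqI simp: D_elt_def ext_scale_def vf_scale_def vD_def vec_eq_iff
        prod_eq_iff C.lookup_laurent_scale lookup_single when_def)
qed

lemma D_elt_zero: "D_elt 0 r = 0"
  by (simp add: D_elt_def vD_zero zero_prod_def)

lemma ext_brk_t_t: "ext_brk (t_elt r) (t_elt s) = 0"
  by (simp add: ext_brk_def t_elt_def vf_brk_def vec_eq_iff prod_eq_iff)

lemma H_tilde_parts:
  fixes X Y :: "('a::finite, complex) vfield"
  shows "X \<in> H_N \<Longrightarrow> X \<in> H_tilde" "Y \<in> cartan \<Longrightarrow> Y \<in> H_tilde"
proof -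
  interpret V: vector_space "vf_scale (*) :: complex \<Rightarrow> ('a::finite, complex) vfield \<Rightarrow> _"
    by (rule comm_algebra.vector_space_vf[OF comm_algebra_complex])
  have 0: "0 \<in> (H_N :: ('a, complex) vfield set)" "0 \<in> (cartan :: ('a, complex) vfield set)"
    by (auto simp: H_N_def V.span_zero cartan_def vD_zero intro!: image_eqI[of _ _ 0])
  show "X \<in> H_N \<Longrightarrow> X \<in> H_tilde" "Y \<in> cartan \<Longrightarrow> Y \<in> H_tilde"
    using 0 unfolding H_tilde_def by force+
qed

lemma h_in_H_N: "vD (cvec (bar r)) r \<in> H_N" for r :: "'a::finite ivec"
proof -
  interpret V: vector_space "vf_scale (*) :: complex \<Rightarrow> ('a::finite, complex) vfield \<Rightarrow> _"
    by (rule comm_algebra.vector_space_vf[OF comm_algebra_complex])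
  show ?thesis unfolding H_N_def by (rule V.span_base) simp
qed

lemma ext_gens_H_ext: "ext_gens \<subseteq> (H_ext :: ('m::finite, complex) ext set)"
proof -
  have "vD (cvec (bar r)) r \<in> H_tilde" and u: "vD u 0 \<in> H_tilde" for r :: "'m ivec" and u :: "'m cvec"
    using H_tilde_parts(1)[OF h_in_H_N] H_tilde_parts(2)[of "vD u 0"] by (auto simp: cartan_def)
  moreover have "0 \<in> (H_tilde :: ('m, complex) vfield set)" using u[of 0] by (simp add: vD_zero)
  ultimately show ?thesis by (auto simp: ext_gens_def H_ext_def D_elt_def t_elt_def)
qed

lemma H_N_induct [consumes 1, case_names zero step]:
  fixes X :: "('a::finite, complex) vfield"
  assumes "X \<in> H_N" "P 0"
    and "\<And>c r X. X \<in> H_N \<Longrightarrow> P X \<Longrightarrow> P (vf_scale (*) c (vD (cvec (bar r)) r) + X)"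
  shows "P X"
proof -
  interpret V: vector_space "vf_scale (*) :: complex \<Rightarrow> ('a::finite, complex) vfield \<Rightarrow> _"
    by (rule comm_algebra.vector_space_vf[OF comm_algebra_complex])
  have "X \<in> H_N \<and> P X"
    using assms(1)[unfolded H_N_def]
  proof (induction rule: V.span_induct_alt)
    case base
    then show ?case using assms(2) by (simp add: H_N_def V.span_zero)
  next
    case (step c x y)
    then obtain r where x: "x = vD (cvec (bar r)) r" by blast
    have "vf_scale (*) c x + y \<in> H_N"
      using step h_in_H_N[of r] by (simp add: H_N_def x V.span_add V.span_scale)
    then show ?case using step.IH assms(3)[of y c r] by (simp add: x)
  qed
  then show ?thesis ..
qed

lemma H_ext_subset_span: "H_ext \<subseteq> module.span (ext_scale (*)) ext_gens"
proof
  interpret C: comm_algebra "(*) :: complex \<Rightarrow> complex \<Rightarrow> complex" by (rule comm_algebra_complex)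
  interpret E: vector_space "ext_scale (*) :: complex \<Rightarrow> ('a::finite, complex) ext \<Rightarrow> _"
    by (rule C.vector_space_ext)
  fix x :: "('a, complex) ext" assume "x \<in> H_ext"
  then obtain X u f where x: "x = (X + vD u 0, f)" and X: "X \<in> H_N"
    by (auto simp: H_ext_def H_tilde_def cartan_def)
  have "(X, 0) \<in> E.span ext_gens"
    using X
  proof (induction rule: H_N_induct)
    case zero
    then show ?case using E.span_zero by (simp add: zero_prod_def)
  next
    case (step c r X)
    have "(vf_scale (*) c (vD (cvec (bar r)) r) + X, 0) = ext_scale (*) c (D_elt (cvec (bar r)) r) + (X, 0)"
      by (simp add: ext_scale_def D_elt_def laurent_scale_def map_eq_zero_iff)
    moreover have "D_elt (cvec (bar r)) r \<in> E.span ext_gens"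
      by (rule E.span_base) (simp add: ext_gens_def)
    ultimately show ?case using step by (simp add: E.span_add E.span_scale)
  qed
  moreover have "(vD u 0, 0) \<in> E.span ext_gens"
    by (rule E.span_base) (simp add: ext_gens_def D_elt_def)
  moreover have "(0, f) \<in> E.span ext_gens"
  proof (induction f rule: laurent_induct)
    case (single k c)
    have "(0, Poly_Mapping.single k c) = ext_scale (*) c (t_elt k)"
      by (auto intro!: poly_mapping_eqI simp: ext_scale_def t_elt_def vf_scale_def vec_eq_iff prod_eq_iff
          C.lookup_laurent_scale lookup_single when_def)
    moreover have "t_elt k \<in> E.span ext_gens" by (rule E.span_base) (simp add: ext_gens_def)
    ultimately show ?case by (simp add: E.span_scale)
  next
    case (add f g)
    have "(0, f + g) = (0, f) + (0 :: ('a, complex) vfield, g)" by simp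
    then show ?case using add E.span_add by metis
  qed
  moreover have "x = (X, 0) + (vD u 0, 0) + (0, f)" by (simp add: x)
  ultimately show "x \<in> E.span ext_gens" by (simp only: E.span_add)
qed

lemma (in comm_algebra) tensor_B_subset_span:
  "(tensor_B scl H_ext :: ('m::finite, 'b) ext set) \<subseteq> module.span (ext_scale scl) {tens scl g b | g b. g \<in> ext_gens}"
proof -
  interpret E: vector_space "ext_scale scl :: complex \<Rightarrow> ('m::finite, 'b) ext \<Rightarrow> _"
    by (rule vector_space_ext)
  interpret C: vector_space "ext_scale (*) :: complex \<Rightarrow> ('m::finite, complex) ext \<Rightarrow> _"
    by (rule comm_algebra.vector_space_ext[OF comm_algebra_complex])
  have "tens scl x b \<in> E.span {tens scl g b | g b. g \<in> ext_gens}" if "x \<in> H_ext"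
    for x :: "('m, complex) ext" and b
  proof -
    have "x \<in> C.span ext_gens" using that H_ext_subset_span by blast
    then show ?thesis
    proof (induction rule: C.span_induct_alt)
      case base
      have "tens scl (0 :: ('m, complex) ext) b = 0"
        using tens_bilinear(1)[of 0 0 b] by simp
      then show ?case by (simp add: E.span_zero)
    next
      case (step c x y)
      have "tens scl x b \<in> E.span {tens scl g b | g b. g \<in> ext_gens}"
        by (rule E.span_base) (use step in blast)
      then show ?case using step.IH by (simp add: tens_bilinear E.span_add E.span_scale)
    qed
  qed
  then show ?thesis unfolding tensor_B_def by (intro E.span_minimal E.subspace_span) blast
qed

lemma (in lie_module) stable_if_stable_under_generators:
  assumes G: "G \<subseteq> L" "L \<subseteq> module.span sclL G"
    and W: "V.subspace W" "\<And>g w. g \<in> G \<Longrightarrow> w \<in> W \<Longrightarrow> act g w \<in> W" and x: "x \<in> L" "w \<in> W"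
  shows "act x w \<in> W"
proof -
  have "x \<in> span G" using G(2) x(1) by blast
  then have "x \<in> L \<and> act x w \<in> W"
  proof (induction rule: span_induct_alt)
    case base
    have 0: "0 \<in> L" using L_subspace by (rule subspace_0)
    then have "act 0 w = 0" using act_scale[OF 0, of 0 w] by simp
    then show ?case using 0 V.subspace_0[OF W(1)] by simp
  next
    case (step c x y)
    then have "x \<in> L" using G(1) by blast
    then have "sclL c x \<in> L" using L_subspace by (simp add: subspace_scale)
    then show ?case using step W x(2) \<open>x \<in> L\<close> L_subspace
      by (auto simp: act_add act_scale intro: subspace_add V.subspace_add V.subspace_scale)
  qed
  then show ?thesis ..
qed

lemma U_orbit_irreducible:
  assumes irr: "irreducible_lie_module sclL L brk sclV act" and "v \<noteq> 0"
  shows "U_orbit sclV L act v = UNIV"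
proof -
  have "lie_module sclL L brk sclV act" using irr by (simp add: irreducible_lie_module_def)
  then interpret lie_module sclL L brk sclV act .
  let ?O = "{foldr act xs v | xs. set xs \<subseteq> L}"
  have stable: "act x w \<in> V.span ?O" if x: "x \<in> L" and w: "w \<in> V.span ?O" for x w
    using w
  proof (induction rule: V.span_induct_alt)
    case base
    interpret l: Vector_Spaces.linear sclV sclV "act x" by (rule act_linear[OF x])
    show ?case by (simp add: V.span_zero)
  next
    case (step c y z)
    interpret l: Vector_Spaces.linear sclV sclV "act x" by (rule act_linear[OF x])
    obtain xs where "y = foldr act xs v" "set xs \<subseteq> L" using step by blast
    then have "act x y = foldr act (x # xs) v" "set (x # xs) \<subseteq> L" using x by auto
    then have "act x y \<in> V.span ?O" by (intro V.span_base) blast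
    then show ?case using step.IH by (simp add: l.add l.scale V.span_add V.span_scale)
  qed
  have "v = foldr act [] v" "set [] \<subseteq> L" by simp_all
  then have "v \<in> V.span ?O" by (intro V.span_base) blast
  moreover have "V.span ?O = {0} \<or> V.span ?O = UNIV"
    using irr stable V.subspace_span unfolding irreducible_lie_module_def by blast
  ultimately show ?thesis using \<open>v \<noteq> 0\<close> by (auto simp: U_orbit_def)
qed

lemma h_dual_dotc: "l \<in> h_dual \<Longrightarrow> l u = dotc u (\<chi> i. l (axis i 1))"
proof -
  assume "l \<in> h_dual"
  then interpret l: Vector_Spaces.linear "(*s)" "(*)" l by (simp add: h_dual_def)
  have "u = (\<Sum>i\<in>UNIV. u $ i *s axis i 1)"
    by (simp add: vec_eq_iff axis_def if_distrib cong: if_cong)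
  then have "l u = (\<Sum>i\<in>UNIV. u $ i * l (axis i 1))" by (metis (no_types, lifting) l.scale l.sum sum.cong)
  then show ?thesis by (simp add: dotc_def)
qed

lemma dotc_h_dual: "(\<lambda>u. dotc u L) \<in> h_dual" for L :: "'m::finite cvec"
proof -
  have "vector_space ((*s) :: complex \<Rightarrow> 'm cvec \<Rightarrow> 'm cvec)"
    by unfold_locales (simp_all add: vector_add_ldistrib vector_sadd_rdistrib)
  moreover have "vector_space ((*) :: complex \<Rightarrow> complex \<Rightarrow> complex)"
    by unfold_locales (simp_all add: algebra_simps)
  ultimately show ?thesis by (simp add: h_dual_def Vector_Spaces.linear_iff)
qed

section \<open>From modules to operators\<close>

locale hamiltonian_module =
  fixes sclB :: "complex \<Rightarrow> 'b::comm_ring_1 \<Rightarrow> 'b"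
    and sclV :: "complex \<Rightarrow> 'v::ab_group_add \<Rightarrow> 'v"
    and \<rho> :: "('m::finite, 'b) ext \<Rightarrow> 'v \<Rightarrow> 'v"
  assumes B: "comm_algebra sclB"
    and irr: "irreducible_lie_module (ext_scale sclB) (tensor_B sclB H_ext) ext_brk sclV \<rho>"
    and bdd: "uniformly_bounded sclV (\<lambda>u. \<rho> (tens sclB (D_elt u 0) 1))"
    and nontriv: "\<exists>s. s \<noteq> 0 \<and> (\<exists>v. \<rho> (tens sclB (t_elt s) 1) v \<noteq> 0)"
    and nontriv0: "\<exists>v. \<rho> (tens sclB (t_elt 0) 1) v \<noteq> 0"
begin

lemma lie_module: "lie_module (ext_scale sclB) (tensor_B sclB H_ext) ext_brk sclV \<rho>"
  using irr by (simp add: irreducible_lie_module_def)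

sublocale LM: lie_module "ext_scale sclB" "tensor_B sclB H_ext" ext_brk sclV \<rho>
  by (rule lie_module)

sublocale B: comm_algebra sclB by (rule B)

sublocale V: complex_space sclV ..

definition act :: "('m, complex) ext \<Rightarrow> 'b \<Rightarrow> 'v endo" where
  "act x b = Endo (\<rho> (tens sclB x b))"

lemma tens_mem: "x \<in> H_ext \<Longrightarrow> tens sclB x b \<in> tensor_B sclB H_ext"
  for x :: "('m, complex) ext"
  unfolding tensor_B_def by (rule LM.span_base) blast

lemma act_app: "x \<in> H_ext \<Longrightarrow> act x b \<cdot> v = \<rho> (tens sclB x b) v"
proof -
  assume "x \<in> H_ext"
  then interpret l: Vector_Spaces.linear sclV sclV "\<rho> (tens sclB x b)"
    by (rule LM.act_linear[OF tens_mem])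
  show ?thesis unfolding act_def by (subst Endo_inverse) (simp_all add: l.add)
qed

lemma lin_act: "x \<in> H_ext \<Longrightarrow> V.lin (act x b)"
proof (rule V.linI)
  fix c v assume x: "x \<in> H_ext"
  interpret l: Vector_Spaces.linear sclV sclV "\<rho> (tens sclB x b)"
    by (rule LM.act_linear[OF tens_mem[OF x]])
  show "act x b \<cdot> sclV c v = sclV c (act x b \<cdot> v)" by (simp add: act_app[OF x] l.scale)
qed

lemma H_ext_closed:
  fixes x y :: "('m, complex) ext"
  shows "x \<in> H_ext \<Longrightarrow> y \<in> H_ext \<Longrightarrow> x + y \<in> H_ext"
  "x \<in> H_ext \<Longrightarrow> ext_scale (*) c x \<in> H_ext"
  "x \<in> H_ext \<Longrightarrow> y \<in> H_ext \<Longrightarrow> ext_brk x y \<in> H_ext" "0 \<in> (H_ext :: ('m, complex) ext set)"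
proof -
  interpret H: lie_algebra "ext_scale (*)" "H_ext :: ('m, complex) ext set" ext_brk
    by (rule lie_algebra_H_ext)
  show "x \<in> H_ext \<Longrightarrow> y \<in> H_ext \<Longrightarrow> x + y \<in> H_ext" "x \<in> H_ext \<Longrightarrow> ext_scale (*) c x \<in> H_ext"
    "x \<in> H_ext \<Longrightarrow> y \<in> H_ext \<Longrightarrow> ext_brk x y \<in> H_ext" "0 \<in> (H_ext :: ('m, complex) ext set)"
    using H.L_subspace by (auto intro: H.subspace_add H.subspace_scale H.subspace_0 H.brk_closed)
qed

lemma act_add_left: "x \<in> H_ext \<Longrightarrow> y \<in> H_ext \<Longrightarrow> act (x + y) b = act x b + act y b"
  and act_br: "x \<in> H_ext \<Longrightarrow> y \<in> H_ext \<Longrightarrow> act (ext_brk x y) (b * b') = br (act x b) (act y b')"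
proof -
  assume x: "x \<in> H_ext" and y: "y \<in> H_ext"
  note m = tens_mem[OF x] tens_mem[OF y]
  note xy = H_ext_closed(1,3)[OF x y]
  show "act (x + y) b = act x b + act y b"
    by (auto intro!: endo_eqI simp: act_app x y xy B.tens_bilinear LM.act_add m)
  show "act (ext_brk x y) (b * b') = br (act x b) (act y b')"
    by (auto intro!: endo_eqI simp: act_app x y xy LM.act_brk m simp flip: B.ext_brk_tens)
qed

lemma act_add: "x \<in> H_ext \<Longrightarrow> act x (b + b') = act x b + act x b'"
  and act_scale_left: "x \<in> H_ext \<Longrightarrow> act (ext_scale (*) c x) b = V.sc c * act x b"
  and act_scale: "x \<in> H_ext \<Longrightarrow> act x (sclB c b) = V.sc c * act x b"
  by (auto intro!: endo_eqI simp: act_app H_ext_closed B.tens_bilinear LM.act_add LM.act_scale tens_mem)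

lemma act_zero: "act 0 b = 0"
  using act_add_left[OF H_ext_closed(4) H_ext_closed(4), of b] by simp

definition "ta r b = act (t_elt r) b"
definition "ha r b = act (D_elt (cvec (bar r)) r) b"
definition "da u b = act (D_elt u 0) b"

lemma gens_mem: "t_elt r \<in> H_ext" "D_elt (cvec (bar r)) r \<in> H_ext" "D_elt u 0 \<in> H_ext"
  using ext_gens_H_ext by (auto simp: ext_gens_def)

lemma irreducible_stable:
  assumes "LM.V.subspace W" "\<And>r b w. w \<in> W \<Longrightarrow> ta r b \<cdot> w \<in> W"
    "\<And>r b w. w \<in> W \<Longrightarrow> ha r b \<cdot> w \<in> W" "\<And>u b w. w \<in> W \<Longrightarrow> da u b \<cdot> w \<in> W"
  shows "W = {0} \<or> W = UNIV"
proof -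
  let ?G = "{tens sclB g b | g b. g \<in> (ext_gens :: ('m, complex) ext set)}"
  have "?G \<subseteq> tensor_B sclB H_ext" using ext_gens_H_ext tens_mem by blast
  moreover have "\<rho> g w \<in> W" if "g \<in> ?G" "w \<in> W" for g w
    using that assms(2-4)[OF that(2)] by (auto simp: ext_gens_def ta_def ha_def da_def act_app gens_mem)
  ultimately have "\<forall>x\<in>tensor_B sclB H_ext. \<forall>w\<in>W. \<rho> x w \<in> W"
    using LM.stable_if_stable_under_generators[OF _ B.tensor_B_subset_span assms(1)] by blast
  then show ?thesis using irr assms(1) unfolding irreducible_lie_module_def by blast
qed

lemma weight_data:
  shows "LM.V.span (\<Union>L. {v. \<forall>u. da u 1 \<cdot> v = sclV (dotc u L) v}) = UNIV"
    and "\<exists>M. \<forall>L. \<exists>T. finite T \<and> card T \<le> M \<and> {v. \<forall>u. da u 1 \<cdot> v = sclV (dotc u L) v} \<subseteq> LM.V.span T"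
proof -
  let ?h = "\<lambda>u. \<rho> (tens sclB (D_elt u 0) 1)"
  have da: "da u 1 \<cdot> v = ?h u v" for u v by (simp add: da_def act_app gens_mem)
  have w: "{v. \<forall>u. da u 1 \<cdot> v = sclV (dotc u L) v} = weight_space sclV ?h (\<lambda>u. dotc u L)" for L
    by (simp add: weight_space_def da)
  have hc: "harish_chandra sclV ?h" using bdd by (simp add: uniformly_bounded_def)
  then have ds: "is_direct_sum sclV h_dual (weight_space sclV ?h)"
    by (simp add: harish_chandra_def weight_module_def)
  have "v \<in> LM.V.span (\<Union>L. weight_space sclV ?h (\<lambda>u. dotc u L))" for v
  proof -
    obtain f where f: "\<forall>i\<in>h_dual. f i \<in> weight_space sclV ?h i" "\<forall>i. i \<notin> h_dual \<longrightarrow> f i = 0"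
      "v = (\<Sum>i | f i \<noteq> 0. f i)"
      using ds unfolding is_direct_sum_def by (auto dest!: spec[of _ v])
    have "f i \<in> LM.V.span (\<Union>L. weight_space sclV ?h (\<lambda>u. dotc u L))" if "f i \<noteq> 0" for i
    proof -
      have "i \<in> h_dual" using that f(2) by blast
      then have "f i \<in> weight_space sclV ?h i" using f(1) by simp
      moreover have "i = (\<lambda>u. dotc u (\<chi> j. i (axis j 1)))"
        by (rule ext) (rule h_dual_dotc[OF \<open>i \<in> h_dual\<close>])
      ultimately have "f i \<in> weight_space sclV ?h (\<lambda>u. dotc u (\<chi> j. i (axis j 1)))" by simp
      then show ?thesis by (intro LM.V.span_base) blast
    qed
    then show ?thesis unfolding f(3) by (intro LM.V.span_sum) simp
  qed
  then show "LM.V.span (\<Union>L. {v. \<forall>u. da u 1 \<cdot> v = sclV (dotc u L) v}) = UNIV" unfolding w by blast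
  obtain M where M: "\<And>l. l \<in> h_dual \<Longrightarrow> LM.V.dim (weight_space sclV ?h l) \<le> M"
    using bdd by (auto simp: uniformly_bounded_def)
  have "\<exists>T. finite T \<and> card T \<le> M \<and> weight_space sclV ?h l \<subseteq> LM.V.span T" if l: "l \<in> h_dual" for l
  proof -
    obtain F where F: "F \<subseteq> weight_space sclV ?h l" "LM.V.independent F" "weight_space sclV ?h l \<subseteq> LM.V.span F"
      "card F = LM.V.dim (weight_space sclV ?h l)"
      by (rule LM.V.basis_exists)
    obtain D where D: "finite D" "weight_space sclV ?h l = LM.V.span D"
      using hc l unfolding harish_chandra_def fin_dim_def by blast
    have "finite F" using LM.V.independent_span_bound[OF D(1) F(2)] F(1) D(2) by blast
    then show ?thesis using F M[OF l] by metis
  qed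
  then show "\<exists>M. \<forall>L. \<exists>T. finite T \<and> card T \<le> M \<and> {v. \<forall>u. da u 1 \<cdot> v = sclV (dotc u L) v} \<subseteq> LM.V.span T"
    unfolding w using dotc_h_dual by blast
qed

lemma loop_rep_of_module: "\<exists>M. loop_rep_nontrivial sclV sclB ta ha da M"
proof -
  obtain M where M: "\<And>L. \<exists>T. finite T \<and> card T \<le> M \<and> {v. \<forall>u. da u 1 \<cdot> v = sclV (dotc u L) v} \<subseteq> LM.V.span T"
    using weight_data(2) by blast
  have bar_add: "cvec (bar (r + s)) = cvec (bar r) + cvec (bar s)" for r s :: "'m ivec"
    by (auto simp: cvec_def bar_def vec_eq_iff split: sum.splits)
  have bar_0: "cvec (bar 0) = (0 :: 'm cvec)"
    by (auto simp: cvec_def bar_def vec_eq_iff split: sum.splits)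
  have h_h: "ext_brk (D_elt (cvec (bar r)) r) (D_elt (cvec (bar s)) s) =
      ext_scale (*) (of_int (om r s)) (D_elt (cvec (bar (r + s))) (r + s))" for r s :: "'m ivec"
    unfolding ext_brk_D_D dotc_bar D_elt_scale[symmetric] bar_add using om_skew[of s r]
    by (simp add: vector_add_ldistrib add.commute)
  have d_h: "ext_brk (D_elt u 0) (D_elt (cvec (bar s)) s) =
      ext_scale (*) (dotc u (cvec s)) (D_elt (cvec (bar s)) s)" for u and s :: "'m ivec"
    by (simp add: ext_brk_D_D D_elt_scale)
  have d_t: "ext_brk (D_elt u 0) (t_elt s) = ext_scale (*) (dotc u (cvec s)) (t_elt s)"
    for u and s :: "'m ivec" by (simp add: ext_brk_D_t)
  have d_d: "ext_brk (D_elt u 0) (D_elt v 0) = (0 :: ('m, complex) ext)" for u v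
    by (simp add: ext_brk_D_D D_elt_zero)
  note defs = ta_def ha_def da_def
  have br: "br (act x b) (act y b') = act (ext_brk x y) (b * b')" if "x \<in> H_ext" "y \<in> H_ext"
    for x y b b' using act_br that by simp
  have "loop_rep_nontrivial sclV sclB ta ha da M"
  proof (unfold_locales, goal_cases)
    case (12 b)
    show ?case by (simp add: ha_def bar_0 D_elt_zero act_zero)
  next
    case (13 r b s b')
    show ?case by (simp only: defs br gens_mem h_h act_scale_left)
  next
    case (14 r b s b')
    show ?case by (simp only: defs br gens_mem ext_brk_D_t dotc_bar act_scale_left)
  next
    case (19 W)
    show ?case by (rule irreducible_stable) fact+
  next
    case 20
    show ?case using irr by (simp add: irreducible_lie_module_def)
  next
    case 21
    show ?case by (rule weight_data)
  next
    case (22 L)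
    show ?case by (rule M)
  next
    case 23
    then show ?case using nontriv by (metis act_app app_simps(1) gens_mem(1) ta_def)
  next
    case 24
    then show ?case using nontriv0 by (metis act_app app_simps(1) gens_mem(1) ta_def)
  qed (simp_all only: defs br gens_mem lin_act act_add act_scale d_h d_t d_d act_scale_left act_zero
      ext_brk_t_t D_elt_add D_elt_scale act_add_left)
  then show ?thesis ..
qed

end

context hamiltonian_module
begin

section \<open>Restriction to the trivial coefficients\<close>

lemma irreducible_over_H_ext:
  "irreducible_lie_module (ext_scale (*)) H_ext ext_brk sclV (\<lambda>x. \<rho> (tens sclB x 1))"
proof -
  obtain M where "loop_rep_nontrivial sclV sclB ta ha da M" using loop_rep_of_module by blast
  then interpret R: loop_rep_nontrivial sclV sclB ta ha da M .
  have lm: "lie_module (ext_scale (*)) (H_ext :: ('m, complex) ext set) ext_brk sclV (\<lambda>x. \<rho> (tens sclB x 1))"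
    unfolding lie_module_def lie_module_axioms_def
  proof (intro conjI allI impI)
    show "lie_algebra (ext_scale (*)) (H_ext :: ('m, complex) ext set) ext_brk" by (rule lie_algebra_H_ext)
    show "vector_space sclV" by (rule LM.V.vector_space_axioms)
    fix x y :: "('m, complex) ext" and v c
    assume x: "x \<in> H_ext"
    show "Vector_Spaces.linear sclV sclV (\<rho> (tens sclB x 1))" by (rule LM.act_linear[OF tens_mem[OF x]])
    show "\<rho> (tens sclB (ext_scale (*) c x) 1) v = sclV c (\<rho> (tens sclB x 1) v)"
      by (simp add: B.tens_bilinear LM.act_scale tens_mem x)
    assume y: "y \<in> H_ext"
    show "\<rho> (tens sclB (x + y) 1) v = \<rho> (tens sclB x 1) v + \<rho> (tens sclB y 1) v"
      by (simp add: B.tens_bilinear LM.act_add tens_mem x y)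
    have "tens sclB (ext_brk x y) 1 = ext_brk (tens sclB x 1) (tens sclB y 1)"
      by (simp add: B.ext_brk_tens)
    then show "\<rho> (tens sclB (ext_brk x y) 1) v =
        \<rho> (tens sclB x 1) (\<rho> (tens sclB y 1) v) - \<rho> (tens sclB y 1) (\<rho> (tens sclB x 1) v)"
      by (simp add: LM.act_brk tens_mem x y)
  qed
  have "W = {0} \<or> W = UNIV"
    if W: "LM.V.subspace W" "\<forall>x\<in>H_ext. \<forall>w\<in>W. \<rho> (tens sclB x 1) w \<in> W" for W
    by (rule R.irreducible_at_one[OF W(1)])
      (use W(2) in \<open>auto simp: ta_def ha_def da_def act_app gens_mem\<close>)
  then show ?thesis
    unfolding irreducible_lie_module_def using lm R.nonzero by blast
qed

text \<open>
  The operators \<open>T r\<close> and \<open>tt r 1\<close> differ by a nonzero factor for \<open>r \<noteq> 0\<close> and are scalars for \<open>r = 0\<close>, so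
  both actions have the same stable subspaces.
\<close>

lemma irreducible_jet:
  "irreducible_jet_module sclV (\<lambda>X. \<rho> (tens sclB (X, 0) 1))"
proof -
  obtain M where "loop_rep_nontrivial sclV sclB ta ha da M" using loop_rep_of_module by blast
  then interpret R: loop_rep_nontrivial sclV sclB ta ha da M .
  interpret H: lie_module "ext_scale (*)" "H_ext :: ('m, complex) ext set" ext_brk sclV
    "\<lambda>x. \<rho> (tens sclB x 1)"
    using irreducible_over_H_ext by (simp add: irreducible_lie_module_def)
  interpret C: comm_algebra "(*) :: complex \<Rightarrow> complex \<Rightarrow> complex" by (rule comm_algebra_complex)
  define pair :: "('m, complex) vfield \<Rightarrow> ('m, complex) ext" where "pair X = (X, 0)" for X
  define X1 where "X1 X = act (pair X) 1" for X
  have mem: "pair X \<in> H_ext" if "X \<in> H_tilde" for X using that by (simp add: H_ext_def pair_def)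
  have pair: "pair (X + Y) = pair X + pair Y" "pair (vf_scale (*) c X) = ext_scale (*) c (pair X)"
    "pair (vf_brk X Y) = ext_brk (pair X) (pair Y)" for X Y c
    by (simp_all add: pair_def ext_scale_def laurent_scale_def map_eq_zero_iff ext_brk_def)
  have lm: "lie_module (vf_scale (*)) H_tilde vf_brk sclV (\<lambda>X. \<rho> (tens sclB (X, 0) 1))"
    unfolding lie_module_def lie_module_axioms_def pair_def[symmetric] pair
    by (intro conjI allI impI lie_algebra_H_tilde LM.V.vector_space_axioms
        H.act_linear H.act_add H.act_scale H.act_brk mem)
  have hc: "harish_chandra sclV (\<lambda>u. \<rho> (tens sclB (vD u 0, 0) 1))"
    using bdd by (simp add: uniformly_bounded_def D_elt_def)
  have compat: "br (X1 X) (R.actA g) = R.actA (vf_app X g)" if X: "X \<in> H_tilde" for X g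
  proof -
    have app_scale: "vf_app (vf_scale (*) c X) f = laurent_scale (*) c (vf_app X f)"
      for c and X :: "('m, complex) vfield" and f
      using C.ext_brk_scale[of c "(X, 0)" "(0, f)"] by (simp add: ext_brk_def ext_scale_def)
    have h: "X1 (vD (cvec (bar r)) r) = ha r 1" and d: "X1 (vD u 0) = da u 1" for r u
      by (simp_all add: X1_def pair_def ha_def da_def D_elt_def)
    have "X1 0 = 0" using act_zero by (simp add: X1_def pair_def zero_prod_def)
    have add: "X1 (X + Y) = X1 X + X1 Y" if "X \<in> H_tilde" "Y \<in> H_tilde" for X Y
      unfolding X1_def pair by (rule act_add_left) (use that mem in auto)
    obtain Y u where Y: "X = Y + vD u 0" "Y \<in> H_N" using X by (auto simp: H_tilde_def cartan_def)
    have "br (X1 Y) (R.actA g) = R.actA (vf_app Y g)"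
      using Y(2)
    proof (induction rule: H_N_induct)
      case zero
      then show ?case using \<open>X1 0 = 0\<close> by (simp add: R.actA_def)
    next
      case (step c r Y)
      have "vf_scale (*) c (vD (cvec (bar r)) r) \<in> H_tilde"
        using H_ext_closed(2)[OF mem[OF H_tilde_parts(1)[OF h_in_H_N]], of c r]
        by (simp add: H_ext_def flip: pair(2)) (simp add: pair_def)
      moreover have "X1 (vf_scale (*) c (vD (cvec (bar r)) r)) = R.sc c * ha r 1"
        unfolding X1_def pair using act_scale_left[OF mem[OF H_tilde_parts(1)[OF h_in_H_N]], of c r 1]
        by (simp add: h[unfolded X1_def])
      ultimately have "br (X1 (vf_scale (*) c (vD (cvec (bar r)) r) + Y)) (R.actA g) =
          br (R.sc c * ha r 1) (R.actA g) + br (X1 Y) (R.actA g)"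
        using H_tilde_parts(1)[OF step(1)] by (simp add: add distrib_left distrib_right)
      also have "br (R.sc c * ha r 1) (R.actA g) = R.sc c * br (ha r 1) (R.actA g)"
        by (simp add: right_diff_distrib mult.assoc V.lin_sc_left[OF R.lin_actA])
      finally show ?case
        by (simp only: R.br_hh_actA step.IH R.actA_scale[symmetric] R.actA_add[symmetric]
            app_scale vf_app_add_left)
    qed
    moreover have "br (da u 1) (R.actA g) = R.actA (vf_app (vD u 0) g)" by (rule R.br_dd_actA)
    moreover have "X1 X = X1 Y + da u 1"
      unfolding Y(1) using add[OF H_tilde_parts(1)[OF Y(2)] H_tilde_parts(2)[of "vD u 0"]]
      by (simp add: d cartan_def)
    ultimately show ?thesis
      by (simp add: Y(1) vf_app_add_left R.actA_add algebra_simps)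
  qed
  have compat': "\<rho> (tens sclB (X, 0) 1) (R.actA g \<cdot> v) =
      R.actA (vf_app X g) \<cdot> v + R.actA g \<cdot> \<rho> (tens sclB (X, 0) 1) v" if X: "X \<in> H_tilde" for X g v
  proof -
    have X1: "X1 X \<cdot> w = \<rho> (tens sclB (X, 0) 1) w" for w
      unfolding X1_def using act_app[OF mem[OF X]] by (simp add: pair_def)
    have "br (X1 X) (R.actA g) \<cdot> v = R.actA (vf_app X g) \<cdot> v" by (simp only: compat[OF X])
    then show ?thesis by (simp add: X1 algebra_simps)
  qed
  have jet: "jet_action sclV (\<lambda>X. \<rho> (tens sclB (X, 0) 1)) (\<lambda>g. app (R.actA g))"
    unfolding jet_action_def
    using lm hc compat' LM.V.vector_space_axioms C.vector_space_laurent V.lin_scale[OF R.lin_actA]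
    by (auto simp: Vector_Spaces.linear_iff R.actA_one R.actA_mult R.actA_add R.actA_scale)
  have "W = {0} \<or> W = UNIV"
    if W: "LM.V.subspace W" "\<forall>X\<in>H_tilde. \<forall>w\<in>W. \<rho> (tens sclB (X, 0) 1) w \<in> W"
      "\<forall>g. \<forall>w\<in>W. R.actA g \<cdot> w \<in> W" for W
  proof (rule R.irreducible_at_one[OF W(1)])
    fix w assume w: "w \<in> W"
    show "ta r 1 \<cdot> w \<in> W" for r
    proof (cases "r = 0")
      case True
      obtain c where "ta 0 1 = R.sc c" using R.At_scalar[OF R.tt_At R.shift_tt] by blast
      then show ?thesis using True W(1) w by (simp add: LM.V.subspace_scale)
    next
      case False
      have "ta r 1 = R.actA (Poly_Mapping.single r (R.psi 1 * R.kap))"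
        by (simp add: R.actA_single R.tt_T[OF False])
      then show ?thesis using W(3) w by simp
    qed
    have "X1 X \<cdot> w \<in> W" if "X \<in> H_tilde" for X
      using W(2) w that act_app[OF mem[OF that]] by (simp add: X1_def pair_def)
    then show "ha r 1 \<cdot> w \<in> W" "da u 1 \<cdot> w \<in> W" for r u
      using H_tilde_parts(1)[OF h_in_H_N] H_tilde_parts(2)[of "vD u 0"]
      by (auto simp: X1_def pair_def ha_def da_def D_elt_def cartan_def)
  qed
  then show ?thesis
    unfolding irreducible_jet_module_def using jet R.nonzero by blast
qed

end

section \<open>The theorem\<close>

theorem theorem4p12:
  fixes sclB :: "complex \<Rightarrow> 'b::comm_ring_1 \<Rightarrow> 'b"
    and sclV :: "complex \<Rightarrow> 'v::ab_group_add \<Rightarrow> 'v"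
    and \<rho> :: "('m::finite, 'b) ext \<Rightarrow> 'v \<Rightarrow> 'v"
  assumes B: "comm_algebra sclB" "finitely_generated_algebra sclB"
    and irr: "irreducible_lie_module (ext_scale sclB) (tensor_B sclB H_ext) ext_brk sclV \<rho>"
    and bdd: "uniformly_bounded sclV (\<lambda>u. \<rho> (tens sclB (D_elt u 0) 1))"
    and nontriv: "\<exists>s. s \<noteq> 0 \<and> (\<exists>v. \<rho> (tens sclB (t_elt s) 1) v \<noteq> 0)"
    and nontriv0: "\<exists>v. \<rho> (tens sclB (t_elt 0) 1) v \<noteq> 0"
  shows "let tt = (\<lambda>r b. \<rho> (tens sclB (t_elt r) b));
             DD = (\<lambda>u r b. \<rho> (tens sclB (D_elt u r) b));
             wts = weights sclV (\<lambda>u. DD u 0 1)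
         in
    (\<exists>c. c \<noteq> 0 \<and> (\<forall>v. tt 0 1 v = sclV c v) \<and>
      (\<exists>l \<in> wts.
        let \<Lambda> = (\<chi> i. l (axis i 1));
            Vr = (\<lambda>r. {v. \<forall>u. DD u 0 1 v = sclV (dotc u (\<Lambda> + cvec r)) v})
        in
        \<comment> \<open>(1)\<close>
        is_direct_sum sclV UNIV Vr \<and>
        (\<forall>r. inj (tt r 1)) \<and>
        wts = {l'. \<exists>n :: 'm ivec. l' = (\<lambda>u. l u + (\<Sum>i\<in>UNIV. of_int (n $ i) * u $ i))} \<and>
        \<comment> \<open>(2)\<close>
        (\<exists>\<psi> \<phi> f.
          algebra_hom_to_C sclB \<psi> \<and> \<psi> 1 = 1 \<and>
          Vector_Spaces.linear sclB (*) \<phi> \<and> \<phi> 1 = 1 \<and>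
          (\<forall>b. Vector_Spaces.linear (*s) (*) (\<lambda>u. f u b)) \<and>
          (\<forall>u. Vector_Spaces.linear sclB (*) (f u)) \<and>
          (\<forall>u. f u 1 = dotc u \<Lambda>) \<and>
          (\<forall>b r v. r \<noteq> 0 \<longrightarrow> tt r b v = sclV (\<psi> b) (tt r 1 v)) \<and>
          (\<forall>b v. tt 0 b v = sclV (\<phi> b) (tt 0 1 v)) \<and>
          (\<forall>b r v. r \<noteq> 0 \<longrightarrow>
             DD (cvec (bar r)) r b v = sclV (\<psi> b) (DD (cvec (bar r)) r 1 v)) \<and>
          (\<forall>b u r. \<forall>v \<in> Vr r. DD u 0 b v = sclV (f u b + dotc u (cvec r) * \<psi> b) v) \<and>
          \<comment> \<open>(3)\<close>
          (\<exists>\<kappa> \<mu>. \<kappa> \<noteq> 0 \<and> \<mu> \<noteq> 0 \<and> \<kappa>\<^sup>2 = c * \<mu> \<and>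
            (\<forall>b b' v.
              (\<forall>m n. m \<noteq> 0 \<and> n \<noteq> 0 \<and> m + n \<noteq> 0 \<longrightarrow>
                 tt m b (tt n b' v) = sclV \<kappa> (tt (m + n) (b * b') v) \<and>
                 tt m b (tt n b' v) = sclV (\<psi> (b * b') * \<kappa>) (tt (m + n) 1 v)) \<and>
              (\<forall>m n. m \<noteq> 0 \<and> n \<noteq> 0 \<and> m + n = 0 \<longrightarrow>
                 tt m b (tt n b' v) = sclV (\<psi> (b * b') * \<mu>) (tt 0 1 v)) \<and>
              (\<forall>m. m \<noteq> 0 \<longrightarrow>
                 tt m b (tt 0 b' v) = sclV (\<psi> b * \<phi> b' * c) (tt m 1 v)) \<and>
              tt 0 b (tt 0 b' v) = sclV (\<phi> b * \<phi> b' * c) (tt 0 1 v)))))) \<and>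
    \<comment> \<open>(4)\<close>
    (\<forall>v. v \<noteq> 0 \<longrightarrow>
       U_orbit sclV (tensor_B sclB H_ext) \<rho> v = U_orbit sclV H_ext (\<lambda>x. \<rho> (tens sclB x 1)) v) \<and>
    irreducible_lie_module (ext_scale (*)) H_ext ext_brk sclV (\<lambda>x. \<rho> (tens sclB x 1)) \<and>
    uniformly_bounded sclV (\<lambda>u. DD u 0 1) \<and>
    irreducible_jet_module sclV (\<lambda>X. \<rho> (tens sclB (X, 0) 1))"
proof -
  interpret hamiltonian_module sclB sclV \<rho>
    by (rule hamiltonian_module.intro) fact+
  obtain M where "loop_rep_nontrivial sclV sclB ta ha da M" using loop_rep_of_module by blast
  then interpret R: loop_rep_nontrivial sclV sclB ta ha da M .
  have t: "\<rho> (tens sclB (t_elt r) b) = app (ta r b)"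
    and h: "\<rho> (tens sclB (D_elt (cvec (bar r)) r) b) = app (ha r b)"
    and d: "\<rho> (tens sclB (D_elt u 0) b) = app (da u b)" for r b u
    by (simp_all add: ta_def ha_def da_def act_app gens_mem fun_eq_iff)
  obtain L x where x: "x \<in> R.wsp L" "x \<noteq> 0" using R.exists_weight by blast
  define l where "l = (\<lambda>u. dotc u L)"
  have L: "(\<chi> i. l (axis i 1)) = L" by (simp add: l_def dotc_axis)
  have wsp: "{v. \<forall>u. da u 1 \<cdot> v = sclV (dotc u K) v} = R.wsp K" for K
    by (rule R.wsp_def[symmetric])
  have weights: "l' \<in> weights sclV (\<lambda>u. app (da u 1)) \<longleftrightarrow> (\<exists>n. l' = (\<lambda>u. dotc u (L + cvec n)))" for l'
  proof
    assume l': "l' \<in> weights sclV (\<lambda>u. app (da u 1))"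
    then have "l' \<in> h_dual" by (simp add: weights_def)
    then have "l' = (\<lambda>u. dotc u (\<chi> i. l' (axis i 1)))" by (intro ext h_dual_dotc)
    then obtain K where K: "l' = (\<lambda>u. dotc u K)" by blast
    then have "R.wsp K \<noteq> {0}" using l' unfolding K by (simp add: weights_def weight_space_def R.wsp_def)
    then obtain n where "K = L + cvec n" unfolding R.weights_form_coset[OF x] by auto
    then show "\<exists>n. l' = (\<lambda>u. dotc u (L + cvec n))"
      unfolding K by (intro exI[of _ n]) (rule arg_cong)
  next
    assume "\<exists>n. l' = (\<lambda>u. dotc u (L + cvec n))"
    then obtain n where n: "l' = (\<lambda>u. dotc u (L + cvec n))" by blast
    have "R.wsp (L + cvec n) \<noteq> {0}" unfolding R.weights_form_coset[OF x] by (rule exI) (rule refl)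
    then show "l' \<in> weights sclV (\<lambda>u. app (da u 1))"
      unfolding weights_def n by (auto simp: weight_space_def R.wsp_def dotc_h_dual simp del: dotc_simps)
  qed
  obtain \<phi>' where \<phi>': "\<And>b. ta 0 b = R.sc (\<phi>' b)"
    using R.At_scalar[OF R.tt_At R.shift_tt] by metis
  define c where "c = \<phi>' 1"
  define \<phi> where "\<phi> b = \<phi>' b / c" for b
  have c: "c \<noteq> 0" using R.nontriv0 \<phi>'[of 1] by (auto simp: c_def)
  have ta0: "ta 0 b = R.sc (\<phi> b * c)" for b using c by (simp add: \<phi>_def \<phi>')
  have "\<phi>' (b + b') = \<phi>' b + \<phi>' b'" "\<phi>' (sclB a b) = a * \<phi>' b" for a b b'
    using R.tt_add[of 0 b b'] R.tt_scale[of 0 a b]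
    by (simp_all add: \<phi>' R.sc_eq_iff flip: V.sc_add V.sc_mult)
  then have lin_\<phi>: "Vector_Spaces.linear sclB (*) \<phi>"
    using B.vector_space_axioms comm_algebra.axioms(1)[OF comm_algebra_complex]
    by (simp add: Vector_Spaces.linear_iff \<phi>_def add_divide_distrib)
  have hom_\<psi>: "algebra_hom_to_C sclB R.psi"
    using B.vector_space_axioms comm_algebra.axioms(1)[OF comm_algebra_complex]
    by (simp add: algebra_hom_to_C_def Vector_Spaces.linear_iff R.psi_add R.psi_scale R.psi_mult)
  obtain f where f: "\<forall>b. Vector_Spaces.linear (*s) (*) (\<lambda>u. f u b)"
    "\<forall>u. Vector_Spaces.linear sclB (*) (f u)" "\<forall>u. f u 1 = dotc u L"
    "\<forall>b u r. \<forall>w \<in> R.wsp (L + cvec r). da u b \<cdot> w = sclV (f u b + dotc u (cvec r) * R.psi b) w"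
    using R.dd_on_weight_spaces[OF x] by (elim exE conjE)
  \<comment> \<open>\<open>t\<^sup>m t\<^sup>-\<^sup>m = \<kappa>\<^sup>2\<close> has to be \<open>\<mu> t\<^sup>0 = \<mu> c\<close>\<close>
  define \<mu> where "\<mu> = R.kap\<^sup>2 / c"
  have ta: "ta r b = R.sc (R.psi b) * ta r 1" if "r \<noteq> 0" for r b by (rule R.tt_psi[OF that])
  have prod: "ta m b * ta n b' = R.sc (R.psi (b * b')) * (ta m 1 * ta n 1)" if "m \<noteq> 0" "n \<noteq> 0" for m n b b'
    unfolding ta[OF that(1), of b] ta[OF that(2), of b']
    by (simp add: mult.assoc V.lin_sc_left[OF R.lin_tt] V.sc_mult_assoc R.psi_mult)
  have monomial_products: "(m \<noteq> 0 \<and> n \<noteq> 0 \<and> m + n \<noteq> 0 \<longrightarrow>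
        ta m b \<cdot> ta n b' \<cdot> v = sclV R.kap (ta (m + n) (b * b') \<cdot> v) \<and>
        ta m b \<cdot> ta n b' \<cdot> v = sclV (R.psi (b * b') * R.kap) (ta (m + n) 1 \<cdot> v)) \<and>
      (m \<noteq> 0 \<and> n \<noteq> 0 \<and> m + n = 0 \<longrightarrow>
        ta m b \<cdot> ta n b' \<cdot> v = sclV (R.psi (b * b') * \<mu>) (ta 0 1 \<cdot> v))" for m n b b' v
  proof (intro conjI impI)
    assume mn: "m \<noteq> 0 \<and> n \<noteq> 0 \<and> m + n \<noteq> 0"
    have "ta m b * ta n b' = R.sc (R.psi (b * b') * R.kap) * ta (m + n) 1"
      using prod[of m n b b'] R.tt_mult[of m n] mn by (simp add: V.sc_mult_assoc)
    from arg_cong[OF this, of "\<lambda>g. g \<cdot> v"]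
    show 1: "ta m b \<cdot> ta n b' \<cdot> v = sclV (R.psi (b * b') * R.kap) (ta (m + n) 1 \<cdot> v)" by simp
    show "ta m b \<cdot> ta n b' \<cdot> v = sclV R.kap (ta (m + n) (b * b') \<cdot> v)"
      unfolding 1 using mn ta[of "m + n" "b * b'"] by (simp add: mult.commute)
  next
    assume mn: "m \<noteq> 0 \<and> n \<noteq> 0 \<and> m + n = 0"
    then have "n = - m" by (simp add: add_eq_0_iff)
    then have "ta m b * ta n b' = R.sc (R.psi (b * b') * R.kap\<^sup>2)"
      using prod[of m n b b'] R.tt_mult_inverse[of m] mn by (simp add: V.sc_mult)
    from arg_cong[OF this, of "\<lambda>g. g \<cdot> v"]
    show "ta m b \<cdot> ta n b' \<cdot> v = sclV (R.psi (b * b') * \<mu>) (ta 0 1 \<cdot> v)"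
      using c by (simp add: \<phi>' \<mu>_def flip: c_def)
  qed
  have central_products: "(m \<noteq> 0 \<longrightarrow> ta m b \<cdot> ta 0 b' \<cdot> v = sclV (R.psi b * \<phi> b' * c) (ta m 1 \<cdot> v)) \<and>
      ta 0 b \<cdot> ta 0 b' \<cdot> v = sclV (\<phi> b * \<phi> b' * c) (ta 0 1 \<cdot> v)" for m b b' v
    using ta[of m b] \<phi>'[of 1] c by (auto simp: ta0 V.lin_scale[OF R.lin_tt] mult_ac simp flip: c_def)
  have \<kappa>: "R.kap \<noteq> 0" "\<mu> \<noteq> 0" "R.kap\<^sup>2 = c * \<mu>" using R.kap_nonzero c by (auto simp: \<mu>_def)
  have inj: "inj (app (ta r 1))" for r
    using R.inj_tt[of r] c \<phi>'[of 1] by (cases "r = 0") (auto simp: inj_app_iff c_def)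
  have psi_h: "ha r b \<cdot> v = sclV (R.psi b) (ha r 1 \<cdot> v)" for r b v
    using arg_cong[OF R.hh_psi[of r b], of "\<lambda>g. g \<cdot> v"] by simp
  have psi_t: "ta r b \<cdot> v = sclV (R.psi b) (ta r 1 \<cdot> v)" if "r \<noteq> 0" for r b v
    using arg_cong[OF ta[OF that, of b], of "\<lambda>g. g \<cdot> v"] by simp
  have wts: "weights sclV (\<lambda>u. app (da u 1)) =
      {l'. \<exists>n :: 'm ivec. l' = (\<lambda>u. l u + (\<Sum>i\<in>UNIV. of_int (n $ i) * u $ i))}"
  proof -
    have "(\<lambda>u. l u + (\<Sum>i\<in>UNIV. of_int (n $ i) * u $ i)) = (\<lambda>u. dotc u (L + cvec n))" for n :: "'m ivec"
      by (simp add: l_def) (simp add: dotc_def cvec_def mult.commute)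
    then show ?thesis by (simp only: set_eq_iff weights mem_Collect_eq simp_thms)
  qed
  have l: "l \<in> weights sclV (\<lambda>u. app (da u 1))"
    unfolding weights l_def by (rule exI[of _ 0]) simp
  have orbit: "U_orbit sclV (tensor_B sclB H_ext) \<rho> v = U_orbit sclV H_ext (\<lambda>x. \<rho> (tens sclB x 1)) v"
    if "v \<noteq> 0" for v
    using U_orbit_irreducible[OF irr that] U_orbit_irreducible[OF irreducible_over_H_ext that] by simp
  have t0: "\<forall>b v. ta 0 b \<cdot> v = sclV (\<phi> b) (ta 0 1 \<cdot> v)" "\<forall>v. ta 0 1 \<cdot> v = sclV c v" "\<phi> 1 = 1"
    using c by (simp_all add: ta0 \<phi>_def c_def[symmetric])
  have quasi_associative: "\<exists>\<kappa> \<mu>. \<kappa> \<noteq> 0 \<and> \<mu> \<noteq> 0 \<and> \<kappa>\<^sup>2 = c * \<mu> \<and>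
      (\<forall>b b' v.
        (\<forall>m n. m \<noteq> 0 \<and> n \<noteq> 0 \<and> m + n \<noteq> 0 \<longrightarrow>
           ta m b \<cdot> ta n b' \<cdot> v = sclV \<kappa> (ta (m + n) (b * b') \<cdot> v) \<and>
           ta m b \<cdot> ta n b' \<cdot> v = sclV (R.psi (b * b') * \<kappa>) (ta (m + n) 1 \<cdot> v)) \<and>
        (\<forall>m n. m \<noteq> 0 \<and> n \<noteq> 0 \<and> m + n = 0 \<longrightarrow>
           ta m b \<cdot> ta n b' \<cdot> v = sclV (R.psi (b * b') * \<mu>) (ta 0 1 \<cdot> v)) \<and>
        (\<forall>m. m \<noteq> 0 \<longrightarrow>
           ta m b \<cdot> ta 0 b' \<cdot> v = sclV (R.psi b * \<phi> b' * c) (ta m 1 \<cdot> v)) \<and>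
        ta 0 b \<cdot> ta 0 b' \<cdot> v = sclV (\<phi> b * \<phi> b' * c) (ta 0 1 \<cdot> v))"
    by (rule exI[of _ R.kap], rule exI[of _ \<mu>])
      (intro conjI allI \<kappa> monomial_products[THEN conjunct1] monomial_products[THEN conjunct2] central_products[THEN conjunct1]
        central_products[THEN conjunct2])
  show ?thesis
    unfolding Let_def t h d
  proof (intro conjI exI[of _ c] bexI[OF _ l], unfold L wsp)
    show "is_direct_sum sclV UNIV (\<lambda>r. R.wsp (L + cvec r))" by (rule R.coset_direct_sum[OF x])
    show "\<exists>\<psi> \<phi> f.
          algebra_hom_to_C sclB \<psi> \<and> \<psi> 1 = 1 \<and>
          Vector_Spaces.linear sclB (*) \<phi> \<and> \<phi> 1 = 1 \<and>
          (\<forall>b. Vector_Spaces.linear (*s) (*) (\<lambda>u. f u b)) \<and>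
          (\<forall>u. Vector_Spaces.linear sclB (*) (f u)) \<and>
          (\<forall>u. f u 1 = dotc u L) \<and>
          (\<forall>b r v. r \<noteq> 0 \<longrightarrow> ta r b \<cdot> v = sclV (\<psi> b) (ta r 1 \<cdot> v)) \<and>
          (\<forall>b v. ta 0 b \<cdot> v = sclV (\<phi> b) (ta 0 1 \<cdot> v)) \<and>
          (\<forall>b r v. r \<noteq> 0 \<longrightarrow> ha r b \<cdot> v = sclV (\<psi> b) (ha r 1 \<cdot> v)) \<and>
          (\<forall>b u r. \<forall>v \<in> R.wsp (L + cvec r). da u b \<cdot> v = sclV (f u b + dotc u (cvec r) * \<psi> b) v) \<and>
          (\<exists>\<kappa> \<mu>. \<kappa> \<noteq> 0 \<and> \<mu> \<noteq> 0 \<and> \<kappa>\<^sup>2 = c * \<mu> \<and>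
            (\<forall>b b' v.
              (\<forall>m n. m \<noteq> 0 \<and> n \<noteq> 0 \<and> m + n \<noteq> 0 \<longrightarrow>
                 ta m b \<cdot> ta n b' \<cdot> v = sclV \<kappa> (ta (m + n) (b * b') \<cdot> v) \<and>
                 ta m b \<cdot> ta n b' \<cdot> v = sclV (\<psi> (b * b') * \<kappa>) (ta (m + n) 1 \<cdot> v)) \<and>
              (\<forall>m n. m \<noteq> 0 \<and> n \<noteq> 0 \<and> m + n = 0 \<longrightarrow>
                 ta m b \<cdot> ta n b' \<cdot> v = sclV (\<psi> (b * b') * \<mu>) (ta 0 1 \<cdot> v)) \<and>
              (\<forall>m. m \<noteq> 0 \<longrightarrow>
                 ta m b \<cdot> ta 0 b' \<cdot> v = sclV (\<psi> b * \<phi> b' * c) (ta m 1 \<cdot> v)) \<and>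
              ta 0 b \<cdot> ta 0 b' \<cdot> v = sclV (\<phi> b * \<phi> b' * c) (ta 0 1 \<cdot> v)))"
      by (rule exI[of _ R.psi], rule exI[of _ \<phi>], rule exI[of _ f],
          intro conjI hom_\<psi> R.psi_one lin_\<phi> f quasi_associative t0)
        (intro allI impI psi_t psi_h, assumption?)+
  qed (rule c t0 wts irreducible_over_H_ext irreducible_jet bdd[unfolded d]
      | intro allI impI inj orbit, assumption?)+
qed

end
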